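(* Let $f\in\mathcal{H}^1$. For any given $(w_\bullet,p_\bullet)\in\mathcal{O}\times\mathcal{H}^{1,+}_0$ there exist an open neighborhood $\mathcal{V}$ of $(w_\bullet,p_\bullet)$ in $\mathcal{O}\times\mathcal{H}^{1,+}_0$ and $T>0$ such that for any initial data $(w_0,p_0)\in\mathcal{V}$ there exists a unique solution $(w,p)\in C^\ell\big([0,T),\mathcal{O}\times\mathcal{H}^{1,+}_0\big)$, for all $\ell\ge1$, of the Hamiltonian equation $(\dot w,\dot p)=X_{H_f}(w,p)$ with $(w,p)|_{t=0}=(w_0,p_0)$. The solution depends continuously on the initial data in the sense that, for every $\ell\ge 1$, the data-to-solution map $\mathcal{V}\to C^\ell\big([0,T),\mathcal{O}\times\mathcal{H}^{1,+}_0\big)$, $(w_0,p_0)\mapsto(w,p)$, is continuous. The same holds with $H_f$ replaced by $J^f_k$ for any $k\ge1$, and with $H_f$ replaced by $J^f(\mu)$ for any $\mu\in\mathbb{D}$.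
   Context: All spaces are complex. $\mathbb{T}=\mathbb{R}/\mathbb{Z}$, $\mathbb{D}=\{z\in\mathbb{C}:|z|<1\}$, $f_k=(f)_k=\int_0^1 f(y)e^{-2\pi i k y}\,dy$ are Fourier coefficients, $\langle k\rangle:=|k|$ for $k\neq0$, $\langle0\rangle:=1$. $\mathcal{H}^1$ is the Hilbert space of functions $f:\mathbb{T}\to\mathbb{C}$ with $\|f\|_{\mathcal{H}^1}=(\sum_{k\in\mathbb{Z}}|f_k|^2\langle k\rangle^2)^{1/2}<\infty$ (a Banach algebra). $\mathcal{H}^{1,+}=\{f\in\mathcal{H}^1: f_k=0 \text{ for } k<0\}$, $\mathcal{H}^{1,+}_0=\{f\in\mathcal{H}^1: f_k=0\text{ for }k\le 0\}$, with Fourier-truncation projections $\Pi^+,\Pi^+_0$. The bilinear pairing is $\langle f,g\rangle=\sum_{k\in\mathbb{Z}}f_kg_k$, and $\check f(y):=f(-y)$. $\mathcal{O}:=\{w\in\mathcal{H}^{1,+}_0: w(y)\ne0\ \forall y\in\mathbb{T}\}$ (open in $\mathcal{H}^{1,+}_0$). Shift: $(Lf)(y)=f(y)e^{-2\pi i y}$. For $w\in\mathcal{H}^{1,+}_0$, $k\ge1$: $A_k(w)g=g\,\Pi^+(L^{k+1}w)-w\,\Pi^+(L^{k+1}g)$, $\Gamma(w)p=\Pi^+_0(w\check p)$, $I_k(w,p)=\langle A_k(w)\Gamma(w)p,p\rangle$. For $(w,p)\in\mathcal{O}\times\mathcal{H}^{1,+}_0$: $H_f(w,p)=\langle w,p^2\rangle+\int_0^1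 f(y)/w(y)\,dy$; $J^f_k(w,p)=I_k(w,p)-\big(w\,\Pi^+_0(f/w)\big)_{k+1}$; $J^f(\mu)(w,p)=\sum_{k\ge1}J^f_k(w,p)\mu^k$ (the series converges). For a $C^1$ function $F$ on $\mathcal{O}\times\mathcal{H}^{1,+}_0$, $X_F=(\nabla_pF,-\nabla_wF)$, where the gradients are determined by $\langle\nabla_wF,\delta w\rangle=(D_1F)(\delta w)$, $\langle\nabla_pF,\delta p\rangle=(D_2F)(\delta p)$ for all $\delta w,\delta p\in\mathcal{H}^{1,+}_0$ ($D_1,D_2$ partial differentials); the Hamiltonian equation of $F$ is $(\dot w,\dot p)=X_F(w,p)$. For all the functions above, $X_F$ takes values in $\mathcal{H}^{1,+}_0\times\mathcal{H}^{1,+}_0$. The topology on $C^\ell([0,T),\cdot)$ is that of uniform convergence of derivatives of order $\le\ell$ on compact subsets of $[0,T)$. *)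

theory Defs
  imports "HOL-Analysis.Analysis"
begin

text \<open>Functions on \<open>\<real>/\<int>\<close> are 1-periodic functions on the real line.\<close>

definition fourier_coeff :: "(real \<Rightarrow> complex) \<Rightarrow> int \<Rightarrow> complex" where
  "fourier_coeff f k = integral {0..1} (\<lambda>y. f y * exp (- 2 * pi * \<i> * of_int k * of_real y))"

definition jap :: "int \<Rightarrow> real" where
  "jap k = (if k = 0 then 1 else \<bar>real_of_int k\<bar>)"

text \<open>Finiteness of the \<open>\<H>\<^sup>1\<close>-norm makes the Fourier coefficients absolutely summable, so
  every class of almost everywhere equal functions in \<open>\<H>\<^sup>1\<close> has exactly one continuous
  representative; the elements of \<open>\<H>\<^sup>1\<close> are taken to be these representatives.\<close>

definition H1 :: "(real \<Rightarrow> complex) set" where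
  "H1 = {f. continuous_on UNIV f \<and> (\<forall>y. f (y + 1) = f y) \<and>
            (\<lambda>k. (cmod (fourier_coeff f k))\<^sup>2 * (jap k)\<^sup>2) summable_on UNIV}"

definition H1_norm :: "(real \<Rightarrow> complex) \<Rightarrow> real" where
  "H1_norm f = sqrt (\<Sum>\<^sub>\<infinity>k. (cmod (fourier_coeff f k))\<^sup>2 * (jap k)\<^sup>2)"

definition proj_nonneg :: "(real \<Rightarrow> complex) \<Rightarrow> real \<Rightarrow> complex" where
  "proj_nonneg f y = (\<Sum>\<^sub>\<infinity>k\<in>{0..}. fourier_coeff f k * exp (2 * pi * \<i> * of_int k * of_real y))"

definition proj_pos :: "(real \<Rightarrow> complex) \<Rightarrow> real \<Rightarrow> complex" where
  "proj_pos f y = (\<Sum>\<^sub>\<infinity>k\<in>{1..}. fourier_coeff f k * exp (2 * pi * \<i> * of_int k * of_real y))"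

text \<open>The pairing is bilinear, not sesquilinear.\<close>

definition pairing :: "(real \<Rightarrow> complex) \<Rightarrow> (real \<Rightarrow> complex) \<Rightarrow> complex" where
  "pairing f g = (\<Sum>\<^sub>\<infinity>k. fourier_coeff f k * fourier_coeff g k)"

definition shift :: "(real \<Rightarrow> complex) \<Rightarrow> real \<Rightarrow> complex" where
  "shift f y = f y * exp (- 2 * pi * \<i> * of_real y)"

lemma fourier_coeff_integrable:
  assumes "continuous_on UNIV f"
  shows "(\<lambda>y. f y * exp (- 2 * pi * \<i> * of_int k * of_real y)) integrable_on {0..1}"
  by (intro integrable_continuous_real continuous_intros continuous_on_subset[OF assms]) auto

lemma fourier_coeff_add:
  assumes "continuous_on UNIV f" "continuous_on UNIV g"
  shows "fourier_coeff (\<lambda>y. f y + g y) k = fourier_coeff f k + fourier_coeff g k"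
  using fourier_coeff_integrable[OF assms(1)] fourier_coeff_integrable[OF assms(2)]
  by (simp add: fourier_coeff_def distrib_right integral_add)

lemma fourier_coeff_cmult: "fourier_coeff (\<lambda>y. c * f y) k = c * fourier_coeff f k"
  by (simp add: fourier_coeff_def mult.assoc)

lemma fourier_coeff_zero [simp]: "fourier_coeff (\<lambda>y. 0) k = 0"
  by (simp add: fourier_coeff_def)

lemma fourier_coeff_exp:
  "fourier_coeff (\<lambda>y. exp (2 * pi * \<i> * of_int m * of_real y) * f y) k = fourier_coeff f (k - m)"
proof -
  have "exp (2 * pi * \<i> * of_int m * of_real y) * f y * exp (- 2 * pi * \<i> * of_int k * of_real y)
      = f y * exp (- 2 * pi * \<i> * of_int (k - m) * of_real y)" for y :: real
    by (simp add: exp_add[symmetric] algebra_simps)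
  then show ?thesis by (simp only: fourier_coeff_def)
qed

lemma fourier_coeff_zero_mult_polynomial:
  assumes "real_polynomial_function q"
  shows "\<And>h. continuous_on UNIV h \<Longrightarrow> (\<forall>k. fourier_coeff h k = 0) \<Longrightarrow>
     continuous_on UNIV (\<lambda>y. of_real (q (exp (2 * pi * \<i> * of_real y))) * h y :: complex) \<and>
     (\<forall>k. fourier_coeff (\<lambda>y. of_real (q (exp (2 * pi * \<i> * of_real y))) * h y) k = 0)"
  using assms
proof (induction rule: real_polynomial_function.induct)
  case (linear q)
  interpret q: bounded_linear q by fact
  let ?e = "\<lambda>y::real. exp (2 * pi * \<i> * of_real y)"
  define a where "a = (of_real (q 1) - \<i> * of_real (q \<i>)) / 2"
  define b where "b = (of_real (q 1) + \<i> * of_real (q \<i>)) / 2"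
  have q: "q z = Re z * q 1 + Im z * q \<i>" for z
  proof -
    have "q z = q (Re z *\<^sub>R 1 + Im z *\<^sub>R \<i>)"
      by (rule arg_cong[where f=q]) (simp add: complex_eq_iff)
    then show ?thesis by (simp add: q.add q.scaleR)
  qed
  have inv: "exp (2 * pi * \<i> * of_int (-1) * of_real y) = cnj (?e y)" for y
    by (simp add: exp_cnj)
  have eq: "(\<lambda>y. of_real (q (?e y)) * h y) =
     (\<lambda>y. a * (exp (2 * pi * \<i> * of_int 1 * of_real y) * h y)
        + b * (exp (2 * pi * \<i> * of_int (-1) * of_real y) * h y))"
  proof
    fix y
    have "of_real (Re E * q 1 + Im E * q \<i>) = a * E + b * cnj E" for E
      by (simp add: a_def b_def complex_eq_iff field_simps)
    from this[of "?e y"]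
    show "of_real (q (?e y)) * h y =
        a * (exp (2 * pi * \<i> * of_int 1 * of_real y) * h y)
        + b * (exp (2 * pi * \<i> * of_int (-1) * of_real y) * h y)"
      unfolding inv q[of "?e y"] by (simp add: distrib_right mult.assoc)
  qed
  have cont: "continuous_on UNIV (\<lambda>y. c * (exp (2 * pi * \<i> * of_int m * of_real y) * h y))" for c m
    by (intro continuous_intros linear(2))
  show ?case
    unfolding eq
    by (simp only: fourier_coeff_add[OF cont cont] fourier_coeff_cmult fourier_coeff_exp
          continuous_on_add[OF cont cont]) (use linear(3) in simp)
next
  case (const c)
  then show ?case by (auto intro!: continuous_intros simp: fourier_coeff_cmult)
next
  case (add f g)
  show ?case
    using add.IH(1)[OF add.prems] add.IH(2)[OF add.prems]
    by (simp add: distrib_right continuous_on_add fourier_coeff_add)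
next
  case (mult f g)
  show ?case
    using mult.IH(1)[OF conjunct1[OF mult.IH(2)[OF mult.prems]] conjunct2[OF mult.IH(2)[OF mult.prems]]]
    by (simp add: mult.assoc)
qed

lemma circle_lift:
  fixes f :: "real \<Rightarrow> complex"
  assumes "continuous_on UNIV f" "f 1 = f 0"
  shows "continuous_on (sphere 0 1) (f \<circ> (\<lambda>z. Arg2pi z / (2 * pi)))"
proof -
  have "homotopic_loops UNIV f f"
    using assms by (auto simp: homotopic_loops_refl path_def pathstart_def pathfinish_def
        intro: continuous_on_subset)
  from homotopic_with_imp_continuous[OF homotopic_loops_imp_homotopic_circlemaps[OF this]]
  show ?thesis by simp
qed

theorem fourier_coeff_unique:
  assumes cont: "continuous_on UNIV f" and per: "\<And>y. f (y + 1) = f y"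
    and zero: "\<And>k. fourier_coeff f k = 0"
  shows "f = (\<lambda>y. 0)"
proof -
  let ?e = "\<lambda>y::real. exp (2 * pi * \<i> * of_real y)"
  let ?F = "f \<circ> (\<lambda>z. Arg2pi z / (2 * pi))"
  have f10: "f 1 = f 0" using per[of 0] by simp
  have Fe: "?F (?e y) = f y" if "y \<in> {0..1}" for y
  proof (cases "y = 1")
    case True
    have "?e 1 = 1" by (simp add: exp_two_pi_i)
    then show ?thesis using True f10 Arg2pi_unique[of 1 0 1] by simp
  next
    case False
    then have "Arg2pi (?e y) = 2 * pi * y"
      using that by (intro Arg2pi_unique[of 1]) (auto simp: mult_ac)
    then show ?thesis by simp
  qed
  have contI: "continuous_on {0..1} f" by (rule continuous_on_subset[OF cont]) auto
  have n2: "integral {0..1} (\<lambda>y. (cmod (f y))\<^sup>2) \<le> e * integral {0..1} (\<lambda>y. cmod (f y))" if "e > 0" for e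
  proof -
    obtain g where g: "polynomial_function g" "\<And>z. z \<in> sphere 0 1 \<Longrightarrow> cmod (?F z - g z) < e"
      using Stone_Weierstrass_polynomial_function[OF compact_sphere circle_lift[OF cont f10] \<open>e > 0\<close>]
      by blast
    have rp: "real_polynomial_function (Re \<circ> g)" "real_polynomial_function (Im \<circ> g)"
      using g(1) bounded_linear_Re bounded_linear_Im by (auto simp: polynomial_function_def)
    have z1: "fourier_coeff (\<lambda>y. of_real ((Re \<circ> g) (?e y)) * f y) 0 = 0"
      using fourier_coeff_zero_mult_polynomial[OF rp(1) cont] zero by blast
    have z2: "fourier_coeff (\<lambda>y. of_real ((Im \<circ> g) (?e y)) * f y) 0 = 0"
      using fourier_coeff_zero_mult_polynomial[OF rp(2) cont] zero by blast
    have c1: "continuous_on UNIV (\<lambda>y. of_real ((Re \<circ> g) (?e y)) * f y)"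
      using fourier_coeff_zero_mult_polynomial[OF rp(1) cont] zero by blast
    have c2: "continuous_on UNIV (\<lambda>y. of_real ((Im \<circ> g) (?e y)) * f y)"
      using fourier_coeff_zero_mult_polynomial[OF rp(2) cont] zero by blast
    have ge: "continuous_on {0..1} (\<lambda>y. g (?e y))"
      by (rule continuous_on_compose2[OF continuous_on_polymonial_function[OF g(1), of UNIV]])
        (auto intro!: continuous_intros)
    have eq: "(\<lambda>y. cnj (g (?e y)) * f y) = (\<lambda>y. of_real ((Re \<circ> g) (?e y)) * f y
            + (- \<i>) * (of_real ((Im \<circ> g) (?e y)) * f y))"
      by (auto simp: complex_eq_iff)
    have "fourier_coeff (\<lambda>y. cnj (g (?e y)) * f y) 0 = 0"
      unfolding eq
      using z1 z2 by (subst fourier_coeff_add[OF c1 continuous_on_mult_left[OF c2]])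
        (simp only: fourier_coeff_cmult mult_zero_right add_0)
    then have z: "integral {0..1} (\<lambda>y. cnj (g (?e y)) * f y) = 0"
      by (simp add: fourier_coeff_def)
    have cg: "continuous_on {0..1} (\<lambda>y. cnj (g (?e y)) * f y)"
      by (intro continuous_on_mult continuous_on_cnj ge contI)
    have cf: "continuous_on {0..1} (\<lambda>y. cnj (f y) * f y)"
      by (intro continuous_on_mult continuous_on_cnj contI)
    have "complex_of_real (integral {0..1} (\<lambda>y. (cmod (f y))\<^sup>2)) = integral {0..1} (\<lambda>y. cnj (f y) * f y)"
    proof -
      have "((\<lambda>y. (cmod (f y))\<^sup>2) has_integral integral {0..1} (\<lambda>y. (cmod (f y))\<^sup>2)) {0..1}"
        by (intro integrable_integral integrable_continuous_real continuous_intros contI)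
      from has_integral_linear[OF this, of complex_of_real]
      have "((\<lambda>y. cnj (f y) * f y) has_integral complex_of_real (integral {0..1} (\<lambda>y. (cmod (f y))\<^sup>2))) {0..1}"
        by (simp add: bounded_linear_of_real o_def complex_norm_square mult.commute del: of_real_power)
      then show ?thesis by (simp add: integral_unique)
    qed
    also have "\<dots> = integral {0..1} (\<lambda>y. cnj (f y) * f y - cnj (g (?e y)) * f y)"
      using z by (subst integral_diff[OF integrable_continuous_real[OF cf] integrable_continuous_real[OF cg]])
        simp
    finally have "integral {0..1} (\<lambda>y. (cmod (f y))\<^sup>2)
        \<le> cmod (integral {0..1} (\<lambda>y. cnj (f y) * f y - cnj (g (?e y)) * f y))"
      by (metis norm_of_real abs_ge_self)
    also have "\<dots> \<le> integral {0..1} (\<lambda>y. e * cmod (f y))"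
    proof (rule integral_norm_bound_integral)
      show "(\<lambda>y. cnj (f y) * f y - cnj (g (?e y)) * f y) integrable_on {0..1}"
        by (intro integrable_continuous_real continuous_on_diff cf cg)
      show "(\<lambda>y. e * cmod (f y)) integrable_on {0..1}"
        by (auto intro!: integrable_continuous_real continuous_intros contI)
      fix y :: real assume y: "y \<in> {0..1}"
      have "cmod (f y - g (?e y)) < e" using g(2)[of "?e y"] Fe[OF y] by simp
      moreover have "cnj (f y) * f y - cnj (g (?e y)) * f y = cnj (f y - g (?e y)) * f y"
        by (simp add: algebra_simps)
      ultimately show "cmod (cnj (f y) * f y - cnj (g (?e y)) * f y) \<le> e * cmod (f y)"
        by (simp only: norm_mult complex_mod_cnj) (intro mult_right_mono, auto)
    qed
    finally show ?thesis by simp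
  qed
  have "integral {0..1} (\<lambda>y. (cmod (f y))\<^sup>2) \<le> 0"
  proof (rule tendsto_lowerbound)
    show "((\<lambda>e. e * integral {0..1} (\<lambda>y. cmod (f y))) \<longlongrightarrow> 0) (at_right 0)"
      by (auto intro!: tendsto_eq_intros)
    show "\<forall>\<^sub>F e in at_right 0. integral {0..1} (\<lambda>y. (cmod (f y))\<^sup>2) \<le> e * integral {0..1} (\<lambda>y. cmod (f y))"
      by (rule eventually_at_rightI[of 0 1]) (auto intro: n2)
  qed simp
  moreover have "integral {0..1} (\<lambda>y. (cmod (f y))\<^sup>2) \<ge> 0"
    by (intro integral_nonneg integrable_continuous_real continuous_intros contI) auto
  ultimately have I0: "integral (cbox 0 1) (\<lambda>y. (cmod (f y))\<^sup>2) = 0" by simp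
  have c2: "continuous_on {0..1} (\<lambda>y. (cmod (f y))\<^sup>2)"
    by (intro continuous_intros contI)
  then have "((\<lambda>y. (cmod (f y))\<^sup>2) has_integral 0) (cbox 0 1)"
    using integrable_integral[OF integrable_continuous_real[OF c2]] I0 by simp
  then have f0: "f y = 0" if "y \<in> {0..1}" for y
    using has_integral_0_cbox_imp_0[of 0 1 "\<lambda>y. (cmod (f y))\<^sup>2" y] that c2 by simp
  have pern: "f (y + real n) = f y" for y n
  proof (induction n)
    case (Suc n)
    show ?case using per[of "y + real n"] Suc by (simp add: add_ac)
  qed simp
  have "f y = 0" for y
  proof -
    have "f (frac y) = 0" by (intro f0) (auto simp: frac_lt_1 less_imp_le)
    moreover have "f (frac y) = f y"
    proof (cases "\<lfloor>y\<rfloor> \<ge> 0")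
      case True
      then have "y = frac y + real (nat \<lfloor>y\<rfloor>)" by (simp add: frac_def)
      then show ?thesis using pern by metis
    next
      case False
      then have "frac y = y + real (nat (- \<lfloor>y\<rfloor>))" by (simp add: frac_def)
      then show ?thesis using pern by metis
    qed
    ultimately show ?thesis by simp
  qed
  then show ?thesis by auto
qed

lemma jap_nonneg: "jap k \<ge> 0" and jap_pos: "jap k > 0"
  by (auto simp: jap_def)

lemma H1_zero: "(\<lambda>y. 0) \<in> H1"
  by (simp add: H1_def)

lemma H1_continuous: "f \<in> H1 \<Longrightarrow> continuous_on UNIV f"
  by (simp add: H1_def)

lemma H1_cmult: "f \<in> H1 \<Longrightarrow> (\<lambda>y. c * f y) \<in> H1"
  by (auto simp: H1_def fourier_coeff_cmult norm_mult power_mult_distrib mult.assoc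
      intro!: continuous_intros summable_on_cmult_right)

lemma H1_norm_eq: "f \<in> H1 \<Longrightarrow> finite F \<Longrightarrow>
    L2_set (\<lambda>k. cmod (fourier_coeff f k) * jap k) F \<le> H1_norm f"
  unfolding L2_set_def H1_norm_def
  by (intro real_sqrt_le_mono)
     (auto simp: H1_def power_mult_distrib intro!: finite_sum_le_infsum)

lemma H1_norm_nonneg: "H1_norm f \<ge> 0"
  by (simp add: H1_norm_def infsum_nonneg)

lemma H1_add_aux:
  assumes f: "f \<in> H1" and g: "g \<in> H1" and F: "finite F"
  shows "(\<Sum>k\<in>F. (cmod (fourier_coeff (\<lambda>y. f y + g y) k))\<^sup>2 * (jap k)\<^sup>2) \<le> (H1_norm f + H1_norm g)\<^sup>2"
proof -
  have c: "continuous_on UNIV f" "continuous_on UNIV g" using f g by (auto simp: H1_def)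
  have "L2_set (\<lambda>k. cmod (fourier_coeff (\<lambda>y. f y + g y) k) * jap k) F
     \<le> L2_set (\<lambda>k. cmod (fourier_coeff f k) * jap k + cmod (fourier_coeff g k) * jap k) F"
    by (intro L2_set_mono)
       (auto simp: fourier_coeff_add[OF c] distrib_right[symmetric] jap_nonneg
         intro!: mult_right_mono norm_triangle_ineq)
  also have "\<dots> \<le> H1_norm f + H1_norm g"
    by (rule order_trans[OF L2_set_triangle_ineq add_mono]) (auto intro: H1_norm_eq f g F)
  finally have "(L2_set (\<lambda>k. cmod (fourier_coeff (\<lambda>y. f y + g y) k) * jap k) F)\<^sup>2 \<le> (H1_norm f + H1_norm g)\<^sup>2"
    by (intro power_mono) auto
  then show ?thesis by (simp add: L2_set_def sum_nonneg power_mult_distrib)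
qed

lemma H1_add:
  assumes f: "f \<in> H1" and g: "g \<in> H1"
  shows "(\<lambda>y. f y + g y) \<in> H1"
proof -
  have "(\<lambda>k. (cmod (fourier_coeff (\<lambda>y. f y + g y) k))\<^sup>2 * (jap k)\<^sup>2) summable_on UNIV"
    by (rule nonneg_bdd_above_summable_on) (auto intro!: bdd_aboveI2 H1_add_aux[OF f g])
  then show ?thesis using f g by (auto simp: H1_def intro!: continuous_intros)
qed

lemma H1_norm_triangle:
  assumes f: "f \<in> H1" and g: "g \<in> H1"
  shows "H1_norm (\<lambda>y. f y + g y) \<le> H1_norm f + H1_norm g"
proof -
  have "(\<Sum>\<^sub>\<infinity>k. (cmod (fourier_coeff (\<lambda>y. f y + g y) k))\<^sup>2 * (jap k)\<^sup>2) \<le> (H1_norm f + H1_norm g)\<^sup>2"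
    using H1_add[OF f g] by (intro infsum_le_finite_sums H1_add_aux[OF f g]) (auto simp: H1_def)
  then show ?thesis
    unfolding H1_norm_def[of "\<lambda>y. f y + g y"]
    by (intro real_le_lsqrt) (auto intro!: H1_norm_nonneg add_nonneg_nonneg)
qed

lemma H1_norm_cmult: "H1_norm (\<lambda>y. c * f y) = cmod c * H1_norm f"
  by (simp add: H1_norm_def fourier_coeff_cmult norm_mult power_mult_distrib mult.assoc
      infsum_cmult_right' real_sqrt_mult)

lemma H1_norm_eq_0:
  assumes f: "f \<in> H1"
  shows "H1_norm f = 0 \<longleftrightarrow> f = (\<lambda>y. 0)"
proof
  assume "H1_norm f = 0"
  then have "(\<Sum>\<^sub>\<infinity>k. (cmod (fourier_coeff f k))\<^sup>2 * (jap k)\<^sup>2) \<le> 0" by (simp add: H1_norm_def)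
  from nonneg_infsum_le_0D[OF this] have "(cmod (fourier_coeff f k))\<^sup>2 * (jap k)\<^sup>2 = 0" for k
    using f by (simp add: H1_def)
  then have "fourier_coeff f k = 0" for k
    using jap_pos[of k] by (metis less_irrefl mult_eq_0_iff norm_eq_zero power_eq_0_iff)
  then show "f = (\<lambda>y. 0)"
    using f by (intro fourier_coeff_unique) (auto simp: H1_def)
qed (simp add: H1_norm_def)

typedef hardy = "{f \<in> H1. \<forall>k\<le>0. fourier_coeff f k = 0}"
  morphisms fun_of Abs_hardy
  by (rule exI[of _ "\<lambda>y. 0"]) (simp add: H1_zero)

setup_lifting type_definition_hardy

lemma fun_of_H1: "fun_of u \<in> H1"
  using fun_of by blast

instantiation hardy :: real_normed_vector
begin

lift_definition zero_hardy :: hardy is "\<lambda>y. 0"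
  by (simp add: H1_zero)

lift_definition plus_hardy :: "hardy \<Rightarrow> hardy \<Rightarrow> hardy" is "\<lambda>f g y. f y + g y"
  by (simp add: H1_add fourier_coeff_add H1_continuous)

lift_definition scaleR_hardy :: "real \<Rightarrow> hardy \<Rightarrow> hardy" is "\<lambda>r f y. of_real r * f y"
  by (auto simp: H1_cmult fourier_coeff_cmult)

lift_definition uminus_hardy :: "hardy \<Rightarrow> hardy" is "\<lambda>f y. - f y"
  subgoal for f
    using H1_cmult[of f "-1"] fourier_coeff_cmult[of "-1" f] by auto
  done

definition minus_hardy :: "hardy \<Rightarrow> hardy \<Rightarrow> hardy" where
  "minus_hardy u v = u + (- v)"

lift_definition norm_hardy :: "hardy \<Rightarrow> real" is H1_norm .

definition dist_hardy :: "hardy \<Rightarrow> hardy \<Rightarrow> real" where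
  "dist_hardy u v = norm (u - v)"

definition sgn_hardy :: "hardy \<Rightarrow> hardy" where
  "sgn_hardy u = inverse (norm u) *\<^sub>R u"

definition uniformity_hardy :: "(hardy \<times> hardy) filter" where
  "uniformity_hardy = (INF e\<in>{0<..}. principal {(u, v). dist u v < e})"

definition open_hardy :: "hardy set \<Rightarrow> bool" where
  "open_hardy U = (\<forall>u\<in>U. \<forall>\<^sub>F (u', v) in uniformity. u' = u \<longrightarrow> v \<in> U)"

instance
proof
  fix a b :: real and u v w :: hardy
  show "u + v + w = u + (v + w)" by transfer (simp add: add.assoc)
  show "u + v = v + u" by transfer (simp add: add.commute)
  show "0 + u = u" by transfer simp
  show "- u + u = 0" by transfer simp
  show "u - v = u + - v" by (simp add: minus_hardy_def)
  show "a *\<^sub>R (u + v) = a *\<^sub>R u + a *\<^sub>R v" by transfer (simp add: distrib_left)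
  show "(a + b) *\<^sub>R u = a *\<^sub>R u + b *\<^sub>R u" by transfer (simp add: distrib_right)
  show "a *\<^sub>R b *\<^sub>R u = (a * b) *\<^sub>R u" by transfer (simp add: mult.assoc)
  show "1 *\<^sub>R u = u" by transfer simp
  show "dist u v = norm (u - v)" by (simp add: dist_hardy_def)
  show "sgn u = inverse (norm u) *\<^sub>R u" by (simp add: sgn_hardy_def)
  show "(uniformity :: (hardy \<times> hardy) filter) = (INF e\<in>{0<..}. principal {(u, v). dist u v < e})"
    by (simp add: uniformity_hardy_def)
  show "open U = (\<forall>u\<in>U. \<forall>\<^sub>F (u', v) in uniformity. u' = u \<longrightarrow> v \<in> U)" for U :: "hardy set"
    by (simp add: open_hardy_def)
  show "norm u = 0 \<longleftrightarrow> u = 0" by transfer (simp add: H1_norm_eq_0)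
  show "norm (u + v) \<le> norm u + norm v" by transfer (simp add: H1_norm_triangle)
  show "norm (a *\<^sub>R u) = \<bar>a\<bar> * norm u" by transfer (simp add: H1_norm_cmult)
qed

end

definition nonvanishing :: "hardy set" where
  "nonvanishing = {w. \<forall>y. fun_of w y \<noteq> 0}"

definition A_op :: "nat \<Rightarrow> (real \<Rightarrow> complex) \<Rightarrow> (real \<Rightarrow> complex) \<Rightarrow> real \<Rightarrow> complex" where
  "A_op k w g y = g y * proj_nonneg ((shift ^^ (k + 1)) w) y
                - w y * proj_nonneg ((shift ^^ (k + 1)) g) y"

definition Gamma_op :: "(real \<Rightarrow> complex) \<Rightarrow> (real \<Rightarrow> complex) \<Rightarrow> real \<Rightarrow> complex" where
  "Gamma_op w p = proj_pos (\<lambda>y. w y * p (- y))"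

definition I_fun :: "nat \<Rightarrow> (real \<Rightarrow> complex) \<Rightarrow> (real \<Rightarrow> complex) \<Rightarrow> complex" where
  "I_fun k w p = pairing (A_op k w (Gamma_op w p)) p"

text \<open>The values of the following functions are relevant only on
  \<open>nonvanishing \<times> UNIV\<close>, which is open in \<open>hardy \<times> hardy\<close>.\<close>

definition H_ham :: "(real \<Rightarrow> complex) \<Rightarrow> hardy \<Rightarrow> hardy \<Rightarrow> complex" where
  "H_ham f w p = pairing (fun_of w) (\<lambda>y. (fun_of p y)\<^sup>2) + integral {0..1} (\<lambda>y. f y / fun_of w y)"

definition J_ham :: "(real \<Rightarrow> complex) \<Rightarrow> nat \<Rightarrow> hardy \<Rightarrow> hardy \<Rightarrow> complex" where
  "J_ham f k w p = I_fun k (fun_of w) (fun_of p)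
     - fourier_coeff (\<lambda>y. fun_of w y * proj_pos (\<lambda>x. f x / fun_of w x) y) (int k + 1)"

definition J_gen :: "(real \<Rightarrow> complex) \<Rightarrow> complex \<Rightarrow> hardy \<Rightarrow> hardy \<Rightarrow> complex" where
  "J_gen f \<mu> w p = (\<Sum>k. J_ham f (Suc k) w p * \<mu> ^ Suc k)"

text \<open>Derivatives are Frechet derivatives over the reals; the gradient
  condition forces them to be complex linear, since the pairing is complex bilinear.\<close>

definition is_gradient_at :: "(hardy \<Rightarrow> complex) \<Rightarrow> hardy \<Rightarrow> hardy \<Rightarrow> bool" where
  "is_gradient_at G u g \<longleftrightarrow> (G has_derivative (\<lambda>\<delta>. pairing (fun_of g) (fun_of \<delta>))) (at u)"

text \<open>\<open>is_ham_vector F (w, p) v\<close> says that the gradients of \<open>F\<close> at \<open>(w, p)\<close> exist in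
  \<open>hardy\<close> and that \<open>v\<close> is \<open>X\<^sub>F (w, p)\<close>.\<close>

definition is_ham_vector :: "(hardy \<Rightarrow> hardy \<Rightarrow> complex) \<Rightarrow> hardy \<times> hardy \<Rightarrow> hardy \<times> hardy \<Rightarrow> bool" where
  "is_ham_vector F z v \<longleftrightarrow>
     (\<exists>gw gp. is_gradient_at (\<lambda>w. F w (snd z)) (fst z) gw \<and>
              is_gradient_at (\<lambda>p. F (fst z) p) (snd z) gp \<and> v = (gp, - gw))"

definition ham_solution ::
  "(hardy \<Rightarrow> hardy \<Rightarrow> complex) \<Rightarrow> real \<Rightarrow> hardy \<times> hardy \<Rightarrow> (real \<Rightarrow> hardy \<times> hardy) \<Rightarrow> bool" where
  "ham_solution F T z\<^sub>0 u \<longleftrightarrow> u 0 = z\<^sub>0 \<and>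
     (\<forall>t\<in>{0..<T}. \<exists>v. is_ham_vector F (u t) v \<and> (u has_vector_derivative v) (at t within {0..<T}))"

primrec nth_vector_derivative ::
  "real set \<Rightarrow> nat \<Rightarrow> (real \<Rightarrow> 'a::real_normed_vector) \<Rightarrow> real \<Rightarrow> 'a" where
  "nth_vector_derivative S 0 u = u"
| "nth_vector_derivative S (Suc n) u =
     (\<lambda>t. vector_derivative (nth_vector_derivative S n u) (at t within S))"

text \<open>Functions on \<open>[0,T)\<close> are extensional, so that equality is equality on \<open>[0,T)\<close>.\<close>

definition C_space :: "nat \<Rightarrow> real \<Rightarrow> 'a::real_normed_vector set \<Rightarrow> (real \<Rightarrow> 'a) set" where
  "C_space l T X = {u \<in> {0..<T} \<rightarrow>\<^sub>E X.
     (\<forall>n<l. \<forall>t\<in>{0..<T}. nth_vector_derivative {0..<T} n u differentiable (at t within {0..<T})) \<and>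
     (\<forall>n\<le>l. continuous_on {0..<T} (nth_vector_derivative {0..<T} n u))}"

definition C_nbhd ::
  "nat \<Rightarrow> real \<Rightarrow> 'a::real_normed_vector set \<Rightarrow> (real \<Rightarrow> 'a) \<Rightarrow> real set \<Rightarrow> real \<Rightarrow> (real \<Rightarrow> 'a) set" where
  "C_nbhd l T X u K e = {v \<in> C_space l T X. \<forall>n\<le>l. \<forall>t\<in>K.
     dist (nth_vector_derivative {0..<T} n v t) (nth_vector_derivative {0..<T} n u t) < e}"

definition C_openin :: "nat \<Rightarrow> real \<Rightarrow> 'a::real_normed_vector set \<Rightarrow> (real \<Rightarrow> 'a) set \<Rightarrow> bool" where
  "C_openin l T X W \<longleftrightarrow> W \<subseteq> C_space l T X \<and>
     (\<forall>u\<in>W. \<exists>K e. compact K \<and> K \<subseteq> {0..<T} \<and> e > 0 \<and> C_nbhd l T X u K e \<subseteq> W)"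

text \<open>Uniform convergence of the derivatives of order at most \<open>l\<close> on compact subsets of \<open>[0,T)\<close>.\<close>

definition C_topology :: "nat \<Rightarrow> real \<Rightarrow> 'a::real_normed_vector set \<Rightarrow> (real \<Rightarrow> 'a) topology" where
  "C_topology l T X = topology (C_openin l T X)"

lemma istopology_C_openin: "istopology (C_openin l T X)"
  unfolding istopology_def
proof (intro conjI allI impI)
  fix V W assume V: "C_openin l T X V" and W: "C_openin l T X W"
  show "C_openin l T X (V \<inter> W)"
    unfolding C_openin_def
  proof (intro conjI ballI)
    show "V \<inter> W \<subseteq> C_space l T X" using V by (auto simp: C_openin_def)
    fix u assume u: "u \<in> V \<inter> W"
    obtain K e where 1: "compact K" "K \<subseteq> {0..<T}" "e > 0" "C_nbhd l T X u K e \<subseteq> V"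
      using V u unfolding C_openin_def by blast
    obtain K' e' where 2: "compact K'" "K' \<subseteq> {0..<T}" "e' > 0" "C_nbhd l T X u K' e' \<subseteq> W"
      using W u unfolding C_openin_def by blast
    have "C_nbhd l T X u (K \<union> K') (min e e') \<subseteq> C_nbhd l T X u K e \<inter> C_nbhd l T X u K' e'"
      by (intro subsetI) (simp add: C_nbhd_def)
    then have "C_nbhd l T X u (K \<union> K') (min e e') \<subseteq> V \<inter> W"
      using 1(4) 2(4) by blast
    then show "\<exists>K e. compact K \<and> K \<subseteq> {0..<T} \<and> e > 0 \<and> C_nbhd l T X u K e \<subseteq> V \<inter> W"
      using 1 2 by (intro exI[of _ "K \<union> K'"] exI[of _ "min e e'"] conjI) auto
  qed
next
  fix \<W> assume *: "\<forall>W\<in>\<W>. C_openin l T X W"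
  show "C_openin l T X (\<Union>\<W>)"
    unfolding C_openin_def
  proof (intro conjI ballI)
    show "\<Union>\<W> \<subseteq> C_space l T X" using * by (auto simp: C_openin_def)
    fix u assume "u \<in> \<Union>\<W>"
    then obtain W where W: "W \<in> \<W>" "u \<in> W" by blast
    obtain K e where "compact K" "K \<subseteq> {0..<T}" "e > 0" "C_nbhd l T X u K e \<subseteq> W"
      using bspec[OF * W(1)] W(2) unfolding C_openin_def by blast
    moreover have "W \<subseteq> \<Union>\<W>" using W by blast
    ultimately show "\<exists>K e. compact K \<and> K \<subseteq> {0..<T} \<and> e > 0 \<and> C_nbhd l T X u K e \<subseteq> \<Union>\<W>"
      by (meson order_trans)
  qed
qed

lemma openin_C_topology: "openin (C_topology l T X) = C_openin l T X"
  by (simp add: C_topology_def istopology_C_openin topology_inverse')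

definition locally_well_posed :: "(hardy \<Rightarrow> hardy \<Rightarrow> complex) \<Rightarrow> bool" where
  "locally_well_posed F \<longleftrightarrow>
     (\<forall>z \<in> nonvanishing \<times> UNIV. \<exists>V T.
        openin (top_of_set (nonvanishing \<times> UNIV)) V \<and> z \<in> V \<and> T > 0 \<and>
        (\<exists>\<Phi>. \<forall>l\<ge>1.
           (\<forall>z\<^sub>0\<in>V.
              \<Phi> z\<^sub>0 \<in> C_space l T (nonvanishing \<times> UNIV) \<and> ham_solution F T z\<^sub>0 (\<Phi> z\<^sub>0) \<and>
              (\<forall>u \<in> C_space l T (nonvanishing \<times> UNIV). ham_solution F T z\<^sub>0 u \<longrightarrow> u = \<Phi> z\<^sub>0)) \<and>
           continuous_map (top_of_set V) (C_topology l T (nonvanishing \<times> UNIV)) \<Phi>))"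

end

theory Submission
  imports Defs
begin

text \<open>The Hamiltonian vector fields involve only products, Fourier truncations, the reflection
  \<open>y \<mapsto> -y\<close> and the reciprocal \<open>1 / w\<close>, that is, bounded (bi)linear operations on the algebra
  \<open>\<H>\<^sup>1\<close> and its inversion. All these preserve local Lipschitz continuity and the class of
  families of curves that depend continuously, with all their time derivatives, on a parameter.
  Hence Picard iteration yields a local flow that is Lipschitz in the initial data, and one may
  bootstrap: if the flow is a \<open>C\<^sup>l\<close> family, so is the vector field along it, and the flow is a
  \<open>C\<^sup>l\<^sup>+\<^sup>1\<close> family.

  That \<open>\<H>\<^sup>1\<close> is an algebra, and that it contains \<open>1 / w\<close> for nowhere vanishing \<open>w\<close>, follows
  from its characterization by \<open>\<integral>|f(y + h) - f(y)|\<^sup>2 dy = O(h\<^sup>2)\<close>.\<close>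

section \<open>Integral curves in Banach spaces\<close>

text \<open>The phase space consists of one-sided series, but w(y) p(-y) and f/w are two-sided.
  Calculations are therefore made in a second type \<open>sob\<close> of all H^1 functions, and the
  projection to \<open>hardy\<close> is applied only to the finished gradients; nothing is lost,
  since directions in \<open>hardy\<close> pair only with positive frequencies. Writing the bilinear
  pairing as the zeroth coefficient of \<open>a * reflect b\<close> makes the adjoint of each
  building block explicit, so every gradient is again composed of the same blocks.

  Continuity of each time derivative jointly in data and time already gives, by compactness,
  convergence uniform on compact sets of times. The time \<open>T\<close> is fixed by local
  Lipschitz and norm bounds of the vector field and is independent of the order \<open>l\<close>.

  Difference quotients stand in for weak derivatives because they are exact on the Fourier side: the
  kth coefficient of f(y + h) - f(y) has modulus 2 |sin(pi k h)| |f_k|, and dividing by h and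
  letting h tend to 0 brings back the weight |k|.\<close>

definition loc_lip :: "'a::real_normed_vector set \<Rightarrow> ('a \<Rightarrow> 'b::real_normed_vector) \<Rightarrow> bool" where
  "loc_lip D G \<longleftrightarrow> (\<forall>z\<in>D. \<exists>r>0. \<exists>L. L-lipschitz_on (ball z r \<inter> D) G)"

text \<open>Only time is differentiated. The parameter enters through continuity, and this is joint
  in parameter and time because compactness of a set of times turns exactly that into uniform
  closeness. The derivative is an existential witness, so closure lemmas need only offer a formula
  for it.\<close>

primrec smooth_family ::
  "nat \<Rightarrow> 'p::topological_space set \<Rightarrow> real \<Rightarrow> ('p \<Rightarrow> real \<Rightarrow> 'b::real_normed_vector) \<Rightarrow> bool" where
  "smooth_family 0 V T U \<longleftrightarrow> continuous_on (V \<times> {0..<T}) (\<lambda>x. U (fst x) (snd x))"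
| "smooth_family (Suc l) V T U \<longleftrightarrow> continuous_on (V \<times> {0..<T}) (\<lambda>x. U (fst x) (snd x)) \<and>
     (\<exists>U'. smooth_family l V T U' \<and>
        (\<forall>z\<in>V. \<forall>t\<in>{0..<T}. (U z has_vector_derivative U' z t) (at t within {0..<T})))"

lemma smooth_family_continuous:
  "smooth_family l V T U \<Longrightarrow> continuous_on (V \<times> {0..<T}) (\<lambda>x. U (fst x) (snd x))"
  by (cases l) auto

lemma smooth_family_SucD: "smooth_family (Suc l) V T U \<Longrightarrow> smooth_family l V T U"
proof (induction l arbitrary: U)
  case 0
  then show ?case by (auto dest: smooth_family_continuous)
next
  case (Suc l)
  from Suc.prems obtain U' where "smooth_family (Suc l) V T U'"
    "\<forall>z\<in>V. \<forall>t\<in>{0..<T}. (U z has_vector_derivative U' z t) (at t within {0..<T})"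
    by auto
  with Suc.IH[of U'] Suc.prems show ?case by auto
qed

lemma smooth_family_const: "smooth_family l V T (\<lambda>z t. c :: 'b::real_normed_vector)"
proof -
  \<comment> \<open>Zero is its own derivative, so the induction closes for it; every other constant
    has it as derivative.\<close>
  have "smooth_family l V T (\<lambda>z t. 0::'b)" for l
    by (induction l) (auto intro!: exI[of _ "\<lambda>z t. 0"])
  then show ?thesis
    by (cases l) (auto intro!: exI[of _ "\<lambda>z t. 0"])
qed

lemma smooth_family_bounded_linear:
  assumes "bounded_linear h"
  shows "smooth_family l V T U \<Longrightarrow> smooth_family l V T (\<lambda>z t. h (U z t))"
proof (induction l arbitrary: U)
  case 0
  then show ?case by (auto intro: bounded_linear.continuous_on[OF assms])
next
  case (Suc l)
  from Suc.prems obtain U' where "smooth_family l V T U'"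
    "\<forall>z\<in>V. \<forall>t\<in>{0..<T}. (U z has_vector_derivative U' z t) (at t within {0..<T})"
    by auto
  with Suc.IH[of U'] Suc.prems show ?case
    by (auto intro!: exI[of _ "\<lambda>z t. h (U' z t)"] bounded_linear.has_vector_derivative[OF assms]
        bounded_linear.continuous_on[OF assms])
qed

lemma smooth_family_add:
  "smooth_family l V T U \<Longrightarrow> smooth_family l V T W \<Longrightarrow> smooth_family l V T (\<lambda>z t. U z t + W z t)"
proof (induction l arbitrary: U W)
  case 0
  then show ?case by (auto intro: continuous_intros)
next
  case (Suc l)
  from Suc.prems(1) obtain U' where U': "smooth_family l V T U'"
    "\<forall>z\<in>V. \<forall>t\<in>{0..<T}. (U z has_vector_derivative U' z t) (at t within {0..<T})"
    by auto
  from Suc.prems(2) obtain W' where "smooth_family l V T W'"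
    "\<forall>z\<in>V. \<forall>t\<in>{0..<T}. (W z has_vector_derivative W' z t) (at t within {0..<T})"
    by auto
  with Suc.IH[of U' W'] Suc.prems U' show ?case
    by (auto intro!: exI[of _ "\<lambda>z t. U' z t + W' z t"] has_vector_derivative_add continuous_on_add)
qed

lemma smooth_family_bounded_bilinear:
  assumes "bounded_bilinear h"
  shows "smooth_family l V T U \<Longrightarrow> smooth_family l V T W \<Longrightarrow>
    smooth_family l V T (\<lambda>z t. h (U z t) (W z t))"
proof (induction l arbitrary: U W)
  case 0
  then show ?case by (auto intro: bounded_bilinear.continuous_on[OF assms])
next
  case (Suc l)
  from Suc.prems(1) obtain U' where U': "smooth_family l V T U'"
    "\<forall>z\<in>V. \<forall>t\<in>{0..<T}. (U z has_vector_derivative U' z t) (at t within {0..<T})"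
    by auto
  from Suc.prems(2) obtain W' where W': "smooth_family l V T W'"
    "\<forall>z\<in>V. \<forall>t\<in>{0..<T}. (W z has_vector_derivative W' z t) (at t within {0..<T})"
    by auto
  \<comment> \<open>The Leibniz rule pairs each derivative with an undifferentiated factor, so these
    factors are wanted at order \<open>l\<close> as well.\<close>
  have UW: "smooth_family l V T U" "smooth_family l V T W"
    using Suc.prems by (blast dest: smooth_family_SucD)+
  have "smooth_family l V T (\<lambda>z t. h (U z t) (W' z t) + h (U' z t) (W z t))"
    by (intro smooth_family_add Suc.IH UW U' W')
  then show ?case
    using Suc.prems U'(2) W'(2)
    by (auto intro!: exI[of _ "\<lambda>z t. h (U z t) (W' z t) + h (U' z t) (W z t)"]
        bounded_bilinear.has_vector_derivative[OF assms] bounded_bilinear.continuous_on[OF assms])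
qed

text \<open>For a vector field, being tame is all that is needed for local well-posedness in every
  \<open>C\<^sup>l\<close>: along an integral curve the second condition gains one time derivative at a time.\<close>

definition tame :: "'a::real_normed_vector set \<Rightarrow> ('a \<Rightarrow> 'b::real_normed_vector) \<Rightarrow> bool" where
  "tame D G \<longleftrightarrow> loc_lip D G \<and>
     (\<forall>l (V :: 'a set) T U. (\<forall>z\<in>V. \<forall>t\<in>{0..<T}. U z t \<in> D) \<longrightarrow> smooth_family l V T U \<longrightarrow>
        smooth_family l V T (\<lambda>z t. G (U z t)))"

lemma loc_lipE:
  assumes "loc_lip D G" "z \<in> D"
  obtains r L where "r > 0" "L-lipschitz_on (ball z r \<inter> D) G"
  using assms unfolding loc_lip_def by blast

lemma loc_lip_continuous:
  assumes "loc_lip D G"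
  shows "continuous_on D G"
proof (rule continuous_on_subset[OF _ order_refl], unfold continuous_on_eq_continuous_within, rule ballI)
  fix z assume z: "z \<in> D"
  obtain r L where r: "r > 0" "L-lipschitz_on (ball z r \<inter> D) G"
    using assms z by (rule loc_lipE)
  have "continuous (at z within (ball z r \<inter> D)) G"
    using lipschitz_on_continuous_on[OF r(2)] z r(1)
    by (auto simp: continuous_on_eq_continuous_within)
  moreover have "at z within (ball z r \<inter> D) = at z within D"
    using r(1) by (intro at_within_nhd[where S="ball z r"]) auto
  ultimately show "continuous (at z within D) G" by (simp add: continuous_within)
qed

text \<open>On the smaller of the two balls each factor is bounded by its norm at the centre plus
  Lipschitz constant times radius. Telescoping the difference of two products then leaves one
  bounded and one Lipschitz factor in each term.\<close>

lemma loc_lip_bounded_bilinear: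
  assumes h: "bounded_bilinear h" and G: "loc_lip D G" and H: "loc_lip D H"
  shows "loc_lip D (\<lambda>z. h (G z) (H z))"
  unfolding loc_lip_def
proof
  fix z assume z: "z \<in> D"
  interpret bounded_bilinear h by fact
  obtain r L where r: "r > 0" "L-lipschitz_on (ball z r \<inter> D) G"
    using G z by (rule loc_lipE)
  obtain s M where s: "s > 0" "M-lipschitz_on (ball z s \<inter> D) H"
    using H z by (rule loc_lipE)
  obtain K where K: "K > 0" "\<And>a b. norm (h a b) \<le> norm a * norm b * K"
    using pos_bounded by blast
  define \<rho> where "\<rho> = min r s"
  have L: "L \<ge> 0" and M: "M \<ge> 0" using r s by (auto intro: lipschitz_on_nonneg)
  have bG: "norm (G x) \<le> norm (G z) + L * r" if "x \<in> ball z \<rho> \<inter> D" for x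
  proof -
    have "dist (G x) (G z) \<le> L * dist x z"
      using that z r by (intro lipschitz_onD[OF r(2)]) (auto simp: \<rho>_def)
    also have "\<dots> \<le> L * r" using that L by (intro mult_left_mono) (auto simp: \<rho>_def dist_commute)
    finally show ?thesis using norm_triangle_sub[of "G x" "G z"] by (simp add: dist_norm)
  qed
  have bH: "norm (H x) \<le> norm (H z) + M * s" if "x \<in> ball z \<rho> \<inter> D" for x
  proof -
    have "dist (H x) (H z) \<le> M * dist x z"
      using that z s by (intro lipschitz_onD[OF s(2)]) (auto simp: \<rho>_def)
    also have "\<dots> \<le> M * s" using that M by (intro mult_left_mono) (auto simp: \<rho>_def dist_commute)
    finally show ?thesis using norm_triangle_sub[of "H x" "H z"] by (simp add: dist_norm)
  qed
  have "((norm (G z) + L * r) * M * K + L * (norm (H z) + M * s) * K)-lipschitz_on (ball z \<rho> \<inter> D) (\<lambda>z. h (G z) (H z))"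
  proof (rule lipschitz_onI)
    fix x y assume x: "x \<in> ball z \<rho> \<inter> D" and y: "y \<in> ball z \<rho> \<inter> D"
    have "h (G x) (H x) - h (G y) (H y) = h (G x) (H x - H y) + h (G x - G y) (H y)"
      by (simp add: diff_left diff_right)
    then have "dist (h (G x) (H x)) (h (G y) (H y)) \<le> norm (h (G x) (H x - H y)) + norm (h (G x - G y) (H y))"
      by (simp add: dist_norm norm_triangle_ineq)
    also have "\<dots> \<le> norm (G x) * norm (H x - H y) * K + norm (G x - G y) * norm (H y) * K"
      by (intro add_mono K)
    also have "\<dots> \<le> (norm (G z) + L * r) * (M * dist x y) * K + (L * dist x y) * (norm (H z) + M * s) * K"
      using x y K(1) L M r s
      by (intro add_mono mult_right_mono mult_mono bG bH mult_nonneg_nonneg add_nonneg_nonneg)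
        (auto simp: dist_norm[symmetric] \<rho>_def intro!: lipschitz_onD[OF r(2)] lipschitz_onD[OF s(2)])
    finally show "dist (h (G x) (H x)) (h (G y) (H y)) \<le>
        ((norm (G z) + L * r) * M * K + L * (norm (H z) + M * s) * K) * dist x y"
      by (simp add: algebra_simps)
  qed (use K L M r s in auto)
  then show "\<exists>r>0. \<exists>L. L-lipschitz_on (ball z r \<inter> D) (\<lambda>z. h (G z) (H z))"
    using r s by (intro exI[of _ \<rho>]) (auto simp: \<rho>_def)
qed

lemma loc_lip_compose:
  assumes G: "loc_lip D G" and H: "loc_lip E H" and sub: "G ` D \<subseteq> E"
  shows "loc_lip D (\<lambda>z. H (G z))"
  unfolding loc_lip_def
proof
  fix z assume z: "z \<in> D"
  obtain r L where r: "r > 0" "L-lipschitz_on (ball z r \<inter> D) G"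
    using G z by (rule loc_lipE)
  obtain s M where s: "s > 0" "M-lipschitz_on (ball (G z) s \<inter> E) H"
    using H sub z by (blast elim: loc_lipE)
  have L: "L \<ge> 0" using r by (auto intro: lipschitz_on_nonneg)
  \<comment> \<open>The radius is chosen so that \<open>G\<close> maps the ball into the one where
    \<open>H\<close> is Lipschitz; \<open>L + 1\<close> keeps the quotient meaningful for
    \<open>L = 0\<close>.\<close>
  define \<rho> where "\<rho> = min r (s / (L + 1))"
  have \<rho>: "\<rho> > 0" using r s L by (auto simp: \<rho>_def)
  have "G ` (ball z \<rho> \<inter> D) \<subseteq> ball (G z) s \<inter> E"
  proof safe
    fix x assume x: "x \<in> ball z \<rho>" "x \<in> D"
    show "G x \<in> E" using x sub by blast
    have "dist (G z) (G x) \<le> L * dist z x"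
      using x z r by (intro lipschitz_onD[OF r(2)]) (auto simp: \<rho>_def)
    also have "\<dots> \<le> (L + 1) * dist z x" by (simp add: algebra_simps)
    also have "\<dots> < s" using x L by (auto simp: \<rho>_def field_simps)
    finally show "G x \<in> ball (G z) s" by simp
  qed
  then have "(M * L)-lipschitz_on (ball z \<rho> \<inter> D) (\<lambda>z. H (G z))"
    by (intro lipschitz_on_compose2[of L _ G M H] lipschitz_on_mono[OF r(2)] lipschitz_on_mono[OF s(2)])
      (auto simp: \<rho>_def)
  with \<rho> show "\<exists>r>0. \<exists>L. L-lipschitz_on (ball z r \<inter> D) (\<lambda>z. H (G z))" by blast
qed

lemma loc_lip_bounded_linear: "bounded_linear h \<Longrightarrow> loc_lip D h"
proof -
  assume "bounded_linear h"
  then interpret bounded_linear h .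
  obtain K where K: "K \<ge> 0" "\<And>x. norm (h x) \<le> norm x * K"
    using nonneg_bounded by blast
  have "K-lipschitz_on X h" for X
    using K by (intro lipschitz_onI) (auto simp: dist_norm diff[symmetric] mult.commute)
  then show ?thesis unfolding loc_lip_def by (meson zero_less_one)
qed


text \<open>The parameters range over the type of the domain of \<open>G\<close>, since a definition
  cannot quantify over types. This fits the flow, whose parameters are initial data, that is, points
  of the phase space.\<close>

lemma tame_compose_smooth:
  fixes V :: "'a::real_normed_vector set"
  assumes "tame D (G :: 'a \<Rightarrow> _)" "\<And>z t. z \<in> V \<Longrightarrow> t \<in> {0..<T} \<Longrightarrow> U z t \<in> D" "smooth_family l V T U"
  shows "smooth_family l V T (\<lambda>z t. G (U z t))"
  using assms(2,3) by (rule assms(1)[unfolded tame_def, THEN conjunct2, rule_format])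

lemma tame_bounded_linear: "bounded_linear h \<Longrightarrow> tame D h"
  unfolding tame_def by (auto intro: loc_lip_bounded_linear smooth_family_bounded_linear)

lemma tame_const: "tame D (\<lambda>z. c)"
  unfolding tame_def loc_lip_def
  using lipschitz_on_constant zero_less_one by (blast intro: smooth_family_const)

lemma tame_linear_compose:
  assumes "bounded_linear h" "tame D G"
  shows "tame D (\<lambda>z. h (G z))"
  using assms loc_lip_compose[OF _ loc_lip_bounded_linear, of D G h UNIV]
  unfolding tame_def by (auto intro: smooth_family_bounded_linear)

lemma tame_bilinear:
  assumes "bounded_bilinear h" "tame D G" "tame D H"
  shows "tame D (\<lambda>z. h (G z) (H z))"
  using assms unfolding tame_def
  by (auto intro: smooth_family_bounded_bilinear loc_lip_bounded_bilinear)

lemma tame_add: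
  assumes "tame D G" "tame D H"
  shows "tame D (\<lambda>z. G z + H z)"
  unfolding tame_def
proof (intro conjI allI impI)
  show "loc_lip D (\<lambda>z. G z + H z)"
    unfolding loc_lip_def
  proof
    fix z assume z: "z \<in> D"
    obtain r L where r: "r > 0" "L-lipschitz_on (ball z r \<inter> D) G"
      using assms(1) z unfolding tame_def by (blast elim: loc_lipE)
    obtain s M where s: "s > 0" "M-lipschitz_on (ball z s \<inter> D) H"
      using assms(2) z unfolding tame_def by (blast elim: loc_lipE)
    have "(L + M)-lipschitz_on (ball z (min r s) \<inter> D) (\<lambda>z. G z + H z)"
      by (intro lipschitz_on_add lipschitz_on_subset[OF r(2)] lipschitz_on_subset[OF s(2)]) auto
    then show "\<exists>r>0. \<exists>L. L-lipschitz_on (ball z r \<inter> D) (\<lambda>z. G z + H z)"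
      using r s by (intro exI[of _ "min r s"]) auto
  qed
qed (use assms in \<open>auto simp: tame_def intro: smooth_family_add\<close>)

lemma tame_uminus: "tame D G \<Longrightarrow> tame D (\<lambda>z. - G z)"
  using tame_linear_compose[OF bounded_linear_minus[OF bounded_linear_ident]] .

lemma tame_diff: "tame D G \<Longrightarrow> tame D H \<Longrightarrow> tame D (\<lambda>z. G z - H z)"
  using tame_add[OF _ tame_uminus, of D G H] by simp

text \<open>A pair is the sum of two linear embeddings, so closure under sums and bounded linear
  maps suffices.\<close>

lemma tame_Pair: "tame D G \<Longrightarrow> tame D H \<Longrightarrow> tame D (\<lambda>z. (G z, H z))"
  using tame_add[OF
      tame_linear_compose[OF bounded_linear_Pair[OF bounded_linear_ident bounded_linear_zero]]
      tame_linear_compose[OF bounded_linear_Pair[OF bounded_linear_zero bounded_linear_ident]], of D G H]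
  by simp

section \<open>Uniqueness, existence and regularity of integral curves\<close>

lemma has_vector_derivative_dist_bound:
  fixes f :: "real \<Rightarrow> 'a::real_normed_vector"
  assumes S: "convex S" and x: "x \<in> S" and y: "y \<in> S"
    and d: "\<And>t. t \<in> S \<Longrightarrow> (f has_vector_derivative f' t) (at t within S)"
    and B: "\<And>t. t \<in> S \<Longrightarrow> norm (f' t) \<le> B"
  shows "norm (f x - f y) \<le> B * \<bar>x - y\<bar>"
proof -
  have on: "onorm (\<lambda>h. h *\<^sub>R f' t) \<le> B" if "t \<in> S" for t
    using B[OF that] order_trans[OF norm_ge_zero B[OF that]]
    by (intro onorm_le) (simp add: mult.commute[of "\<bar>_\<bar>"] mult_right_mono)
  show ?thesis
    using differentiable_bound[OF S d[unfolded has_vector_derivative_def] on x y] by simp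
qed

text \<open>At a common point the curves agree nearby, since the maximal distance \<open>m\<close> over a short
  interval satisfies \<open>m \<le> m / 2\<close>; connectedness of the interval does the rest.\<close>

lemma integral_curve_unique:
  fixes X :: "'a::real_normed_vector \<Rightarrow> 'a"
  assumes lip: "loc_lip D X" and D: "open D"
    and u: "\<And>t. t \<in> {0..<T} \<Longrightarrow> u t \<in> D \<and> (u has_vector_derivative X (u t)) (at t within {0..<T})"
    and v: "\<And>t. t \<in> {0..<T} \<Longrightarrow> v t \<in> D \<and> (v has_vector_derivative X (v t)) (at t within {0..<T})"
    and uv: "u 0 = v 0" and t: "t \<in> {0..<T}"
  shows "u t = v t"
proof -
  let ?I = "{0..<T}"
  have cu: "continuous_on ?I u" and cv: "continuous_on ?I v"
    unfolding continuous_on_eq_continuous_within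
    using u v has_vector_derivative_continuous by blast+
  define A where "A = {t\<in>?I. u t = v t}"
  have loc: "\<exists>e>0. \<forall>t\<in>?I. \<bar>t - s\<bar> < e \<longrightarrow> u t = v t" if s: "s \<in> A" for s
  proof -
    have sI: "s \<in> ?I" and us: "u s = v s" using s by (auto simp: A_def)
    obtain r0 L where r0: "r0 > 0" "L-lipschitz_on (ball (u s) r0 \<inter> D) X"
      using lip u[OF sI] by (blast elim: loc_lipE)
    have L: "L \<ge> 0" using r0 by (auto intro: lipschitz_on_nonneg)
    obtain e1 where e1: "e1 > 0" "\<And>t. t \<in> ?I \<Longrightarrow> dist t s < e1 \<Longrightarrow> dist (u t) (u s) < r0"
      using bspec[OF cu[unfolded continuous_on_iff] sI] r0(1) by blast
    obtain e2 where e2: "e2 > 0" "\<And>t. t \<in> ?I \<Longrightarrow> dist t s < e2 \<Longrightarrow> dist (v t) (v s) < r0"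
      using bspec[OF cv[unfolded continuous_on_iff] sI] r0(1) by blast
    \<comment> \<open>Within \<open>e1\<close> and \<open>e2\<close> both curves stay in the ball
      where \<open>X\<close> is Lipschitz. The last term makes \<open>L * e\<close> at most 1/2,
      also when \<open>L = 0\<close>.\<close>
    define e where "e = min (min e1 e2) (1 / (2 * L + 1))"
    have e: "e > 0" using e1 e2 L by (auto simp: e_def)
    define S where "S = ?I \<inter> ball s e"
    have S: "convex S" "s \<in> S" using sI e by (auto simp: S_def convex_Int)
    have uS: "u t \<in> ball (u s) r0 \<inter> D" if "t \<in> S" for t
      using that e1(2)[of t] u[of t] by (auto simp: S_def e_def dist_commute)
    have vS: "v t \<in> ball (u s) r0 \<inter> D" if "t \<in> S" for t
      using that e2(2)[of t] v[of t] us by (auto simp: S_def e_def dist_commute)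
    define m where "m = (SUP t\<in>S. norm (u t - v t))"
    have bdd: "bdd_above ((\<lambda>t. norm (u t - v t)) ` S)"
    proof (rule bdd_aboveI2)
      fix t assume "t \<in> S"
      then show "norm (u t - v t) \<le> 2 * r0"
        using uS[of t] vS[of t] dist_triangle2[of "u t" "v t" "u s"]
        by (auto simp: dist_norm norm_minus_commute)
    qed
    have le_m: "norm (u t - v t) \<le> m" if "t \<in> S" for t
      unfolding m_def using that bdd by (rule cSUP_upper)
    have m0: "m \<ge> 0" using le_m[OF S(2)] norm_ge_zero order_trans by blast
    have half: "norm (u t - v t) \<le> m / 2" if t: "t \<in> S" for t
    proof -
      have "norm ((u t - v t) - (u s - v s)) \<le> (L * m) * \<bar>t - s\<bar>"
      proof (rule has_vector_derivative_dist_bound[OF S(1) t S(2)])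
        fix x assume x: "x \<in> S"
        show "((\<lambda>t. u t - v t) has_vector_derivative X (u x) - X (v x)) (at x within S)"
          using u[of x] v[of x] x
          by (intro has_vector_derivative_diff) (auto simp: S_def intro: has_vector_derivative_within_subset)
        have "norm (X (u x) - X (v x)) \<le> L * norm (u x - v x)"
          by (rule lipschitz_on_normD[OF r0(2) uS[OF x] vS[OF x]])
        also have "\<dots> \<le> L * m" by (intro mult_left_mono le_m x L)
        finally show "norm (X (u x) - X (v x)) \<le> L * m" .
      qed
      also have "\<dots> \<le> (L * m) * (1 / (2 * L + 1))"
        using t L m0 by (intro mult_left_mono) (auto simp: S_def e_def dist_real_def)
      also have "\<dots> \<le> m / 2"
        using L m0 by (simp add: field_simps)
      finally show ?thesis using us by simp
    qed
    have "m \<le> m / 2"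
      using S(2) half unfolding m_def by (intro cSUP_least) auto
    then have "m = 0" using m0 by simp
    then have "u t = v t" if "t \<in> ?I" "\<bar>t - s\<bar> < e" for t
      using le_m[of t] that by (auto simp: S_def dist_real_def abs_minus_commute)
    then show ?thesis using e by blast
  qed
  have "openin (top_of_set ?I) A"
    unfolding openin_euclidean_subtopology_iff
  proof (intro conjI ballI)
    fix s assume "s \<in> A"
    from loc[OF this] obtain e where "e > 0" "\<forall>t\<in>?I. \<bar>t - s\<bar> < e \<longrightarrow> u t = v t" by blast
    then show "\<exists>e>0. \<forall>x'\<in>?I. dist x' s < e \<longrightarrow> x' \<in> A"
      by (intro exI[of _ e]) (simp add: A_def dist_real_def)
  qed (auto simp: A_def)
  moreover have "closedin (top_of_set ?I) A"
  proof -
    have "A = ?I \<inter> (\<lambda>t. u t - v t) -` {0}" by (auto simp: A_def)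
    then show ?thesis
      by (simp add: continuous_closedin_preimage continuous_on_diff cu cv)
  qed
  moreover have "connected ?I" by (simp add: convex_connected)
  moreover have "0 \<in> A" using uv t by (auto simp: A_def)
  ultimately have "A = ?I" unfolding connected_clopen by blast
  with t have "t \<in> A" by blast
  then show ?thesis by (simp add: A_def)
qed

text \<open>Banach's fixed point theorem for the integral operator \<open>P\<close>:
  \<open>r + T * M \<le> R\<close> keeps its values in the ball on which \<open>X\<close> is
  controlled, and \<open>T * L \<le> 1 / 2\<close> makes it a contraction with factor 1/2. Neither
  condition mentions \<open>z0\<close>, so one time \<open>T\<close> serves a whole ball of initial
  data.\<close>

lemma picard_lindelof:
  fixes X :: "'a::banach \<Rightarrow> 'a"
  assumes lip: "L-lipschitz_on (cball z R) X"
    and bd: "\<And>x. x \<in> cball z R \<Longrightarrow> norm (X x) \<le> M"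
    and M: "M \<ge> 0" and T: "T \<ge> 0" "T * L \<le> 1 / 2" "r + T * M \<le> R" and z0: "z0 \<in> cball z r"
  obtains u where "u 0 = z0" "\<And>t. t \<in> {0..T} \<Longrightarrow> u t \<in> cball z R"
    "\<And>t. t \<in> {0..T} \<Longrightarrow> (u has_vector_derivative X (u t)) (at t within {0..T})"
proof -
  \<comment> \<open>Bounded continuous functions are taken on the whole line, so time is clamped to
    \<open>{0..T}\<close>; on that interval \<open>c t = t\<close> and \<open>P\<close> is the usual
    Picard operator.\<close>
  define c where "c t = max 0 (min T t)" for t
  have c: "c t \<in> {0..T}" for t using T by (auto simp: c_def)
  have cc: "continuous_on A c" for A unfolding c_def by (intro continuous_intros)
  have L: "L \<ge> 0" using lip by (rule lipschitz_on_nonneg)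
  define S where "S = PiC (UNIV::real set) (\<lambda>_. cball z R)"
  have SD: "u t \<in> cball z R" if "u \<in> S" for u t
    using mem_PiCD[OF that[unfolded S_def]] by auto
  define P where "P u t = z0 + integral {0..c t} (\<lambda>s. X (apply_bcontfun u s))" for u t
  have cX: "continuous_on A (\<lambda>s. X (apply_bcontfun u s))" if "u \<in> S" for u A
    by (rule continuous_on_compose2[OF lipschitz_on_continuous_on[OF lip]]) (auto intro: SD that)
  have int: "(\<lambda>s. X (apply_bcontfun u s)) integrable_on {a..b}" if "u \<in> S" for u a b
    by (intro integrable_continuous_real cX that)
  have Pdist: "P u t \<in> cball z R" if "u \<in> S" for u t
  proof -
    have "norm (integral {0..c t} (\<lambda>s. X (apply_bcontfun u s))) \<le> M * (c t - 0)"
      using c[of t] by (intro integral_bound cX that bd SD) auto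
    also have "\<dots> \<le> M * T"
      using c[of t] bd[OF SD[OF that]] by (intro mult_left_mono) (auto intro: order_trans[OF norm_ge_zero])
    finally have "norm (P u t - z0) \<le> M * T" by (simp add: P_def)
    then show ?thesis
      using z0 T(3) dist_triangle[of z "P u t" z0] by (simp add: dist_norm norm_minus_commute mult.commute)
  qed
  have Pcont: "continuous_on UNIV (P u)" if "u \<in> S" for u
  proof -
    have "continuous_on {0..T} (\<lambda>x. integral {0..x} (\<lambda>s. X (apply_bcontfun u s)))"
      by (intro indefinite_integral_continuous_1 int that)
    then show ?thesis
      unfolding P_def
      by (intro continuous_intros continuous_on_compose2[OF _ cc]) (use c in auto)
  qed
  have Pb: "P u \<in> bcontfun" if "u \<in> S" for u
    using Pcont[OF that] Pdist[OF that]
    by (auto simp: bcontfun_def intro!: bounded_subset[OF bounded_cball])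
  have app: "apply_bcontfun (Bcontfun (P u)) = P u" if "u \<in> S" for u
    using Pb[OF that] by (simp add: Bcontfun_inverse)
  have "\<exists>!u. u \<in> S \<and> Bcontfun (P u) = u"
  proof -
    have "complete S"
      unfolding S_def complete_eq_closed by (intro closed_PiC) auto
    moreover have "S \<noteq> {}"
      using z0 T(1,3) mult_nonneg_nonneg[OF T(1) M]
      unfolding S_def
      by (intro ex_in_conv[THEN iffD1] exI[of _ "const_bcontfun z0"] mem_PiCI)
        (simp add: const_bcontfun.rep_eq)
    moreover have "(\<lambda>u. Bcontfun (P u)) ` S \<subseteq> S"
    proof safe
      fix u assume u: "u \<in> S"
      show "Bcontfun (P u) \<in> S"
        unfolding S_def by (intro mem_PiCI Pi_I) (simp only: app[OF u] Pdist[OF u])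
    qed
    moreover have "dist (Bcontfun (P u)) (Bcontfun (P v)) \<le> (1/2) * dist u v" if "u \<in> S" "v \<in> S" for u v
    proof (rule dist_bound)
      fix t
      have "P u t - P v t = integral {0..c t} (\<lambda>s. X (apply_bcontfun u s) - X (apply_bcontfun v s))"
        unfolding P_def by (subst integral_diff[OF int[OF that(1)] int[OF that(2)]]) simp
      also have "norm \<dots> \<le> (L * dist u v) * (c t - 0)"
      proof (rule integral_bound)
        fix s
        have "norm (X (apply_bcontfun u s) - X (apply_bcontfun v s)) \<le> L * dist (u s) (v s)"
          using lipschitz_onD[OF lip SD[OF that(1)] SD[OF that(2)]] by (simp add: dist_norm)
        also have "\<dots> \<le> L * dist u v" by (intro mult_left_mono dist_bounded L)
        finally show "norm (X (apply_bcontfun u s) - X (apply_bcontfun v s)) \<le> L * dist u v" .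
      qed (use c[of t] in \<open>auto intro!: continuous_on_diff cX that\<close>)
      also have "\<dots> \<le> (L * dist u v) * T" using c[of t] L by (intro mult_left_mono) auto
      also have "\<dots> = (T * L) * dist u v" by simp
      also have "\<dots> \<le> (1/2) * dist u v" by (intro mult_right_mono T) auto
      finally show "dist (Bcontfun (P u) t) (Bcontfun (P v) t) \<le> (1/2) * dist u v"
        by (simp only: app[OF that(1)] app[OF that(2)] dist_norm)
    qed
    ultimately show ?thesis
      by (intro Banach_fix[of S "1/2" "\<lambda>u. Bcontfun (P u)"]) simp_all
  qed
  then obtain u where u: "u \<in> S" "Bcontfun (P u) = u" by blast
  have uP: "apply_bcontfun u = P u" using app[OF u(1)] unfolding u(2) .
  show thesis
  proof
    show "apply_bcontfun u 0 = z0"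
      using T(1) by (subst uP) (simp add: P_def c_def)
    fix t assume t: "t \<in> {0..T}"
    show "apply_bcontfun u t \<in> cball z R" by (rule SD[OF u(1)])
    have "((\<lambda>x. z0 + integral {0..x} (\<lambda>s. X (apply_bcontfun u s))) has_vector_derivative 0 + X (apply_bcontfun u t)) (at t within {0..T})"
      by (intro has_vector_derivative_add has_vector_derivative_const integral_has_vector_derivative cX u t)
    then show "(apply_bcontfun u has_vector_derivative X (apply_bcontfun u t)) (at t within {0..T})"
    proof (subst add_0[symmetric], rule has_vector_derivative_transform[OF t, rotated])
      show "apply_bcontfun u x = z0 + integral {0..x} (\<lambda>s. X (apply_bcontfun u s))" if "x \<in> {0..T}" for x
        using that by (subst uP) (simp add: P_def c_def)
    qed
  qed
qed


lemma local_flow: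
  fixes X :: "'a::banach \<Rightarrow> 'a"
  assumes X: "tame D X" and D: "open D" and z: "z \<in> D"
  obtains r T \<Phi> where "r > 0" "T > 0" "ball z r \<subseteq> D"
    "\<And>z0. z0 \<in> ball z r \<Longrightarrow> \<Phi> z0 0 = z0"
    "\<And>z0 t. z0 \<in> ball z r \<Longrightarrow> t \<in> {0..<T} \<Longrightarrow> \<Phi> z0 t \<in> D"
    "\<And>z0 t. z0 \<in> ball z r \<Longrightarrow> t \<in> {0..<T} \<Longrightarrow>
      (\<Phi> z0 has_vector_derivative X (\<Phi> z0 t)) (at t within {0..<T})"
    "\<And>l. smooth_family l (ball z r) T \<Phi>"
proof -
  obtain r0 L where r0: "r0 > 0" "L-lipschitz_on (ball z r0 \<inter> D) X"
    using X z unfolding tame_def by (blast elim: loc_lipE)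
  obtain r1 where r1: "r1 > 0" "ball z r1 \<subseteq> D"
    using D z by (auto elim: openE)
  have L: "L \<ge> 0" using r0 by (auto intro: lipschitz_on_nonneg)
  define R where "R = min r0 r1 / 2"
  have R: "R > 0" using r0 r1 by (auto simp: R_def)
  have sub: "cball z R \<subseteq> ball z r0 \<inter> D"
    using r0(1) r1 by (auto simp: R_def min_def split: if_splits)
  have lip: "L-lipschitz_on (cball z R) X"
    using r0(2) sub by (rule lipschitz_on_subset)
  define M where "M = norm (X z) + L * R"
  have M: "M \<ge> 0" using L R by (auto simp: M_def)
  have bd: "norm (X x) \<le> M" if "x \<in> cball z R" for x
  proof -
    have "dist (X x) (X z) \<le> L * dist x z"
      using that R by (intro lipschitz_onD[OF lip]) auto
    also have "\<dots> \<le> L * R" using that L by (intro mult_left_mono) (auto simp: dist_commute)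
    finally show ?thesis
      unfolding M_def using norm_triangle_sub[of "X x" "X z"] by (simp add: dist_norm)
  qed
  \<comment> \<open>The two terms give \<open>T * L \<le> 1 / 2\<close> and
    \<open>T * M \<le> R / 2\<close>. The second leaves room for initial data at distance up to
    \<open>R / 2\<close> from \<open>z\<close>. Adding 1 in the denominators covers
    \<open>L = 0\<close> and \<open>M = 0\<close>.\<close>
  define T where "T = min (1 / (2 * L + 1)) (R / (2 * M + 1))"
  have T: "T > 0" using L M R by (auto simp: T_def)
  have TL: "T * L \<le> 1 / 2"
  proof -
    have "T * L \<le> (1 / (2 * L + 1)) * L" using L by (intro mult_right_mono) (auto simp: T_def)
    also have "\<dots> \<le> 1 / 2" using L by (simp add: field_simps)
    finally show ?thesis .
  qed
  have TM: "R / 2 + T * M \<le> R"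
  proof -
    have "T * M \<le> (R / (2 * M + 1)) * M" using M by (intro mult_right_mono) (auto simp: T_def)
    also have "\<dots> \<le> R / 2" using M R by (simp add: field_simps)
    finally show ?thesis by simp
  qed
  have "\<exists>u. u 0 = z0 \<and> (\<forall>t\<in>{0..T}. u t \<in> cball z R \<and>
      (u has_vector_derivative X (u t)) (at t within {0..T}))" if "z0 \<in> cball z (R / 2)" for z0
    using picard_lindelof[OF lip bd M less_imp_le[OF T] TL TM that] by metis
  then obtain \<Phi> where \<Phi>: "\<And>z0. z0 \<in> cball z (R / 2) \<Longrightarrow> \<Phi> z0 0 = z0"
    "\<And>z0 t. z0 \<in> cball z (R / 2) \<Longrightarrow> t \<in> {0..T} \<Longrightarrow> \<Phi> z0 t \<in> cball z R"
    "\<And>z0 t. z0 \<in> cball z (R / 2) \<Longrightarrow> t \<in> {0..T} \<Longrightarrow>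
      (\<Phi> z0 has_vector_derivative X (\<Phi> z0 t)) (at t within {0..T})"
    by metis
  let ?V = "ball z (R / 2)"
  \<comment> \<open>Since the time is short, no Gronwall estimate is needed: the supremum
    \<open>m\<close> of the distance satisfies m \<le> |x - y| + m/2, whence the factor 2.\<close>
  have sp: "norm (\<Phi> x t - \<Phi> y t) \<le> 2 * norm (x - y)"
    if x: "x \<in> ?V" and y: "y \<in> ?V" and t: "t \<in> {0..T}" for x y t
  proof -
    have x': "x \<in> cball z (R / 2)" and y': "y \<in> cball z (R / 2)" using x y by auto
    define m where "m = (SUP t\<in>{0..T}. norm (\<Phi> x t - \<Phi> y t))"
    have bdd: "bdd_above ((\<lambda>t. norm (\<Phi> x t - \<Phi> y t)) ` {0..T})"
    proof (rule bdd_aboveI2)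
      fix t assume "t \<in> {0..T}"
      then show "norm (\<Phi> x t - \<Phi> y t) \<le> 2 * R"
        using \<Phi>(2)[OF x', of t] \<Phi>(2)[OF y', of t] dist_triangle3[of "\<Phi> x t" "\<Phi> y t" z]
        by (auto simp: dist_norm)
    qed
    have le_m: "norm (\<Phi> x t - \<Phi> y t) \<le> m" if "t \<in> {0..T}" for t
      unfolding m_def using that bdd by (rule cSUP_upper)
    have m0: "m \<ge> 0" using le_m[OF t] norm_ge_zero order_trans by blast
    have half: "norm (\<Phi> x t - \<Phi> y t) \<le> norm (x - y) + m / 2" if t: "t \<in> {0..T}" for t
    proof -
      have "norm ((\<Phi> x t - \<Phi> y t) - (\<Phi> x 0 - \<Phi> y 0)) \<le> (L * m) * \<bar>t - 0\<bar>"
      proof (rule has_vector_derivative_dist_bound[OF _ t])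
        fix s assume s: "s \<in> {0..T}"
        show "((\<lambda>t. \<Phi> x t - \<Phi> y t) has_vector_derivative X (\<Phi> x s) - X (\<Phi> y s)) (at s within {0..T})"
          by (intro has_vector_derivative_diff \<Phi> x' y' s)
        have "norm (X (\<Phi> x s) - X (\<Phi> y s)) \<le> L * norm (\<Phi> x s - \<Phi> y s)"
          by (intro lipschitz_on_normD[OF lip] \<Phi> x' y' s)
        also have "\<dots> \<le> L * m" by (intro mult_left_mono le_m s L)
        finally show "norm (X (\<Phi> x s) - X (\<Phi> y s)) \<le> L * m" .
      qed (use T in auto)
      also have "\<dots> \<le> (L * m) * T" using t L m0 by (intro mult_left_mono) auto
      also have "\<dots> = (T * L) * m" by simp
      also have "\<dots> \<le> (1 / 2) * m" by (intro mult_right_mono TL m0)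
      finally show ?thesis
        using norm_triangle_sub[of "\<Phi> x t - \<Phi> y t" "x - y"] by (simp add: \<Phi>(1)[OF x'] \<Phi>(1)[OF y'])
    qed
    have "m \<le> norm (x - y) + m / 2"
      using t half unfolding m_def by (intro cSUP_least) auto
    then show ?thesis using le_m[OF t] by simp
  qed
  have tm: "norm (\<Phi> x t - \<Phi> x s) \<le> M * \<bar>t - s\<bar>"
    if x: "x \<in> ?V" and t: "t \<in> {0..T}" and s: "s \<in> {0..T}" for x t s
    by (rule has_vector_derivative_dist_bound[OF _ t s \<Phi>(3)]) (use x in \<open>auto intro!: bd \<Phi>(2)\<close>)
  have "(2 + M)-lipschitz_on (?V \<times> {0..<T}) (\<lambda>x. \<Phi> (fst x) (snd x))"
  proof (rule lipschitz_onI)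
    fix p q assume p: "p \<in> ?V \<times> {0..<T}" and q: "q \<in> ?V \<times> {0..<T}"
    have "dist (\<Phi> (fst p) (snd p)) (\<Phi> (fst q) (snd q))
        \<le> dist (\<Phi> (fst p) (snd p)) (\<Phi> (fst q) (snd p)) + dist (\<Phi> (fst q) (snd p)) (\<Phi> (fst q) (snd q))"
      by (rule dist_triangle)
    also have "\<dots> \<le> 2 * dist (fst p) (fst q) + M * dist (snd p) (snd q)"
      using p q sp[of "fst p" "fst q" "snd p"] tm[of "fst q" "snd p" "snd q"]
      by (intro add_mono) (auto simp: dist_norm)
    also have "\<dots> \<le> 2 * dist p q + M * dist p q"
      by (intro add_mono mult_left_mono dist_fst_le dist_snd_le M) auto
    finally show "dist (\<Phi> (fst p) (snd p)) (\<Phi> (fst q) (snd q)) \<le> (2 + M) * dist p q"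
      by (simp add: algebra_simps)
  qed (use M in auto)
  then have cont: "continuous_on (?V \<times> {0..<T}) (\<lambda>x. \<Phi> (fst x) (snd x))"
    by (rule lipschitz_on_continuous_on)
  have inD: "\<Phi> x t \<in> D" if "x \<in> ?V" "t \<in> {0..<T}" for x t
    using \<Phi>(2)[of x t] that sub by (auto simp: subset_iff)
  have der: "(\<Phi> x has_vector_derivative X (\<Phi> x t)) (at t within {0..<T})" if "x \<in> ?V" "t \<in> {0..<T}" for x t
    using \<Phi>(3)[of x t] that by (auto intro: has_vector_derivative_within_subset)
  \<comment> \<open>Being tame raises the order by one on the same set of data and times, so the
    interval does not shrink as \<open>l\<close> grows.\<close>
  have smooth: "smooth_family l ?V T \<Phi>" for l
  proof (induction l)
    case (Suc l)
    have "smooth_family l ?V T (\<lambda>z t. X (\<Phi> z t))"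
      by (rule tame_compose_smooth[OF X inD Suc])
    then show ?case
      using cont der by auto
  qed (use cont in simp)
  show thesis
    by (rule that[of "R / 2" T \<Phi>]) (use R T sub \<Phi>(1) inD der smooth in \<open>auto simp: subset_iff\<close>)
qed

section \<open>From smooth families to the topology of \<open>C_space\<close>\<close>

lemma nth_vector_derivative_Suc:
  "nth_vector_derivative S (Suc n) u = nth_vector_derivative S n (\<lambda>t. vector_derivative u (at t within S))"
  by (induction n) auto

text \<open>A derivative within \<open>S\<close> at a point of \<open>S\<close> sees only values on
  \<open>S\<close>. Hence the extensional restriction of a curve to \<open>{0..<T}\<close> has the
  same derivatives there as the curve.\<close>

lemma nth_vector_derivative_cong:
  assumes "\<And>t. t \<in> S \<Longrightarrow> u t = v t"
  shows "t \<in> S \<Longrightarrow> nth_vector_derivative S n u t = nth_vector_derivative S n v t"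
proof (induction n arbitrary: t)
  case (Suc n)
  have "(nth_vector_derivative S n u has_vector_derivative d) (at t within S) \<longleftrightarrow>
      (nth_vector_derivative S n v has_vector_derivative d) (at t within S)" for d
    using Suc has_vector_derivative_transform[of t S] by (smt (verit))
  then show ?case by (simp add: vector_derivative_def)
qed (use assms in simp)

lemma smooth_family_nth_vector_derivative_aux:
  fixes U :: "'p::topological_space \<Rightarrow> real \<Rightarrow> 'b::real_normed_vector"
  assumes "smooth_family l V T U"
  shows "(\<forall>n\<le>l. continuous_on (V \<times> {0..<T})
           (\<lambda>x. nth_vector_derivative {0..<T} n (U (fst x)) (snd x))) \<and>
    (\<forall>n<l. \<forall>z\<in>V. \<forall>t\<in>{0..<T}.
      nth_vector_derivative {0..<T} n (U z) differentiable (at t within {0..<T}))"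
  using assms
proof (induction l arbitrary: U)
  case 0
  then show ?case by simp
next
  case (Suc l)
  let ?S = "{0..<T}"
  obtain U' where U': "smooth_family l V T U'"
    and d: "\<And>z t. z \<in> V \<Longrightarrow> t \<in> ?S \<Longrightarrow> (U z has_vector_derivative U' z t) (at t within ?S)"
    using Suc.prems by auto
  note IH = Suc.IH[OF U']
  \<comment> \<open>\<open>nth_vector_derivative\<close> adds derivatives on the outside, while
    \<open>smooth_family\<close> peels off the first one; commuting the two lets the induction
    hypothesis for \<open>U'\<close> apply.\<close>
  have eq: "nth_vector_derivative ?S (Suc m) (U z) t = nth_vector_derivative ?S m (U' z) t"
    if z: "z \<in> V" and t: "t \<in> ?S" for m z t
    unfolding nth_vector_derivative_Suc
  proof (rule nth_vector_derivative_cong[OF _ t])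
    fix s assume s: "s \<in> ?S"
    \<comment> \<open>A derivative within the interval is unique only at limit points. Points to the
      right of \<open>s\<close> provide this at the left end 0 as well.\<close>
    have "at s within {s<..<T} \<noteq> bot" using s by (simp add: at_within_eq_bot_iff)
    then have "at s within ?S \<noteq> bot"
      using s at_le[of "{s<..<T}" "?S" s] by (auto simp: bot_unique subset_iff)
    then show "vector_derivative (U z) (at s within ?S) = U' z s"
      by (rule vector_derivative_within[OF _ d[OF z s]])
  qed
  have "continuous_on (V \<times> ?S) (\<lambda>x. nth_vector_derivative ?S n (U (fst x)) (snd x))" if "n \<le> Suc l" for n
  proof (cases n)
    case 0
    then show ?thesis using smooth_family_continuous[OF Suc.prems] by simp
  next
    case (Suc m)
    have "continuous_on (V \<times> ?S) (\<lambda>x. nth_vector_derivative ?S m (U' (fst x)) (snd x))"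
      using IH that Suc by auto
    also have "?this \<longleftrightarrow> continuous_on (V \<times> ?S) (\<lambda>x. nth_vector_derivative ?S n (U (fst x)) (snd x))"
      unfolding Suc by (intro continuous_on_cong) (auto simp: eq simp del: nth_vector_derivative.simps)
    finally show ?thesis .
  qed
  moreover have "nth_vector_derivative ?S n (U z) differentiable (at t within ?S)"
    if n: "n < Suc l" and z: "z \<in> V" and t: "t \<in> ?S" for n z t
  proof (cases n)
    case 0
    then show ?thesis using d[OF z t] by (auto simp: differentiableI_vector)
  next
    case (Suc m)
    have "nth_vector_derivative ?S m (U' z) differentiable (at t within ?S)"
      using IH n z t Suc by auto
    then show ?thesis
      using eq[OF z] t unfolding Suc differentiable_def
      by (meson has_derivative_transform)
  qed
  ultimately show ?case by blast
qed

lemmas smooth_family_nth_vector_derivative =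
  smooth_family_nth_vector_derivative_aux[THEN conjunct1, rule_format]
  smooth_family_nth_vector_derivative_aux[THEN conjunct2, rule_format]

lemma smooth_family_C_space:
  assumes U: "smooth_family l V T U" and z: "z \<in> V" and D: "\<And>t. t \<in> {0..<T} \<Longrightarrow> U z t \<in> D"
  shows "restrict (U z) {0..<T} \<in> C_space l T D"
proof -
  let ?S = "{0..<T}"
  have eq: "nth_vector_derivative ?S n (restrict (U z) ?S) t = nth_vector_derivative ?S n (U z) t"
    if "t \<in> ?S" for n t
    using that by (intro nth_vector_derivative_cong) auto
  have "nth_vector_derivative ?S n (restrict (U z) ?S) differentiable (at t within ?S)" if "n < l" "t \<in> ?S" for n t
    using smooth_family_nth_vector_derivative(2)[OF U that(1) z that(2)] eq that(2)
    unfolding differentiable_def by (meson has_derivative_transform)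
  moreover have "continuous_on ?S (nth_vector_derivative ?S n (restrict (U z) ?S))" if "n \<le> l" for n
  proof -
    have "continuous_on ?S (\<lambda>t. nth_vector_derivative ?S n (U (fst (z, t))) (snd (z, t)))"
      by (rule continuous_on_compose2[OF smooth_family_nth_vector_derivative(1)[OF U that]])
        (auto intro!: continuous_intros z)
    then show ?thesis by (rule continuous_on_eq) (simp add: eq)
  qed
  ultimately show ?thesis
    using D by (auto simp: C_space_def)
qed

text \<open>For each order \<open>n \<le> l\<close> the derivative is continuous on
  \<open>V \<times> K\<close>, so compactness of \<open>K\<close> gives a neighbourhood of the datum
  on which it is close uniformly in time. Finitely many orders allow these neighbourhoods to be
  intersected.\<close>

lemma smooth_family_continuous_map:
  fixes V :: "'p::topological_space set"
  assumes U: "smooth_family l V T U" and D: "\<And>z t. z \<in> V \<Longrightarrow> t \<in> {0..<T} \<Longrightarrow> U z t \<in> D"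
  shows "continuous_map (top_of_set V) (C_topology l T D) (\<lambda>z. restrict (U z) {0..<T})"
proof -
  let ?S = "{0..<T}" and ?F = "\<lambda>z. restrict (U z) {0..<T}"
  have eq: "nth_vector_derivative ?S n (?F z) t = nth_vector_derivative ?S n (U z) t"
    if "t \<in> ?S" for n t z
    using that by (intro nth_vector_derivative_cong) auto
  have Csp: "?F z \<in> C_space l T D" if "z \<in> V" for z
    by (rule smooth_family_C_space[OF U that D[OF that]])
  \<comment> \<open>\<open>C_nbhd\<close> lies in \<open>C_space\<close> by definition, so even the
    empty compact set witnesses openness. Thus the topology has all of \<open>C_space\<close> as its
    carrier.\<close>
  have top: "C_openin l T D (C_space l T D)"
    unfolding C_openin_def
    by (intro conjI ballI exI[of _ "{}"] exI[of _ "1::real"]) (auto simp: C_nbhd_def)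
  show ?thesis
    unfolding continuous_map
  proof (intro conjI allI impI)
    show "?F ` topspace (top_of_set V) \<subseteq> topspace (C_topology l T D)"
      using Csp openin_subset[of "C_topology l T D", unfolded openin_C_topology, OF top] by auto
    fix W assume "openin (C_topology l T D) W"
    then have W: "C_openin l T D W" by (simp add: openin_C_topology)
    have "openin (top_of_set V) {z \<in> V. ?F z \<in> W}"
    proof (subst openin_subopen, intro ballI)
      fix z assume z: "z \<in> {z \<in> V. ?F z \<in> W}"
      obtain K e where K: "compact K" "K \<subseteq> ?S" "e > 0" "C_nbhd l T D (?F z) K e \<subseteq> W"
        using W z unfolding C_openin_def by blast
      have "\<exists>A. z \<in> A \<and> open A \<and> (\<forall>x\<in>A \<inter> V. \<forall>t\<in>K.
          dist (nth_vector_derivative ?S n (U x) t) (nth_vector_derivative ?S n (U z) t) < e)"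
        if n: "n \<le> l" for n
      proof -
        have "continuous_on (V \<times> K) (\<lambda>x. nth_vector_derivative ?S n (U (fst x)) (snd x))"
          using smooth_family_nth_vector_derivative(1)[OF U n]
          by (rule continuous_on_subset) (use K in auto)
        \<comment> \<open>Compactness yields a non-strict bound, hence the use of
          \<open>e / 2\<close>.\<close>
        from continuous_on_prod_compactE[OF this K(1), of z "e / 2"] z K(3)
        obtain A where "z \<in> A" "open A"
          "\<forall>x\<in>A \<inter> V. \<forall>t\<in>K. dist (nth_vector_derivative ?S n (U x) t) (nth_vector_derivative ?S n (U z) t) \<le> e / 2"
          by auto
        with K(3) show ?thesis by (intro exI[of _ A]) force
      qed
      then obtain A where A: "\<And>n. n \<le> l \<Longrightarrow> z \<in> A n" "\<And>n. n \<le> l \<Longrightarrow> open (A n)"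
        "\<And>n x t. n \<le> l \<Longrightarrow> x \<in> A n \<inter> V \<Longrightarrow> t \<in> K \<Longrightarrow>
          dist (nth_vector_derivative ?S n (U x) t) (nth_vector_derivative ?S n (U z) t) < e"
        by metis
      define B where "B = V \<inter> (\<Inter>n\<in>{..l}. A n)"
      have "openin (top_of_set V) B"
        unfolding B_def using A(2) by (intro openin_open_Int open_INT) auto
      moreover have "z \<in> B" using z A(1) by (auto simp: B_def)
      moreover have "B \<subseteq> {z \<in> V. ?F z \<in> W}"
      proof
        fix x assume x: "x \<in> B"
        then have xV: "x \<in> V" by (simp add: B_def)
        have "?F x \<in> C_nbhd l T D (?F z) K e"
          unfolding C_nbhd_def using Csp[OF xV] A(3) x K(2)
          by (auto simp: B_def eq subset_iff)
        then show "x \<in> {z \<in> V. ?F z \<in> W}" using K(4) xV by blast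
      qed
      ultimately show "\<exists>B. openin (top_of_set V) B \<and> z \<in> B \<and> B \<subseteq> {z \<in> V. ?F z \<in> W}" by blast
    qed
    then show "openin (top_of_set V) {z \<in> topspace (top_of_set V). ?F z \<in> W}" by simp
  qed
qed

section \<open>Fourier series and the space \<open>\<H>\<^sup>1\<close>\<close>

abbreviation fourier_basis :: "int \<Rightarrow> real \<Rightarrow> complex" where
  "fourier_basis k y \<equiv> exp (2 * pi * \<i> * of_int k * of_real y)"

definition fourier_series :: "(int \<Rightarrow> complex) \<Rightarrow> real \<Rightarrow> complex" where
  "fourier_series a y = (\<Sum>\<^sub>\<infinity>k. a k * fourier_basis k y)"

lemma fourier_basis_cis: "fourier_basis k y = cis (2 * pi * real_of_int k * y)"
  by (simp add: cis_conv_exp mult_ac)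

lemma norm_fourier_basis [simp]: "cmod (fourier_basis k y) = 1"
  unfolding fourier_basis_cis by simp

lemma fourier_basis_periodic: "fourier_basis k (y + 1) = fourier_basis k y"
proof -
  have "fourier_basis k (y + 1) = fourier_basis k y * cis (2 * pi * real_of_int k)"
    unfolding fourier_basis_cis cis_mult by (simp add: algebra_simps)
  also have "cis (2 * pi * real_of_int k) = 1"
    by (metis cis_multiple_2pi Ints_of_int mult.commute mult.left_commute)
  finally show ?thesis by simp
qed

lemma continuous_fourier_basis [continuous_intros]: "continuous_on A (fourier_basis k)"
  by (intro continuous_intros)

lemma fourier_coeff_basis_mult: "fourier_coeff (\<lambda>y. fourier_basis m y * f y) k = fourier_coeff f (k - m)"
  by (rule fourier_coeff_exp)

lemma fourier_coeff_1: "fourier_coeff (\<lambda>y. 1) k = (if k = 0 then 1 else 0)"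
proof (cases "k = 0")
  case False
  define c where "c = - 2 * pi * \<i> * of_int k"
  have c: "c \<noteq> 0" using False by (simp add: c_def)
  have "((\<lambda>y. exp (c * of_real y)) has_integral (exp (c * of_real 1) / c - exp (c * of_real 0) / c)) {0..1}"
    by (rule fundamental_theorem_of_calculus)
      (auto intro!: derivative_eq_intros has_vector_derivative_real_field simp: c)
  moreover have "exp c = 1"
  proof -
    have "exp c = fourier_basis (-k) (0 + 1)" by (simp add: c_def)
    also have "\<dots> = 1" unfolding fourier_basis_periodic by simp
    finally show ?thesis .
  qed
  ultimately show ?thesis
    using False by (simp add: fourier_coeff_def c_def integral_unique)
qed (simp add: fourier_coeff_def)

lemma fourier_coeff_basis: "fourier_coeff (fourier_basis m) k = (if k = m then 1 else 0)"
  using fourier_coeff_basis_mult[of m "\<lambda>y. 1" k] by (simp add: fourier_coeff_1)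

text \<open>The M-test along finite index sets gives uniform convergence, which transfers continuity
  and permits integration term by term. The resulting convolution formula is used with
  \<open>h = 1\<close> to recover coefficients, with the conjugate for Parseval, and with a
  reflected function for the pairing.\<close>

lemma
  assumes a: "(\<lambda>k. cmod (a k)) summable_on UNIV"
  shows continuous_fourier_series: "continuous_on A (fourier_series a)"
    and fourier_series_periodic: "fourier_series a (y + 1) = fourier_series a y"
    and fourier_coeff_series_mult: "continuous_on UNIV h \<Longrightarrow>
      ((\<lambda>j. a j * fourier_coeff h (k - j)) has_sum fourier_coeff (\<lambda>y. fourier_series a y * h y) k) UNIV"
proof -
  have s: "(\<lambda>k. a k * fourier_basis k y) summable_on UNIV" for y
    by (rule abs_summable_summable) (use a in \<open>simp add: norm_mult\<close>)
  have "uniform_limit UNIV (\<lambda>X y. \<Sum>k\<in>X. a k * fourier_basis k y) (fourier_series a) (finite_subsets_at_top UNIV)"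
    unfolding fourier_series_def[abs_def]
    by (rule Weierstrass_m_test_general[OF _ a]) (simp add: norm_mult)
  then have "continuous_on UNIV (fourier_series a)"
    by (rule uniform_limit_theorem[rotated]) (auto intro!: always_eventually continuous_intros)
  then show "continuous_on A (fourier_series a)" by (rule continuous_on_subset) auto
  show "fourier_series a (y + 1) = fourier_series a y"
    unfolding fourier_series_def fourier_basis_periodic ..
  assume h: "continuous_on UNIV h"
  have hc: "continuous_on {0..1} h" using h by (rule continuous_on_subset) auto
  have "compact (h ` {0..1})" by (intro compact_continuous_image hc) auto
  then obtain B where B: "\<And>y. y \<in> {0..1} \<Longrightarrow> cmod (h y) \<le> B"
    using compact_imp_bounded bounded_iff by (metis imageI)
  let ?f = "\<lambda>j y. a j * fourier_basis j y * h y * exp (- 2 * pi * \<i> * of_int k * of_real y)"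
  let ?g = "\<lambda>y. fourier_series a y * h y * exp (- 2 * pi * \<i> * of_int k * of_real y)"
  have ul: "uniform_limit {0..1} (\<lambda>X y. \<Sum>j\<in>X. ?f j y) ?g (finite_subsets_at_top UNIV)"
  proof (rule Weierstrass_m_test_general'[where M = "\<lambda>j. cmod (a j) * B"])
    fix j and y :: real assume "y \<in> {0..1}"
    then have "cmod (a j) * cmod (h y) \<le> cmod (a j) * B" by (intro mult_left_mono B) auto
    moreover have "cmod (exp (- 2 * pi * \<i> * of_int k * of_real y)) = 1"
      using norm_fourier_basis[of "-k" y] by simp
    ultimately show "cmod (?f j y) \<le> cmod (a j) * B" by (simp add: norm_mult)
  next
    fix y :: real
    show "((\<lambda>j. ?f j y) has_sum ?g y) UNIV"
      by (intro has_sum_cmult_left) (use s[of y] in \<open>simp add: fourier_series_def\<close>)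
  next
    show "(\<lambda>j. cmod (a j) * B) summable_on UNIV"
      using a by (rule summable_on_cmult_left)
  qed
  obtain I J where I: "\<And>X. ((\<lambda>y. \<Sum>j\<in>X. ?f j y) has_integral I X) {0..1}"
    and J: "(?g has_integral J) {0..1}" and lim: "(I \<longlongrightarrow> J) (finite_subsets_at_top UNIV)"
    by (rule uniform_limit_integral[OF ul]) (auto intro!: continuous_intros hc)
  have "(I \<longlongrightarrow> fourier_coeff (\<lambda>y. fourier_series a y * h y) k) (finite_subsets_at_top UNIV)"
    using lim J by (simp add: fourier_coeff_def integral_unique)
  moreover have "\<forall>\<^sub>F X in finite_subsets_at_top UNIV. I X = (\<Sum>j\<in>X. a j * fourier_coeff h (k - j))"
  proof (rule eventually_finite_subsets_at_top_weakI)
    fix X :: "int set" assume X: "finite X"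
    have f: "(?f j has_integral a j * fourier_coeff h (k - j)) {0..1}" for j
    proof -
      have "continuous_on UNIV (\<lambda>y. fourier_basis j y * h y)" by (intro continuous_intros h)
      from has_integral_mult_right[OF integrable_integral[OF fourier_coeff_integrable[OF this]], of "a j" k]
      show ?thesis
        unfolding fourier_coeff_def[symmetric] fourier_coeff_basis_mult by (simp only: mult.assoc)
    qed
    show "I X = (\<Sum>j\<in>X. a j * fourier_coeff h (k - j))"
      using has_integral_unique[OF I has_integral_sum[OF X f]] .
  qed
  ultimately show "((\<lambda>j. a j * fourier_coeff h (k - j)) has_sum fourier_coeff (\<lambda>y. fourier_series a y * h y) k) UNIV"
    unfolding has_sum_def by (simp add: filterlim_cong)
qed

lemma fourier_coeff_series:
  assumes "(\<lambda>k. cmod (a k)) summable_on UNIV"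
  shows "fourier_coeff (fourier_series a) k = a k"
proof -
  have "((\<lambda>j. a j * (if k - j = 0 then 1 else 0)) has_sum fourier_coeff (\<lambda>y. fourier_series a y * 1) k) UNIV"
    using fourier_coeff_series_mult[OF assms, of "\<lambda>y. 1" k] by (simp add: fourier_coeff_1)
  moreover have "((\<lambda>j. a j * (if k - j = 0 then 1 else 0)) has_sum a k) UNIV"
    by (rule has_sum_cong_neutral[THEN iffD1, OF _ _ _ has_sum_finite[of "{k}" "\<lambda>j. a j * (if k - j = 0 then 1 else 0)", simplified]]) auto
  ultimately show ?thesis by (simp add: has_sum_unique)
qed

lemma fourier_series_unique:
  assumes f: "continuous_on UNIV f" "\<And>y. f (y + 1) = f y"
    and a: "(\<lambda>k. cmod (a k)) summable_on UNIV" and eq: "\<And>k. fourier_coeff f k = a k"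
  shows "f = fourier_series a"
proof -
  note c = continuous_fourier_series[OF a, of UNIV]
  have z: "fourier_coeff (\<lambda>y. f y + (-1) * fourier_series a y) k = 0" for k
    unfolding fourier_coeff_add[OF f(1) continuous_on_mult_left[OF c]] fourier_coeff_cmult
      fourier_coeff_series[OF a] eq by simp
  have "(\<lambda>y. f y + (-1) * fourier_series a y) = (\<lambda>y. 0)"
    by (rule fourier_coeff_unique[OF _ _ z])
      (auto intro!: continuous_intros f c simp: f(2) fourier_series_periodic[OF a])
  from fun_cong[OF this] show ?thesis by (intro ext) simp
qed

subsection \<open>Parseval and Bessel\<close>

lemma fourier_coeff_cnj: "fourier_coeff (\<lambda>y. cnj (f y)) k = cnj (fourier_coeff f (- k))"
  by (simp add: fourier_coeff_def integral_cnj exp_cnj)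

lemma integral_cnj_mult:
  fixes f :: "real \<Rightarrow> complex"
  assumes "continuous_on UNIV f"
  shows "fourier_coeff (\<lambda>y. f y * cnj (f y)) 0 = of_real (integral {0..1} (\<lambda>y. (cmod (f y))\<^sup>2))"
proof -
  have "continuous_on {0..1} f" using assms by (rule continuous_on_subset) auto
  then have "((\<lambda>y. (cmod (f y))\<^sup>2) has_integral integral {0..1} (\<lambda>y. (cmod (f y))\<^sup>2)) {0..1}"
    by (intro integrable_integral integrable_continuous_real continuous_intros)
  from has_integral_linear[OF this, of complex_of_real] show ?thesis
    by (simp add: fourier_coeff_def o_def complex_norm_square integral_unique bounded_linear_of_real del: of_real_power)
qed

lemma parseval:
  assumes f: "continuous_on UNIV f" "\<And>y. f (y + 1) = f y"
    and s: "(\<lambda>k. cmod (fourier_coeff f k)) summable_on UNIV"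
  shows "((\<lambda>k. (cmod (fourier_coeff f k))\<^sup>2) has_sum integral {0..1} (\<lambda>y. (cmod (f y))\<^sup>2)) UNIV"
proof -
  have "f = fourier_series (fourier_coeff f)" by (rule fourier_series_unique[OF f s]) auto
  moreover have "continuous_on UNIV (\<lambda>y. cnj (f y))" by (intro continuous_intros f)
  ultimately have "((\<lambda>j. fourier_coeff f j * fourier_coeff (\<lambda>y. cnj (f y)) (0 - j))
      has_sum fourier_coeff (\<lambda>y. f y * cnj (f y)) 0) UNIV"
    using fourier_coeff_series_mult[OF s, of "\<lambda>y. cnj (f y)" 0] by simp
  then have "((\<lambda>j. complex_of_real ((cmod (fourier_coeff f j))\<^sup>2)) has_sum
      of_real (integral {0..1} (\<lambda>y. (cmod (f y))\<^sup>2))) UNIV"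
    by (simp add: integral_cnj_mult[OF f(1)] fourier_coeff_cnj complex_norm_square del: of_real_power)
  then show ?thesis by (simp only: has_sum_of_real_iff)
qed

text \<open>Summability of the coefficients is what is to be proved later, so Parseval is applied
  only to the partial sum \<open>s\<close> over \<open>F\<close>. Its squared norm and its inner
  product with \<open>f\<close> both equal \<open>E\<close>, and |s f| \<le> (|s|^2 + |f|^2)/2 gives
  E \<le> (E + integral of |f|^2)/2.\<close>

lemma bessel:
  assumes f: "continuous_on UNIV f" and F: "finite F"
  shows "(\<Sum>k\<in>F. (cmod (fourier_coeff f k))\<^sup>2) \<le> integral {0..1} (\<lambda>y. (cmod (f y))\<^sup>2)"
proof -
  define a where "a k = (if k \<in> F then fourier_coeff f k else 0)" for k
  define E where "E = (\<Sum>k\<in>F. (cmod (fourier_coeff f k))\<^sup>2)"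
  have a: "(\<lambda>k. cmod (a k)) summable_on UNIV"
    by (rule summable_on_cong_neutral[THEN iffD1, OF _ _ _ summable_on_finite[OF F]]) (auto simp: a_def)
  define s where "s = fourier_series a"
  have s: "continuous_on UNIV s" unfolding s_def by (rule continuous_fourier_series[OF a])
  have fs: "fourier_coeff s k = a k" for k unfolding s_def by (rule fourier_coeff_series[OF a])
  have "(\<lambda>k. cmod (fourier_coeff s k)) summable_on UNIV" unfolding fs by (rule a)
  then have "((\<lambda>k. (cmod (fourier_coeff s k))\<^sup>2) has_sum integral {0..1} (\<lambda>y. (cmod (s y))\<^sup>2)) UNIV"
    by (intro parseval s) (simp add: s_def fourier_series_periodic[OF a])
  moreover have "((\<lambda>k. (cmod (fourier_coeff s k))\<^sup>2) has_sum E) UNIV"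
    unfolding fs E_def
    by (rule has_sum_cong_neutral[THEN iffD1, OF _ _ _ has_sum_finite[OF F]]) (auto simp: a_def)
  ultimately have ss: "integral {0..1} (\<lambda>y. (cmod (s y))\<^sup>2) = E" by (rule has_sum_unique)
  have "((\<lambda>j. a j * fourier_coeff (\<lambda>y. cnj (f y)) (0 - j)) has_sum fourier_coeff (\<lambda>y. s y * cnj (f y)) 0) UNIV"
    unfolding s_def by (intro fourier_coeff_series_mult a continuous_intros f)
  moreover have "((\<lambda>j. a j * fourier_coeff (\<lambda>y. cnj (f y)) (0 - j)) has_sum of_real E) UNIV"
    unfolding E_def of_real_sum
    by (rule has_sum_cong_neutral[THEN iffD1, OF _ _ _ has_sum_finite[OF F]])
      (auto simp: a_def fourier_coeff_cnj complex_norm_square simp del: of_real_power)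
  ultimately have "fourier_coeff (\<lambda>y. s y * cnj (f y)) 0 = of_real E" by (rule has_sum_unique)
  then have sf: "integral {0..1} (\<lambda>y. s y * cnj (f y)) = of_real E" by (simp add: fourier_coeff_def)
  have c: "continuous_on {0..1} f" "continuous_on {0..1} s"
    using f s by (auto intro: continuous_on_subset)
  have "E = cmod (integral {0..1} (\<lambda>y. s y * cnj (f y)))"
    unfolding sf norm_of_real by (simp add: E_def sum_nonneg)
  also have "\<dots> \<le> integral {0..1} (\<lambda>y. ((cmod (s y))\<^sup>2 + (cmod (f y))\<^sup>2) / 2)"
  proof (rule integral_norm_bound_integral)
    fix y :: real
    show "cmod (s y * cnj (f y)) \<le> ((cmod (s y))\<^sup>2 + (cmod (f y))\<^sup>2) / 2"
      using sum_squares_bound[of "cmod (s y)" "cmod (f y)"] by (simp add: norm_mult)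
  qed (auto intro!: integrable_continuous_real continuous_intros c)
  also have "\<dots> = (E + integral {0..1} (\<lambda>y. (cmod (f y))\<^sup>2)) / 2"
    unfolding ss[symmetric]
    by (simp, subst integral_add) (auto intro!: integrable_continuous_real continuous_intros c)
  finally show ?thesis by (simp add: E_def)
qed

lemma integral_periodic_shift:
  fixes g :: "real \<Rightarrow> complex"
  assumes g: "continuous_on UNIV g" "\<And>y. g (y + 1) = g y" and h: "h \<in> {0..1}"
  shows "integral {0..1} (\<lambda>y. g (y + h)) = integral {0..1} g"
proof -
  have i: "g integrable_on {a..b}" for a b
    using g(1) by (intro integrable_continuous_real) (rule continuous_on_subset, auto)
  have "integral {0..1} (\<lambda>y. g (y + h)) = integral {0+h..1+h} g"
    unfolding integral_shift_Icc_real[symmetric] by (simp add: o_def add.commute)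
  also have "\<dots> = integral {h..1} g + integral {1..1+h} g"
    using h by (simp add: Henstock_Kurzweil_Integration.integral_combine[OF _ _ i])
  also have "integral {1..1+h} g = integral {0..h} g"
    using integral_shift_Icc_real[of 0 h g 1] by (simp add: o_def add.commute g(2))
  finally show ?thesis
    using h by (simp add: add.commute Henstock_Kurzweil_Integration.integral_combine[OF _ _ i])
qed

lemma fourier_coeff_translate:
  assumes f: "continuous_on UNIV f" "\<And>y. f (y + 1) = f y" and h: "h \<in> {0..1}"
  shows "fourier_coeff (\<lambda>y. f (y + h)) k = fourier_basis k h * fourier_coeff f k"
proof -
  let ?g = "\<lambda>y. f y * fourier_basis (-k) y"
  have "fourier_coeff (\<lambda>y. f (y + h)) k = integral {0..1} (\<lambda>y. fourier_basis k h * ?g (y + h))"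
    unfolding fourier_coeff_def
    by (intro integral_cong) (simp add: exp_add[symmetric] algebra_simps)
  also have "\<dots> = fourier_basis k h * integral {0..1} (\<lambda>y. ?g (y + h))" by simp
  also have "integral {0..1} (\<lambda>y. ?g (y + h)) = integral {0..1} ?g"
  proof (rule integral_periodic_shift[OF _ _ h])
    show "?g (y + 1) = ?g y" for y by (simp only: f fourier_basis_periodic)
  qed (intro continuous_intros f)
  finally show ?thesis by (simp add: fourier_coeff_def)
qed

text \<open>Translation multiplies the coefficient by a unit complex number, and |cis (2x) - 1| = 2
  |sin x|. Being an equality, it serves both directions of the characterization: |sin x| \<le> |x|
  for the upper bound, the limit of sin(x h)/h for the converse.\<close>

lemma fourier_coeff_difference:
  assumes f: "continuous_on UNIV f" "\<And>y. f (y + 1) = f y" and h: "h \<in> {0..1}"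
  shows "cmod (fourier_coeff (\<lambda>y. f (y + h) - f y) k) = 2 * \<bar>sin (pi * of_int k * h)\<bar> * cmod (fourier_coeff f k)"
proof -
  have c: "continuous_on UNIV (\<lambda>y. f (y + h))"
    by (rule continuous_on_compose2[OF f(1)]) (auto intro!: continuous_intros)
  have "fourier_coeff (\<lambda>y. f (y + h) + (-1) * f y) k = (fourier_basis k h - 1) * fourier_coeff f k"
    unfolding fourier_coeff_add[OF c continuous_on_mult_left[OF f(1)]] fourier_coeff_cmult
      fourier_coeff_translate[OF f h] by (simp add: algebra_simps)
  moreover have "cmod (fourier_basis k h - 1) = 2 * \<bar>sin (pi * of_int k * h)\<bar>"
  proof -
    have "cmod (cis (2 * x) - 1) = 2 * \<bar>sin x\<bar>" for x
    proof -
      have "cis (2 * x) - 1 = Complex 0 (2 * sin x) * cis x"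
        by (simp add: complex_eq_iff sin_double[of x] cos_double_sin power2_eq_square)
      moreover have "cmod (Complex 0 b) = \<bar>b\<bar>" for b by (simp add: complex_norm)
      then have "cmod (Complex 0 (2 * sin x)) = 2 * \<bar>sin x\<bar>" by (simp add: abs_mult)
      ultimately show ?thesis by (simp only: norm_mult norm_cis mult_1_right)
    qed
    from this[of "pi * of_int k * h"] show ?thesis
      unfolding fourier_basis_cis by (simp add: mult_ac)
  qed
  ultimately show ?thesis by (simp add: norm_mult)
qed

subsection \<open>Sobolev sequences and difference quotients\<close>

lemma jap_minus [simp]: "jap (- k) = jap k"
  by (simp add: jap_def)

lemma summable_inverse_jap_square: "(\<lambda>k. 1 / (jap k)\<^sup>2) summable_on UNIV"
proof -
  have n: "(\<lambda>n::nat. 1 / (jap (int n))\<^sup>2) summable_on UNIV"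
  proof (rule norm_summable_imp_summable_on, rule summable_comparison_test')
    show "summable (\<lambda>n. inverse (real n ^ 2))" by (rule inverse_power_summable) simp
    show "norm (norm (1 / (jap (int n))\<^sup>2)) \<le> inverse (real n ^ 2)" if "n \<ge> 1" for n
      using that by (simp add: jap_def divide_simps)
  qed
  have "(\<lambda>k. 1 / (jap k)\<^sup>2) summable_on range int"
    using n by (subst summable_on_reindex) (auto simp: o_def)
  moreover have "(\<lambda>k. 1 / (jap k)\<^sup>2) summable_on range (\<lambda>n. - int n)"
    using n by (subst summable_on_reindex) (auto simp: o_def inj_on_def)
  ultimately have "(\<lambda>k. 1 / (jap k)\<^sup>2) summable_on range int \<union> range (\<lambda>n. - int n)"
    by (rule summable_on_union)
  moreover have "range int \<union> range (\<lambda>n. - int n) = UNIV"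
    by (auto simp: image_iff) (metis int_cases2)
  ultimately show ?thesis by simp
qed

text \<open>The constant produced by Cauchy-Schwarz when |a_k| is split as (1 / jap k) times (|a_k|
  jap k); it bounds the sup norm by the H^1 norm.\<close>

definition sobolev_const :: real where
  "sobolev_const = sqrt (\<Sum>\<^sub>\<infinity>k. 1 / (jap k)\<^sup>2)"

lemma sobolev_const_nonneg: "sobolev_const \<ge> 0"
  by (simp add: sobolev_const_def infsum_nonneg)

lemma
  assumes a: "(\<lambda>k. (cmod (a k))\<^sup>2 * (jap k)\<^sup>2) summable_on UNIV"
  shows weighted_summable_imp_summable: "(\<lambda>k. cmod (a k)) summable_on UNIV"
    and weighted_infsum_bound:
      "(\<Sum>\<^sub>\<infinity>k. cmod (a k)) \<le> sobolev_const * sqrt (\<Sum>\<^sub>\<infinity>k. (cmod (a k))\<^sup>2 * (jap k)\<^sup>2)"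
proof -
  let ?C = "sobolev_const * sqrt (\<Sum>\<^sub>\<infinity>k. (cmod (a k))\<^sup>2 * (jap k)\<^sup>2)"
  have fin: "(\<Sum>k\<in>F. cmod (a k)) \<le> ?C" if F: "finite F" for F
  proof -
    have "(\<Sum>k\<in>F. cmod (a k)) = (\<Sum>k\<in>F. \<bar>1 / jap k\<bar> * \<bar>cmod (a k) * jap k\<bar>)"
      using jap_pos by (intro sum.cong) (auto simp: abs_mult less_imp_neq[THEN not_sym])
    also have "\<dots> \<le> L2_set (\<lambda>k. 1 / jap k) F * L2_set (\<lambda>k. cmod (a k) * jap k) F"
      by (rule L2_set_mult_ineq)
    also have "\<dots> \<le> ?C"
      unfolding L2_set_def sobolev_const_def
      by (intro mult_mono real_sqrt_le_mono)
        (auto intro!: finite_sum_le_infsum[OF a F] finite_sum_le_infsum[OF summable_inverse_jap_square F]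
          sum_nonneg infsum_nonneg simp: power_mult_distrib power_divide)
    finally show ?thesis .
  qed
  show s: "(\<lambda>k. cmod (a k)) summable_on UNIV"
    by (rule nonneg_bdd_above_summable_on) (auto intro!: bdd_aboveI2 fin)
  show "(\<Sum>\<^sub>\<infinity>k. cmod (a k)) \<le> ?C"
    by (rule infsum_le_finite_sums[OF s fin])
qed

lemma H1_periodic: "f \<in> H1 \<Longrightarrow> f (y + 1) = f y"
  by (simp add: H1_def)

lemma H1_weighted_summable:
  "f \<in> H1 \<Longrightarrow> (\<lambda>k. (cmod (fourier_coeff f k))\<^sup>2 * (jap k)\<^sup>2) summable_on UNIV"
  by (simp add: H1_def)

lemmas H1_summable = weighted_summable_imp_summable[OF H1_weighted_summable]

lemma H1_fourier_series: "f \<in> H1 \<Longrightarrow> f = fourier_series (fourier_coeff f)"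
  by (rule fourier_series_unique) (auto simp: H1_continuous H1_periodic H1_summable)

lemma H1_eqI: "f \<in> H1 \<Longrightarrow> g \<in> H1 \<Longrightarrow> (\<And>k. fourier_coeff f k = fourier_coeff g k) \<Longrightarrow> f = g"
  by (metis H1_fourier_series ext)

lemma H1_norm_sq: "(H1_norm f)\<^sup>2 = (\<Sum>\<^sub>\<infinity>k. (cmod (fourier_coeff f k))\<^sup>2 * (jap k)\<^sup>2)"
  by (simp add: H1_norm_def infsum_nonneg)

lemma H1_sup_bound:
  assumes "f \<in> H1"
  shows "cmod (f y) \<le> sobolev_const * H1_norm f"
proof -
  have "cmod (f y) = cmod (\<Sum>\<^sub>\<infinity>k. fourier_coeff f k * fourier_basis k y)"
    using fun_cong[OF H1_fourier_series[OF assms], of y] by (simp add: fourier_series_def)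
  also have "\<dots> \<le> (\<Sum>\<^sub>\<infinity>k. cmod (fourier_coeff f k * fourier_basis k y))"
    by (rule norm_infsum_bound) (use H1_summable[OF assms] in \<open>simp add: norm_mult\<close>)
  also have "\<dots> \<le> sobolev_const * H1_norm f"
    using weighted_infsum_bound[OF H1_weighted_summable[OF assms]] by (simp add: norm_mult H1_norm_def)
  finally show ?thesis .
qed

lemma
  assumes a: "(\<lambda>k. (cmod (a k))\<^sup>2 * (jap k)\<^sup>2) summable_on UNIV"
  shows fourier_series_H1: "fourier_series a \<in> H1"
    and fourier_coeff_series_H1: "fourier_coeff (fourier_series a) k = a k"
proof -
  note s = weighted_summable_imp_summable[OF a]
  show "fourier_coeff (fourier_series a) k = a k" for k
    by (rule fourier_coeff_series[OF s])
  with a show "fourier_series a \<in> H1"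
    by (auto simp: H1_def fourier_series_periodic[OF s] intro!: continuous_fourier_series[OF s])
qed

lemma H1_difference_bound:
  assumes f: "f \<in> H1" and h: "h \<in> {0..1}"
  shows "integral {0..1} (\<lambda>y. (cmod (f (y + h) - f y))\<^sup>2) \<le> (2 * pi * h * H1_norm f)\<^sup>2"
proof -
  note fc = H1_continuous[OF f] H1_periodic[OF f]
  let ?g = "\<lambda>y. f (y + h) - f y"
  have c: "continuous_on UNIV (\<lambda>y. f (y + h))"
    by (rule continuous_on_compose2[OF fc(1)]) (auto intro!: continuous_intros)
  have cg: "continuous_on UNIV ?g" by (intro continuous_intros c fc(1))
  have pg: "?g (y + 1) = ?g y" for y using fc(2)[of "y + h"] fc(2)[of y] by (simp add: add_ac)
  \<comment> \<open>This crude bound only secures summable coefficients, so that Parseval applies to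
    the difference. The factor \<open>h\<close> comes from \<open>k2\<close>.\<close>
  have k1: "cmod (fourier_coeff ?g k) \<le> 2 * cmod (fourier_coeff f k)" for k
    unfolding fourier_coeff_difference[OF fc h] by (intro mult_right_mono) (auto simp: abs_sin_le_one)
  have sg: "(\<lambda>k. cmod (fourier_coeff ?g k)) summable_on UNIV"
    by (rule summable_on_comparison_test[OF summable_on_cmult_right[OF H1_summable[OF f], of 2]])
      (use k1 in auto)
  have k2: "(cmod (fourier_coeff ?g k))\<^sup>2 \<le> (2 * pi * h)\<^sup>2 * ((cmod (fourier_coeff f k))\<^sup>2 * (jap k)\<^sup>2)" for k
  proof -
    have "\<bar>sin (pi * of_int k * h)\<bar> \<le> \<bar>pi * of_int k * h\<bar>" by (rule abs_sin_x_le_abs_x)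
    also have "\<dots> \<le> pi * h * jap k" using h by (auto simp: jap_def abs_mult)
    finally have "2 * \<bar>sin (pi * of_int k * h)\<bar> * cmod (fourier_coeff f k) \<le> 2 * (pi * h * jap k) * cmod (fourier_coeff f k)"
      by (intro mult_right_mono mult_left_mono) auto
    then have "cmod (fourier_coeff ?g k) \<le> 2 * (pi * h * jap k) * cmod (fourier_coeff f k)"
      unfolding fourier_coeff_difference[OF fc h] .
    then have "(cmod (fourier_coeff ?g k))\<^sup>2 \<le> (2 * (pi * h * jap k) * cmod (fourier_coeff f k))\<^sup>2"
      by (intro power_mono) auto
    then show ?thesis by (simp add: power_mult_distrib mult_ac)
  qed
  have "integral {0..1} (\<lambda>y. (cmod (?g y))\<^sup>2) = (\<Sum>\<^sub>\<infinity>k. (cmod (fourier_coeff ?g k))\<^sup>2)"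
    using infsumI[OF parseval[OF cg pg sg]] by simp
  also have "\<dots> \<le> (\<Sum>\<^sub>\<infinity>k. (2 * pi * h)\<^sup>2 * ((cmod (fourier_coeff f k))\<^sup>2 * (jap k)\<^sup>2))"
    by (intro infsum_mono k2 summable_on_cmult_right H1_weighted_summable f
        has_sum_imp_summable[OF parseval[OF cg pg sg]])
  also have "\<dots> = (2 * pi * h * H1_norm f)\<^sup>2"
    by (simp add: infsum_cmult_right' H1_norm_sq[symmetric] power_mult_distrib)
  finally show ?thesis .
qed

text \<open>Bessel applied to the difference, divided by h^2, bounds finite sums by K^2 for every h,
  and h \<rightarrow> 0 gives the weight (2 pi k)^2, of which only k^2 is kept. Differences do not
  see the mean; the zeroth term is controlled by the sup bound \<open>B\<close>.\<close>

lemma H1_of_difference_bound: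
  assumes f: "continuous_on UNIV f" "\<And>y. f (y + 1) = f y" and B: "\<And>y. cmod (f y) \<le> B"
    and K: "\<And>h. h \<in> {0<..1} \<Longrightarrow> integral {0..1} (\<lambda>y. (cmod (f (y + h) - f y))\<^sup>2) \<le> (K * h)\<^sup>2"
  shows "f \<in> H1" and "(H1_norm f)\<^sup>2 \<le> B\<^sup>2 + K\<^sup>2"
proof -
  have fin: "(\<Sum>k\<in>F. (cmod (fourier_coeff f k))\<^sup>2 * (jap k)\<^sup>2) \<le> B\<^sup>2 + K\<^sup>2" if F: "finite F" for F
  proof -
    have lim: "((\<lambda>h. \<Sum>k\<in>F. (2 * \<bar>sin (pi * of_int k * h) / h\<bar> * cmod (fourier_coeff f k))\<^sup>2) \<longlongrightarrow>
        (\<Sum>k\<in>F. (2 * \<bar>pi * of_int k\<bar> * cmod (fourier_coeff f k))\<^sup>2)) (at_right 0)"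
    proof (intro tendsto_intros)
      fix k :: int
      have "DERIV (\<lambda>h. sin (pi * of_int k * h)) 0 :> pi * of_int k"
        by (auto intro!: derivative_eq_intros)
      then have "((\<lambda>h. sin (pi * of_int k * h) / h) \<longlongrightarrow> pi * of_int k) (at 0)"
        by (simp add: DERIV_def)
      then show "((\<lambda>h. sin (pi * of_int k * h) / h) \<longlongrightarrow> pi * of_int k) (at_right 0)"
        by (rule filterlim_mono) (auto intro: at_le)
    qed
    have le: "(\<Sum>k\<in>F. (2 * \<bar>sin (pi * of_int k * h) / h\<bar> * cmod (fourier_coeff f k))\<^sup>2) \<le> K\<^sup>2"
      if h: "h \<in> {0<..1}" for h
    proof -
      have h': "h \<in> {0..1}" using h by auto
      have c: "continuous_on UNIV (\<lambda>y. f (y + h) - f y)"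
        by (intro continuous_intros f continuous_on_compose2[OF f(1), of UNIV "\<lambda>y. y + h"]) auto
      have "(\<Sum>k\<in>F. (2 * \<bar>sin (pi * of_int k * h) / h\<bar> * cmod (fourier_coeff f k))\<^sup>2)
          = (\<Sum>k\<in>F. (cmod (fourier_coeff (\<lambda>y. f (y + h) - f y) k))\<^sup>2) / h\<^sup>2"
        unfolding fourier_coeff_difference[OF f h'] sum_divide_distrib
        using h by (intro sum.cong) (auto simp: power_mult_distrib power_divide)
      also have "\<dots> \<le> (K * h)\<^sup>2 / h\<^sup>2"
        by (intro divide_right_mono order_trans[OF bessel[OF c F] K[OF h]]) auto
      also have "\<dots> = K\<^sup>2" using h by (simp add: power_mult_distrib)
      finally show ?thesis .
    qed
    have le1: "(\<Sum>k\<in>F. (2 * \<bar>pi * of_int k\<bar> * cmod (fourier_coeff f k))\<^sup>2) \<le> K\<^sup>2"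
      by (rule tendsto_upperbound[OF lim], rule eventually_at_rightI[of 0 1], rule le) auto
    have le2: "(cmod (fourier_coeff f k) * real_of_int k)\<^sup>2 \<le> (2 * \<bar>pi * of_int k\<bar> * cmod (fourier_coeff f k))\<^sup>2" for k
    proof -
      have "\<bar>real_of_int k\<bar> \<le> 2 * \<bar>pi * of_int k\<bar>"
        using pi_ge_two mult_right_mono[of 1 "2 * pi" "\<bar>real_of_int k\<bar>"] by (simp add: abs_mult)
      then have "cmod (fourier_coeff f k) * \<bar>real_of_int k\<bar> \<le> cmod (fourier_coeff f k) * (2 * \<bar>pi * of_int k\<bar>)"
        by (intro mult_left_mono) auto
      then have "(cmod (fourier_coeff f k) * \<bar>real_of_int k\<bar>)\<^sup>2 \<le> (cmod (fourier_coeff f k) * (2 * \<bar>pi * of_int k\<bar>))\<^sup>2"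
        by (intro power_mono) auto
      then show ?thesis by (simp add: power_mult_distrib mult_ac)
    qed
    have 1: "(\<Sum>k\<in>F. (cmod (fourier_coeff f k) * real_of_int k)\<^sup>2) \<le> K\<^sup>2"
      by (rule order_trans[OF sum_mono[OF le2] le1])
    have "(cmod (fourier_coeff f 0))\<^sup>2 \<le> integral {0..1} (\<lambda>y. (cmod (f y))\<^sup>2)"
      using bessel[OF f(1), of "{0}"] by simp
    also have "\<dots> \<le> integral {0..1::real} (\<lambda>y. B\<^sup>2)"
      using continuous_on_subset[OF f(1), of "{0..1}"] B
      by (intro integral_le) (auto intro!: integrable_continuous_real continuous_intros power_mono)
    finally have 2: "(cmod (fourier_coeff f 0))\<^sup>2 \<le> B\<^sup>2" by simp
    have "(\<Sum>k\<in>F. (cmod (fourier_coeff f k))\<^sup>2 * (jap k)\<^sup>2)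
        \<le> (\<Sum>k\<in>F. (if k = 0 then (cmod (fourier_coeff f 0))\<^sup>2 else 0) + (cmod (fourier_coeff f k) * real_of_int k)\<^sup>2)"
      by (intro sum_mono) (auto simp: jap_def power_mult_distrib)
    also have "\<dots> \<le> (cmod (fourier_coeff f 0))\<^sup>2 + K\<^sup>2"
      using 1 F by (auto simp: sum.distrib intro: add_increasing)
    finally show ?thesis using 2 by simp
  qed
  have s: "(\<lambda>k. (cmod (fourier_coeff f k))\<^sup>2 * (jap k)\<^sup>2) summable_on UNIV"
    by (rule nonneg_bdd_above_summable_on) (auto intro!: bdd_aboveI2 fin)
  then show "f \<in> H1" using f by (simp add: H1_def)
  show "(H1_norm f)\<^sup>2 \<le> B\<^sup>2 + K\<^sup>2"
    unfolding H1_norm_sq by (rule infsum_le_finite_sums[OF s fin])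
qed

text \<open>The square root of B^2 + K^2 for a product of two functions of norm 1, with
  \<open>B\<close> and \<open>K\<close> as in the proof of \<open>H1_mult\<close>.\<close>

definition algebra_const :: real where
  "algebra_const = sqrt (sobolev_const ^ 4 + (4 * pi * sobolev_const)\<^sup>2)"

lemma
  assumes f: "f \<in> H1" and g: "g \<in> H1"
  shows H1_mult: "(\<lambda>y. f y * g y) \<in> H1"
    and H1_norm_mult: "H1_norm (\<lambda>y. f y * g y) \<le> H1_norm f * H1_norm g * algebra_const"
proof -
  let ?C = sobolev_const and ?a = "H1_norm f" and ?b = "H1_norm g"
  note C = sobolev_const_nonneg and n = H1_norm_nonneg[of f] H1_norm_nonneg[of g]
  note c = H1_continuous[OF f] H1_continuous[OF g]
  define B where "B = ?C * ?a * (?C * ?b)"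
  \<comment> \<open>By (s + t)^2 \<le> 2 s^2 + 2 t^2, each of the two terms of the difference of a
    product contributes 8 pi^2 (C a b h)^2, with C the Sobolev constant and a, b the two norms.
    Together this is (4 pi C a b h)^2.\<close>
  define K where "K = 4 * pi * ?C * ?a * ?b"
  have B: "cmod (f y * g y) \<le> B" for y
    unfolding B_def norm_mult using C n
    by (intro mult_mono H1_sup_bound f g) auto
  have K: "integral {0..1} (\<lambda>y. (cmod (f (y + h) * g (y + h) - f y * g y))\<^sup>2) \<le> (K * h)\<^sup>2" if h: "h \<in> {0<..1}" for h
  proof -
    have sh: "continuous_on {0..1} (\<lambda>y. f (y + h))" "continuous_on {0..1} (\<lambda>y. g (y + h))"
      "continuous_on {0..1} f" "continuous_on {0..1} g"
      by (auto intro!: continuous_intros continuous_on_compose2[OF c(1), of _ "\<lambda>y. y + h"]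
          continuous_on_compose2[OF c(2), of _ "\<lambda>y. y + h"] continuous_on_subset[OF c(1)] continuous_on_subset[OF c(2)])
    have "integral {0..1} (\<lambda>y. (cmod (f (y + h) * g (y + h) - f y * g y))\<^sup>2)
      \<le> integral {0..1} (\<lambda>y. 2 * (?C * ?a)\<^sup>2 * (cmod (g (y + h) - g y))\<^sup>2 + 2 * (?C * ?b)\<^sup>2 * (cmod (f (y + h) - f y))\<^sup>2)"
    proof (rule integral_le)
      fix y :: real
      have "f (y + h) * g (y + h) - f y * g y = f (y + h) * (g (y + h) - g y) + g y * (f (y + h) - f y)"
        by (simp add: algebra_simps)
      then have "cmod (f (y + h) * g (y + h) - f y * g y) \<le>
          cmod (f (y + h)) * cmod (g (y + h) - g y) + cmod (g y) * cmod (f (y + h) - f y)"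
        by (metis norm_triangle_ineq norm_mult)
      also have "\<dots> \<le> (?C * ?a) * cmod (g (y + h) - g y) + (?C * ?b) * cmod (f (y + h) - f y)"
        by (intro add_mono mult_right_mono H1_sup_bound f g) auto
      finally have "(cmod (f (y + h) * g (y + h) - f y * g y))\<^sup>2 \<le>
          ((?C * ?a) * cmod (g (y + h) - g y) + (?C * ?b) * cmod (f (y + h) - f y))\<^sup>2"
        by (intro power_mono) auto
      also have "\<dots> \<le> 2 * ((?C * ?a) * cmod (g (y + h) - g y))\<^sup>2 + 2 * ((?C * ?b) * cmod (f (y + h) - f y))\<^sup>2"
        using sum_squares_bound[of "(?C * ?a) * cmod (g (y + h) - g y)" "(?C * ?b) * cmod (f (y + h) - f y)"]
        by (simp add: power2_sum)
      finally show "(cmod (f (y + h) * g (y + h) - f y * g y))\<^sup>2 \<le>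
          2 * (?C * ?a)\<^sup>2 * (cmod (g (y + h) - g y))\<^sup>2 + 2 * (?C * ?b)\<^sup>2 * (cmod (f (y + h) - f y))\<^sup>2"
        by (simp add: power_mult_distrib)
    qed (auto intro!: integrable_continuous_real continuous_intros sh)
    also have "\<dots> = 2 * (?C * ?a)\<^sup>2 * integral {0..1} (\<lambda>y. (cmod (g (y + h) - g y))\<^sup>2)
        + 2 * (?C * ?b)\<^sup>2 * integral {0..1} (\<lambda>y. (cmod (f (y + h) - f y))\<^sup>2)"
      by (subst integral_add) (auto intro!: integrable_continuous_real continuous_intros sh)
    also have "\<dots> \<le> 2 * (?C * ?a)\<^sup>2 * (2 * pi * h * ?b)\<^sup>2 + 2 * (?C * ?b)\<^sup>2 * (2 * pi * h * ?a)\<^sup>2"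
      using h by (intro add_mono mult_left_mono H1_difference_bound f g) auto
    also have "\<dots> = (K * h)\<^sup>2"
      by (simp add: K_def power_mult_distrib)
    finally show ?thesis .
  qed
  note * = H1_of_difference_bound[of "\<lambda>y. f y * g y", OF _ _ B K]
  show "(\<lambda>y. f y * g y) \<in> H1"
    by (rule *(1)) (auto intro!: continuous_intros c simp: H1_periodic f g)
  have "(H1_norm (\<lambda>y. f y * g y))\<^sup>2 \<le> B\<^sup>2 + K\<^sup>2"
    by (rule *(2)) (auto intro!: continuous_intros c simp: H1_periodic f g)
  also have "\<dots> = (?a * ?b * algebra_const)\<^sup>2"
  proof -
    have "algebra_const\<^sup>2 = ?C ^ 4 + (4 * pi * ?C)\<^sup>2" by (simp add: algebra_const_def)
    then have "(?a * ?b * algebra_const)\<^sup>2 = (?a * ?b)\<^sup>2 * (?C ^ 4 + (4 * pi * ?C)\<^sup>2)"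
      by (simp add: power_mult_distrib)
    then show ?thesis by (simp add: B_def K_def power2_eq_square power4_eq_xxxx algebra_simps)
  qed
  finally show "H1_norm (\<lambda>y. f y * g y) \<le> ?a * ?b * algebra_const"
    by (rule power2_le_imp_le) (use n in \<open>auto simp: algebra_const_def\<close>)
qed

text \<open>The difference of two reciprocals is the difference of the functions times two factors
  of size at most 1/m, so the difference bound for \<open>w\<close> carries over with 1/m^2. The
  explicit norm bound later makes inversion locally bounded.\<close>

lemma
  assumes w: "w \<in> H1" and m: "m > 0" "\<And>y. m \<le> cmod (w y)"
  shows H1_inverse: "(\<lambda>y. 1 / w y) \<in> H1"
    and H1_norm_inverse: "(H1_norm (\<lambda>y. 1 / w y))\<^sup>2 \<le> (1 / m)\<^sup>2 + (2 * pi * H1_norm w / m\<^sup>2)\<^sup>2"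
proof -
  note c = H1_continuous[OF w]
  have nz: "w y \<noteq> 0" for y using m(2)[of y] m(1) by auto
  have B: "cmod (1 / w y) \<le> 1 / m" for y
    using m(1) m(2)[of y] by (simp add: norm_divide frac_le)
  have K: "integral {0..1} (\<lambda>y. (cmod (1 / w (y + h) - 1 / w y))\<^sup>2) \<le> (2 * pi * H1_norm w / m\<^sup>2 * h)\<^sup>2" if h: "h \<in> {0<..1}" for h
  proof -
    have sh: "continuous_on {0..1} (\<lambda>y. w (y + h))" "continuous_on {0..1} w"
      by (auto intro!: continuous_intros continuous_on_compose2[OF c(1), of _ "\<lambda>y. y + h"] continuous_on_subset[OF c(1)])
    have "integral {0..1} (\<lambda>y. (cmod (1 / w (y + h) - 1 / w y))\<^sup>2)
        \<le> integral {0..1} (\<lambda>y. (1 / m\<^sup>2)\<^sup>2 * (cmod (w (y + h) - w y))\<^sup>2)"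
    proof (rule integral_le)
      fix y :: real
      have "1 / w (y + h) - 1 / w y = (w y - w (y + h)) * ((1 / w (y + h)) * (1 / w y))"
        using nz by (simp add: field_simps)
      then have "cmod (1 / w (y + h) - 1 / w y) = cmod (w (y + h) - w y) * (cmod (1 / w (y + h)) * cmod (1 / w y))"
        by (simp only: norm_mult norm_minus_commute)
      also have "\<dots> \<le> cmod (w (y + h) - w y) * ((1 / m) * (1 / m))"
        using m(1) by (intro mult_left_mono mult_mono B) auto
      finally have "(cmod (1 / w (y + h) - 1 / w y))\<^sup>2 \<le> (cmod (w (y + h) - w y) * ((1 / m) * (1 / m)))\<^sup>2"
        by (intro power_mono) auto
      then show "(cmod (1 / w (y + h) - 1 / w y))\<^sup>2 \<le> (1 / m\<^sup>2)\<^sup>2 * (cmod (w (y + h) - w y))\<^sup>2"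
        by (simp add: power_mult_distrib power2_eq_square mult_ac)
    qed (use nz in \<open>auto intro!: integrable_continuous_real continuous_intros sh\<close>)
    also have "\<dots> = (1 / m\<^sup>2)\<^sup>2 * integral {0..1} (\<lambda>y. (cmod (w (y + h) - w y))\<^sup>2)" by simp
    also have "\<dots> \<le> (1 / m\<^sup>2)\<^sup>2 * (2 * pi * h * H1_norm w)\<^sup>2"
      using h by (intro mult_left_mono H1_difference_bound w) auto
    also have "\<dots> = (2 * pi * H1_norm w / m\<^sup>2 * h)\<^sup>2" by (simp add: power_mult_distrib power_divide)
    finally show ?thesis .
  qed
  note * = H1_of_difference_bound[of "\<lambda>y. 1 / w y", OF _ _ B K]
  show "(\<lambda>y. 1 / w y) \<in> H1"
    by (rule *(1)) (use nz in \<open>auto intro!: continuous_intros c simp: H1_periodic w\<close>)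
  show "(H1_norm (\<lambda>y. 1 / w y))\<^sup>2 \<le> (1 / m)\<^sup>2 + (2 * pi * H1_norm w / m\<^sup>2)\<^sup>2"
    by (rule *(2)) (use nz in \<open>auto intro!: continuous_intros c simp: H1_periodic w\<close>)
qed

subsection \<open>The Banach algebra \<open>\<H>\<^sup>1\<close>\<close>

text \<open>Reflections and reciprocals of elements of \<open>hardy\<close> have coefficients at
  other frequencies, so the gradients are computed in this larger space and projected back.\<close>

typedef sob = H1 morphisms fun_sob Abs_sob
  by (rule exI[of _ "\<lambda>y. 0"]) (rule H1_zero)

setup_lifting type_definition_sob

lemma H1_const: "(\<lambda>y. c) \<in> H1"
proof -
  have fc: "fourier_coeff (\<lambda>y. c) k = (if k = 0 then c else 0)" for k
    using fourier_coeff_cmult[of c "\<lambda>y. 1" k] by (simp add: fourier_coeff_1)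
  have "(\<lambda>k. (cmod (fourier_coeff (\<lambda>y. c) k))\<^sup>2 * (jap k)\<^sup>2) summable_on UNIV"
    unfolding fc
    by (rule summable_on_cong_neutral[THEN iffD1, OF _ _ _ summable_on_finite[of "{0}"]]) auto
  then show ?thesis by (simp add: H1_def)
qed

text \<open>Pointwise multiplication is bounded, but in general with constant greater than 1, so the
  type is not an instance of \<^class>\<open>real_normed_algebra\<close>.\<close>

instantiation sob :: "{comm_ring_1, real_normed_vector}"
begin

lift_definition zero_sob :: sob is "\<lambda>y. 0" by (rule H1_zero)
lift_definition one_sob :: sob is "\<lambda>y. 1" by (rule H1_const)
lift_definition plus_sob :: "sob \<Rightarrow> sob \<Rightarrow> sob" is "\<lambda>f g y. f y + g y" by (rule H1_add)
lift_definition times_sob :: "sob \<Rightarrow> sob \<Rightarrow> sob" is "\<lambda>f g y. f y * g y" by (rule H1_mult)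
lift_definition uminus_sob :: "sob \<Rightarrow> sob" is "\<lambda>f y. - f y"
  subgoal for f using H1_cmult[of f "-1"] by simp
  done
lift_definition scaleR_sob :: "real \<Rightarrow> sob \<Rightarrow> sob" is "\<lambda>r f y. of_real r * f y" by (rule H1_cmult)
lift_definition norm_sob :: "sob \<Rightarrow> real" is H1_norm .

definition minus_sob :: "sob \<Rightarrow> sob \<Rightarrow> sob" where "minus_sob u v = u + (- v)"
definition dist_sob :: "sob \<Rightarrow> sob \<Rightarrow> real" where "dist_sob u v = norm (u - v)"
definition sgn_sob :: "sob \<Rightarrow> sob" where "sgn_sob u = inverse (norm u) *\<^sub>R u"
definition uniformity_sob :: "(sob \<times> sob) filter" where
  "uniformity_sob = (INF e\<in>{0<..}. principal {(u, v). dist u v < e})"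
definition open_sob :: "sob set \<Rightarrow> bool" where
  "open_sob U = (\<forall>u\<in>U. \<forall>\<^sub>F (u', v) in uniformity. u' = u \<longrightarrow> v \<in> U)"

instance
proof
  fix a b :: real and u v w :: sob
  show "u + v + w = u + (v + w)" by transfer (simp add: add.assoc)
  show "u + v = v + u" by transfer (simp add: add.commute)
  show "0 + u = u" by transfer simp
  show "- u + u = 0" by transfer simp
  show "u - v = u + - v" by (simp add: minus_sob_def)
  show "u * v * w = u * (v * w)" by transfer (simp add: mult.assoc)
  show "u * v = v * u" by transfer (simp add: mult.commute)
  show "1 * u = u" by transfer simp
  show "(u + v) * w = u * w + v * w" by transfer (simp add: distrib_right)
  show "(0::sob) \<noteq> 1" by transfer (auto dest: fun_cong)
  show "a *\<^sub>R (u + v) = a *\<^sub>R u + a *\<^sub>R v" by transfer (simp add: distrib_left)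
  show "(a + b) *\<^sub>R u = a *\<^sub>R u + b *\<^sub>R u" by transfer (simp add: distrib_right)
  show "a *\<^sub>R b *\<^sub>R u = (a * b) *\<^sub>R u" by transfer (simp add: mult.assoc)
  show "1 *\<^sub>R u = u" by transfer simp
  show "dist u v = norm (u - v)" by (simp add: dist_sob_def)
  show "sgn u = inverse (norm u) *\<^sub>R u" by (simp add: sgn_sob_def)
  show "(uniformity :: (sob \<times> sob) filter) = (INF e\<in>{0<..}. principal {(u, v). dist u v < e})"
    by (simp add: uniformity_sob_def)
  show "open U = (\<forall>u\<in>U. \<forall>\<^sub>F (u', v) in uniformity. u' = u \<longrightarrow> v \<in> U)" for U :: "sob set"
    by (simp add: open_sob_def)
  show "norm u = 0 \<longleftrightarrow> u = 0" by transfer (simp add: H1_norm_eq_0)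
  show "norm (u + v) \<le> norm u + norm v" by transfer (simp add: H1_norm_triangle)
  show "norm (a *\<^sub>R u) = \<bar>a\<bar> * norm u" by transfer (simp add: H1_norm_cmult)
qed

end

lemma fun_sob_H1: "fun_sob a \<in> H1"
  using fun_sob by blast

lemma continuous_fun_sob: "continuous_on A (fun_sob a)"
  using H1_continuous[OF fun_sob_H1] by (rule continuous_on_subset) auto

lemma fun_sob_mult: "fun_sob (a * b) y = fun_sob a y * fun_sob b y"
  by (simp add: times_sob.rep_eq)

lemma fun_sob_diff: "fun_sob (a - b) y = fun_sob a y - fun_sob b y"
  by (simp only: diff_conv_add_uminus plus_sob.rep_eq uminus_sob.rep_eq)

lemma fun_sob_norm_bound: "cmod (fun_sob a y) \<le> sobolev_const * norm a"
  unfolding norm_sob.rep_eq by (rule H1_sup_bound[OF fun_sob_H1])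

lemma norm_sob_mult: "norm (a * b) \<le> norm a * norm b * algebra_const" for a b :: sob
  by (simp add: norm_sob.rep_eq times_sob.rep_eq H1_norm_mult fun_sob_H1)

lemma bounded_bilinear_sob_mult: "bounded_bilinear ((*) :: sob \<Rightarrow> sob \<Rightarrow> sob)"
proof
  show "\<exists>K. \<forall>a b :: sob. norm (a * b) \<le> norm a * norm b * K"
    by (intro exI[of _ algebra_const] allI norm_sob_mult)
  fix r :: real and a b :: sob
  show "(r *\<^sub>R a) * b = r *\<^sub>R (a * b)" by transfer (simp add: mult.assoc)
  show "a * (r *\<^sub>R b) = r *\<^sub>R (a * b)" by transfer (simp add: mult.left_commute)
qed (simp_all add: algebra_simps)

abbreviation sob_coeff :: "sob \<Rightarrow> int \<Rightarrow> complex" where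
  "sob_coeff a \<equiv> fourier_coeff (fun_sob a)"

lemma sob_coeff_add: "sob_coeff (a + b) k = sob_coeff a k + sob_coeff b k"
  by (simp add: plus_sob.rep_eq fourier_coeff_add continuous_fun_sob)

lemma sob_coeff_scaleR: "sob_coeff (r *\<^sub>R a) k = of_real r * sob_coeff a k"
  by (simp add: scaleR_sob.rep_eq fourier_coeff_cmult)

lemma sob_eqI: "(\<And>k. sob_coeff a k = sob_coeff b k) \<Longrightarrow> a = b"
  using H1_eqI[OF fun_sob_H1 fun_sob_H1] fun_sob_inject by blast

lemma norm_sob_sq: "(norm a)\<^sup>2 = (\<Sum>\<^sub>\<infinity>k. (cmod (sob_coeff a k))\<^sup>2 * (jap k)\<^sup>2)"
  by (simp add: norm_sob.rep_eq H1_norm_sq)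

lemma norm_sob_le:
  assumes "\<And>k. cmod (sob_coeff a k) \<le> cmod (sob_coeff b k)"
  shows "norm a \<le> norm b"
proof (rule power2_le_imp_le)
  show "(norm a)\<^sup>2 \<le> (norm b)\<^sup>2"
    unfolding norm_sob_sq
    by (intro infsum_mono H1_weighted_summable fun_sob_H1 mult_right_mono power_mono assms) auto
qed simp

lemma bounded_linear_sob_coeff: "bounded_linear (\<lambda>a. sob_coeff a k)"
proof (rule bounded_linear_intro)
  fix a
  have "((cmod (sob_coeff a k)))\<^sup>2 \<le> (norm a)\<^sup>2"
  proof -
    have "1 \<le> jap k" by (auto simp: jap_def)
    then have "1 \<le> (jap k)\<^sup>2" by (rule one_le_power)
    then have "(cmod (sob_coeff a k))\<^sup>2 \<le> (cmod (sob_coeff a k))\<^sup>2 * (jap k)\<^sup>2"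
      using mult_left_mono[of 1 "(jap k)\<^sup>2" "(cmod (sob_coeff a k))\<^sup>2"] by simp
    also have "\<dots> \<le> (norm a)\<^sup>2"
      unfolding norm_sob_sq
      using finite_sum_le_infsum[OF H1_weighted_summable[OF fun_sob_H1[of a]], of "{k}"] by simp
    finally show ?thesis .
  qed
  from power2_le_imp_le[OF this] show "norm (sob_coeff a k) \<le> norm a * 1" by simp
qed (simp_all add: sob_coeff_add sob_coeff_scaleR scaleR_conv_of_real)

instance sob :: banach
proof
  fix X :: "nat \<Rightarrow> sob" assume X: "Cauchy X"
  have "Cauchy (\<lambda>n. sob_coeff (X n) k)" for k
    using bounded_linear.Cauchy[OF bounded_linear_sob_coeff X] .
  then have "\<exists>a. \<forall>k. (\<lambda>n. sob_coeff (X n) k) \<longlonglongrightarrow> a k"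
    by (intro choice allI) (metis Cauchy_convergent_iff convergent_def)
  then obtain a where a: "\<And>k. (\<lambda>n. sob_coeff (X n) k) \<longlonglongrightarrow> a k" by blast
  have diff: "sob_coeff (u - v) k = sob_coeff u k - sob_coeff v k" for u v k
    using linear_diff[OF bounded_linear.linear[OF bounded_linear_sob_coeff]] .
  \<comment> \<open>The Cauchy estimate is passed to the limit in \<open>m\<close> on finite index
    sets, with a bound that does not depend on the set.\<close>
  have key: "(\<Sum>k\<in>F. (cmod (sob_coeff (X n) k - a k))\<^sup>2 * (jap k)\<^sup>2) \<le> e\<^sup>2"
    if "finite F" and le: "\<And>m. m \<ge> n \<Longrightarrow> norm (X n - X m) \<le> e" for F n e
  proof (rule tendsto_upperbound)
    show "(\<lambda>m. \<Sum>k\<in>F. (cmod (sob_coeff (X n) k - sob_coeff (X m) k))\<^sup>2 * (jap k)\<^sup>2)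
        \<longlonglongrightarrow> (\<Sum>k\<in>F. (cmod (sob_coeff (X n) k - a k))\<^sup>2 * (jap k)\<^sup>2)"
      by (intro tendsto_intros a)
    have "(\<Sum>k\<in>F. (cmod (sob_coeff (X n) k - sob_coeff (X m) k))\<^sup>2 * (jap k)\<^sup>2) \<le> e\<^sup>2" if m: "m \<ge> n" for m
    proof -
      have "(\<Sum>k\<in>F. (cmod (sob_coeff (X n) k - sob_coeff (X m) k))\<^sup>2 * (jap k)\<^sup>2) \<le> (norm (X n - X m))\<^sup>2"
        unfolding norm_sob_sq diff[symmetric]
        by (intro finite_sum_le_infsum H1_weighted_summable fun_sob_H1 \<open>finite F\<close>) auto
      also have "\<dots> \<le> e\<^sup>2" using le[OF m] by (intro power_mono) auto
      finally show ?thesis .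
    qed
    then show "\<forall>\<^sub>F m in sequentially. (\<Sum>k\<in>F. (cmod (sob_coeff (X n) k - sob_coeff (X m) k))\<^sup>2 * (jap k)\<^sup>2) \<le> e\<^sup>2"
      by (auto simp: eventually_sequentially)
  qed simp
  obtain N where N: "\<And>e. e > 0 \<Longrightarrow> \<forall>m\<ge>N e. \<forall>n\<ge>N e. norm (X m - X n) < e"
    using X unfolding Cauchy_iff by metis
  have sd: "(\<lambda>k. (cmod (sob_coeff (X n) k - a k))\<^sup>2 * (jap k)\<^sup>2) summable_on UNIV" if "n \<ge> N 1" for n
  proof (rule nonneg_bdd_above_summable_on)
    have "norm (X n - X m) \<le> 1" if "m \<ge> n" for m
      using N[of 1] \<open>n \<ge> N 1\<close> that by (auto intro: less_imp_le)
    then show "bdd_above (sum (\<lambda>k. (cmod (sob_coeff (X n) k - a k))\<^sup>2 * (jap k)\<^sup>2) ` {F. F \<subseteq> UNIV \<and> finite F})"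
      using key[of _ n 1] by (auto intro!: bdd_aboveI2)
  qed simp
  define d where "d n = Abs_sob (fourier_series (\<lambda>k. sob_coeff (X n) k - a k))" for n
  have d: "sob_coeff (d n) k = sob_coeff (X n) k - a k" if "n \<ge> N 1" for n k
    unfolding d_def using fourier_series_H1[OF sd[OF that]] fourier_coeff_series_H1[OF sd[OF that]]
    by (simp add: Abs_sob_inverse)
  \<comment> \<open>The sequence \<open>a\<close> is not yet known to be weighted summable, but its
    difference from a late member of the sequence is. The limit is therefore obtained by subtracting
    that difference.\<close>
  define L where "L = X (N 1) - d (N 1)"
  have L: "sob_coeff L k = a k" for k unfolding L_def diff by (simp add: d)
  have dL: "d n = X n - L" if "n \<ge> N 1" for n
    by (rule sob_eqI) (simp add: d that diff L)
  have "X \<longlonglongrightarrow> L"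
  proof (rule LIMSEQ_I)
    fix e :: real assume e: "e > 0"
    have "norm (X n - L) < e" if n: "n \<ge> max (N 1) (N (e / 2))" for n
    proof -
      have n1: "n \<ge> N 1" and n2: "n \<ge> N (e / 2)" using n by auto
      have "norm (X n - X m) \<le> e / 2" if "m \<ge> n" for m
        using N[of "e / 2"] n2 e that by (auto intro: less_imp_le)
      then have "(norm (X n - L))\<^sup>2 \<le> (e / 2)\<^sup>2"
        unfolding dL[OF n1, symmetric] norm_sob_sq d[OF n1]
        by (intro infsum_le_finite_sums[OF sd[OF n1]] key)
      from power2_le_imp_le[OF this] have "norm (X n - L) \<le> e / 2" using e by simp
      then show ?thesis using e by simp
    qed
    then show "\<exists>no. \<forall>n\<ge>no. norm (X n - L) < e" by blast
  qed
  then show "convergent X" by (auto simp: convergent_def)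
qed

section \<open>Constants, truncations and reflection as operators\<close>

lift_definition sob_const :: "complex \<Rightarrow> sob" is "\<lambda>c y. c" by (rule H1_const)

lemma sob_coeff_const_mult: "sob_coeff (sob_const c * a) k = c * sob_coeff a k"
  by (simp add: times_sob.rep_eq sob_const.rep_eq fourier_coeff_cmult)

lemma H1_filter:
  assumes "f \<in> H1"
  shows "fourier_series (\<lambda>k. if P k then fourier_coeff f k else 0) \<in> H1"
    and "fourier_coeff (fourier_series (\<lambda>k. if P k then fourier_coeff f k else 0)) k = (if P k then fourier_coeff f k else 0)"
proof -
  have "(\<lambda>k. (cmod (if P k then fourier_coeff f k else 0))\<^sup>2 * (jap k)\<^sup>2) summable_on UNIV"
    by (rule summable_on_comparison_test[OF H1_weighted_summable[OF assms]]) auto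
  from fourier_series_H1[OF this] fourier_coeff_series_H1[OF this]
  show "fourier_series (\<lambda>k. if P k then fourier_coeff f k else 0) \<in> H1"
    and "fourier_coeff (fourier_series (\<lambda>k. if P k then fourier_coeff f k else 0)) k = (if P k then fourier_coeff f k else 0)"
    by auto
qed

lemma proj_pos_eq: "proj_pos f = fourier_series (\<lambda>k. if k > 0 then fourier_coeff f k else 0)"
  unfolding proj_pos_def[abs_def] fourier_series_def[abs_def]
  by (intro ext infsum_cong_neutral) auto

lemma proj_nonneg_eq: "proj_nonneg f = fourier_series (\<lambda>k. if k \<ge> 0 then fourier_coeff f k else 0)"
  unfolding proj_nonneg_def[abs_def] fourier_series_def[abs_def]
  by (intro ext infsum_cong_neutral) auto

lift_definition proj_sob :: "sob \<Rightarrow> sob" is proj_nonneg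
  by (simp add: proj_nonneg_eq H1_filter)

lift_definition proj_hardy :: "sob \<Rightarrow> hardy" is proj_pos
  by (auto simp: proj_pos_eq H1_filter)

lift_definition sob_of :: "hardy \<Rightarrow> sob" is "\<lambda>f. f"
  by simp

lemma fun_sob_of: "fun_sob (sob_of w) = fun_of w"
  by (simp add: sob_of.rep_eq)

lemma sob_coeff_proj_sob: "sob_coeff (proj_sob a) k = (if k \<ge> 0 then sob_coeff a k else 0)"
  by (simp add: proj_sob.rep_eq proj_nonneg_eq H1_filter fun_sob_H1)

lemma sob_coeff_proj_hardy: "sob_coeff (sob_of (proj_hardy a)) k = (if k > 0 then sob_coeff a k else 0)"
  by (simp add: fun_sob_of proj_hardy.rep_eq proj_pos_eq H1_filter fun_sob_H1)

lemma sob_coeff_sob_of_nonpos: "k \<le> 0 \<Longrightarrow> sob_coeff (sob_of w) k = 0"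
  using fun_of[of w] by (simp add: fun_sob_of)

lemma norm_sob_of: "norm (sob_of w) = norm w"
  by (simp add: norm_sob.rep_eq norm_hardy.rep_eq fun_sob_of)

lemma sob_of_inject: "sob_of v = sob_of w \<longleftrightarrow> v = w"
  by (metis fun_sob_of fun_of_inject)

lemma proj_hardy_sob_of: "proj_hardy (sob_of w) = w"
  by (rule sob_of_inject[THEN iffD1], rule sob_eqI)
    (simp add: sob_coeff_proj_hardy sob_coeff_sob_of_nonpos)

lemma bounded_linear_sob_of: "bounded_linear sob_of"
proof (rule bounded_linear_intro[where K=1])
  show "sob_of (u + v) = sob_of u + sob_of v" for u v by transfer simp
  show "sob_of (r *\<^sub>R u) = r *\<^sub>R sob_of u" for r u by transfer simp
qed (simp add: norm_sob_of)

lemma bounded_linear_proj_hardy: "bounded_linear proj_hardy"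
proof (rule bounded_linear_intro[where K=1])
  show "proj_hardy (a + b) = proj_hardy a + proj_hardy b" for a b
    by (rule sob_of_inject[THEN iffD1], rule sob_eqI)
      (simp add: sob_coeff_proj_hardy sob_coeff_add linear_add[OF bounded_linear.linear[OF bounded_linear_sob_of]])
  show "proj_hardy (r *\<^sub>R a) = r *\<^sub>R proj_hardy a" for r a
    by (rule sob_of_inject[THEN iffD1], rule sob_eqI)
      (simp add: sob_coeff_proj_hardy sob_coeff_scaleR linear_cmul[OF bounded_linear.linear[OF bounded_linear_sob_of]])
  have "norm (sob_of (proj_hardy a)) \<le> norm a" for a
    by (rule norm_sob_le) (simp add: sob_coeff_proj_hardy)
  then show "norm (proj_hardy a) \<le> norm a * 1" for a by (simp add: norm_sob_of)
qed

lemma bounded_linear_proj_sob: "bounded_linear proj_sob"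
proof (rule bounded_linear_intro[where K=1])
  show "proj_sob (a + b) = proj_sob a + proj_sob b" for a b
    by (rule sob_eqI) (simp add: sob_coeff_proj_sob sob_coeff_add)
  show "proj_sob (r *\<^sub>R a) = r *\<^sub>R proj_sob a" for r a
    by (rule sob_eqI) (simp add: sob_coeff_proj_sob sob_coeff_scaleR)
  have "norm (proj_sob a) \<le> norm a" for a
    by (rule norm_sob_le) (simp add: sob_coeff_proj_sob)
  then show "norm (proj_sob a) \<le> norm a * 1" for a by simp
qed

text \<open>\<open>sob_of\<close> is an isometry with the bounded left inverse
  \<open>proj_hardy\<close>, so a limit found in \<open>sob\<close> can be projected back.\<close>

instance hardy :: banach
proof
  fix X :: "nat \<Rightarrow> hardy" assume X: "Cauchy X"
  have "Cauchy (\<lambda>n. sob_of (X n))"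
    by (rule bounded_linear.Cauchy[OF bounded_linear_sob_of X])
  then obtain L where "(\<lambda>n. sob_of (X n)) \<longlonglongrightarrow> L"
    by (auto simp: Cauchy_convergent_iff convergent_def)
  from bounded_linear.tendsto[OF bounded_linear_proj_hardy this]
  show "convergent X" by (auto simp: proj_hardy_sob_of convergent_def)
qed

lemma fourier_coeff_reflect:
  assumes f: "f \<in> H1"
  shows "(\<lambda>y. f (- y)) \<in> H1" and "fourier_coeff (\<lambda>y. f (- y)) k = fourier_coeff f (- k)"
proof -
  have s: "(\<lambda>k. (cmod (fourier_coeff f (- k)))\<^sup>2 * (jap k)\<^sup>2) summable_on UNIV"
    using H1_weighted_summable[OF f]
    by (rule summable_on_reindex_bij_witness[of UNIV uminus uminus, THEN iffD2, rotated -1]) auto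
  have eq: "(\<lambda>y. f (- y)) = fourier_series (\<lambda>k. fourier_coeff f (- k))"
  proof
    fix y
    have "f (- y) = (\<Sum>\<^sub>\<infinity>k. fourier_coeff f k * fourier_basis k (- y))"
      using fun_cong[OF H1_fourier_series[OF f], of "- y"] by (simp add: fourier_series_def)
    also have "\<dots> = (\<Sum>\<^sub>\<infinity>k. fourier_coeff f (- k) * fourier_basis k y)"
      by (rule infsum_reindex_bij_witness[of _ uminus uminus]) auto
    finally show "f (- y) = fourier_series (\<lambda>k. fourier_coeff f (- k)) y" by (simp add: fourier_series_def)
  qed
  show "(\<lambda>y. f (- y)) \<in> H1" "fourier_coeff (\<lambda>y. f (- y)) k = fourier_coeff f (- k)"
    unfolding eq by (rule fourier_series_H1[OF s], rule fourier_coeff_series_H1[OF s])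
qed

lift_definition reflect :: "sob \<Rightarrow> sob" is "\<lambda>f y. f (- y)"
  by (rule fourier_coeff_reflect)

lemma sob_coeff_reflect: "sob_coeff (reflect a) k = sob_coeff a (- k)"
  by (simp add: reflect.rep_eq fourier_coeff_reflect fun_sob_H1)

lemma reflect_reflect [simp]: "reflect (reflect a) = a"
  by transfer simp

lemma reflect_mult: "reflect (a * b) = reflect a * reflect b"
  by transfer simp

lemma bounded_linear_reflect: "bounded_linear reflect"
proof (rule bounded_linear_intro[where K=1])
  show "reflect (a + b) = reflect a + reflect b" for a b by transfer simp
  show "reflect (r *\<^sub>R a) = r *\<^sub>R reflect a" for r a by transfer simp
  have "(norm (reflect a))\<^sup>2 = (norm a)\<^sup>2" for a
    unfolding norm_sob_sq sob_coeff_reflect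
    by (rule infsum_reindex_bij_witness[of _ uminus uminus]) auto
  then show "norm (reflect a) \<le> norm a * 1" for a by simp
qed

subsection \<open>The pairing\<close>

text \<open>The integral of a(y) b(-y), equal to the bilinear sum of products of coefficients. In
  this form the adjoint of multiplication by \<open>a\<close> is multiplication by
  \<open>reflect a\<close>; reflection is symmetric, and so are the truncations, which act
  diagonally on coefficients.\<close>

definition sob_pairing :: "sob \<Rightarrow> sob \<Rightarrow> complex" where
  "sob_pairing a b = sob_coeff (a * reflect b) 0"

lemma sob_pairing_has_sum: "((\<lambda>k. sob_coeff a k * sob_coeff b k) has_sum sob_pairing a b) UNIV"
proof -
  have "((\<lambda>j. sob_coeff a j * sob_coeff (reflect b) (0 - j)) has_sum
      fourier_coeff (\<lambda>y. fourier_series (sob_coeff a) y * fun_sob (reflect b) y) 0) UNIV"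
    by (rule fourier_coeff_series_mult[OF H1_summable[OF fun_sob_H1] continuous_fun_sob])
  then show ?thesis
    by (simp add: sob_coeff_reflect sob_pairing_def times_sob.rep_eq H1_fourier_series[OF fun_sob_H1, symmetric])
qed

lemma pairing_fun_sob: "pairing (fun_sob a) (fun_sob b) = sob_pairing a b"
  unfolding pairing_def by (rule infsumI[OF sob_pairing_has_sum])

lemma sob_pairing_commute: "sob_pairing a b = sob_pairing b a"
  using has_sum_unique[OF sob_pairing_has_sum[of a b]] sob_pairing_has_sum[of b a]
  by (simp add: mult.commute)

lemma sob_pairing_mult: "sob_pairing (a * b) c = sob_pairing b (reflect a * c)"
  by (simp add: sob_pairing_def reflect_mult mult_ac)

lemma sob_pairing_reflect: "sob_pairing (reflect a) b = sob_pairing a (reflect b)"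
  using sob_coeff_reflect[of "reflect a * reflect b" 0]
  by (simp add: sob_pairing_def reflect_mult)

lemma sob_pairing_proj_sob: "sob_pairing (proj_sob a) b = sob_pairing a (proj_sob b)"
proof -
  have "(\<lambda>k. sob_coeff (proj_sob a) k * sob_coeff b k) = (\<lambda>k. sob_coeff a k * sob_coeff (proj_sob b) k)"
    by (auto simp: sob_coeff_proj_sob)
  with sob_pairing_has_sum[of "proj_sob a" b] sob_pairing_has_sum[of a "proj_sob b"]
  show ?thesis by (auto intro: has_sum_unique)
qed

lemma sob_pairing_proj_hardy:
  "sob_pairing (sob_of (proj_hardy a)) b = sob_pairing a (sob_of (proj_hardy b))"
proof -
  have "(\<lambda>k. sob_coeff (sob_of (proj_hardy a)) k * sob_coeff b k)
      = (\<lambda>k. sob_coeff a k * sob_coeff (sob_of (proj_hardy b)) k)"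
    by (auto simp: sob_coeff_proj_hardy)
  with sob_pairing_has_sum[of "sob_of (proj_hardy a)" b] sob_pairing_has_sum[of a "sob_of (proj_hardy b)"]
  show ?thesis by (auto intro: has_sum_unique)
qed

lemma bounded_bilinear_linear_compose:
  assumes h: "bounded_linear h" and b: "bounded_bilinear b"
  shows "bounded_bilinear (\<lambda>x y. h (b x y))"
proof -
  interpret h: bounded_linear h by fact
  interpret b: bounded_bilinear b by fact
  obtain K where K: "K \<ge> 0" "\<And>x. norm (h x) \<le> norm x * K" using h.nonneg_bounded by blast
  obtain M where M: "M \<ge> 0" "\<And>x y. norm (b x y) \<le> norm x * norm y * M" using b.nonneg_bounded by blast
  show ?thesis
  proof
    show "\<exists>K. \<forall>x y. norm (h (b x y)) \<le> norm x * norm y * K"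
    proof (intro exI[of _ "M * K"] allI)
      fix x y
      show "norm (h (b x y)) \<le> norm x * norm y * (M * K)"
        using order_trans[OF K(2) mult_right_mono[OF M(2) K(1)]] by (simp add: mult.assoc)
    qed
  qed (simp_all add: b.add_left b.add_right b.scaleR_left b.scaleR_right h.add h.scaleR)
qed

lemma bounded_bilinear_sob_pairing: "bounded_bilinear sob_pairing"
proof -
  have "bounded_bilinear (\<lambda>a b. a * reflect b)"
    by (rule bounded_bilinear.comp[OF bounded_bilinear_sob_mult bounded_linear_ident bounded_linear_reflect])
  from bounded_bilinear_linear_compose[OF bounded_linear_sob_coeff this]
  show ?thesis by (simp add: sob_pairing_def[abs_def])
qed

subsection \<open>Inversion\<close>

definition nonzero_sob :: "sob set" where
  "nonzero_sob = {a. \<forall>y. fun_sob a y \<noteq> 0}"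

definition sob_inverse :: "sob \<Rightarrow> sob" where
  "sob_inverse a = (if a \<in> nonzero_sob then Abs_sob (\<lambda>y. 1 / fun_sob a y) else 0)"

lemma nonzero_sob_lower_bound:
  assumes "a \<in> nonzero_sob"
  obtains m where "m > 0" "\<And>y. m \<le> cmod (fun_sob a y)"
proof -
  interpret periodic_fun_simple' "fun_sob a"
    by standard (rule H1_periodic[OF fun_sob_H1])
  obtain x where x: "x \<in> {0..1}" "\<And>y. y \<in> {0..1} \<Longrightarrow> cmod (fun_sob a x) \<le> cmod (fun_sob a y)"
    using continuous_attains_inf[OF compact_Icc _ continuous_on_norm[OF continuous_fun_sob[of "{0..1}" a]]]
    by fastforce
  have "cmod (fun_sob a x) \<le> cmod (fun_sob a y)" for y
  proof -
    have "fun_sob a (frac y) = fun_sob a y" unfolding frac_def by (rule minus_of_int)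
    then show ?thesis using x(2)[of "frac y"] by (simp add: frac_lt_1 less_imp_le)
  qed
  moreover have "cmod (fun_sob a x) > 0" using assms by (simp add: nonzero_sob_def)
  ultimately show thesis using that by blast
qed

lemma fun_sob_inverse:
  assumes "a \<in> nonzero_sob"
  shows "fun_sob (sob_inverse a) y = 1 / fun_sob a y"
proof -
  obtain m where m: "m > 0" "\<And>y. m \<le> cmod (fun_sob a y)"
    using assms by (rule nonzero_sob_lower_bound) blast
  show ?thesis
    using assms by (simp add: sob_inverse_def Abs_sob_inverse H1_inverse[OF fun_sob_H1 m])
qed

text \<open>The resolvent identity. It yields both the local Lipschitz bound and the derivative of
  inversion.\<close>

lemma sob_inverse_diff:
  assumes "a \<in> nonzero_sob" "b \<in> nonzero_sob"
  shows "sob_inverse a - sob_inverse b = sob_inverse a * sob_inverse b * (b - a)"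
proof -
  have "fun_sob (sob_inverse a - sob_inverse b) = fun_sob (sob_inverse a * sob_inverse b * (b - a))"
    using assms
    by (auto simp: fun_sob_diff fun_sob_mult fun_sob_inverse nonzero_sob_def field_simps)
  then show ?thesis by (simp add: fun_sob_inject)
qed

lemma nonzero_sob_locally_bounded:
  assumes "a \<in> nonzero_sob"
  obtains r M where "r > 0" "ball a r \<subseteq> nonzero_sob" "\<And>b. b \<in> ball a r \<Longrightarrow> norm (sob_inverse b) \<le> M"
proof -
  obtain m where m: "m > 0" "\<And>y. m \<le> cmod (fun_sob a y)"
    using assms by (rule nonzero_sob_lower_bound) blast
  \<comment> \<open>A perturbation of norm less than \<open>r\<close> changes values by at most
    \<open>m / 2\<close>, by the Sobolev bound. Adding 1 makes the denominator positive from
    \<open>sobolev_const_nonneg\<close> alone.\<close>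
  define r where "r = m / (2 * (sobolev_const + 1))"
  have r: "r > 0" using m sobolev_const_nonneg by (simp add: r_def)
  define M where "M = sqrt ((1 / (m / 2))\<^sup>2 + (2 * pi * (norm a + r) / (m / 2)\<^sup>2)\<^sup>2)"
  have low: "m / 2 \<le> cmod (fun_sob b y)" if "b \<in> ball a r" for b y
  proof -
    have "cmod (fun_sob a y - fun_sob b y) \<le> sobolev_const * norm (a - b)"
      unfolding fun_sob_diff[symmetric] by (rule fun_sob_norm_bound)
    also have "\<dots> \<le> (sobolev_const + 1) * r"
      using that sobolev_const_nonneg by (intro mult_mono) (auto simp: dist_norm)
    also have "\<dots> = m / 2" using sobolev_const_nonneg by (simp add: r_def field_simps)
    finally show ?thesis using m(2)[of y] norm_triangle_sub[of "fun_sob a y" "fun_sob b y"] by simp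
  qed
  have sub: "ball a r \<subseteq> nonzero_sob"
  proof
    fix b assume b: "b \<in> ball a r"
    have "fun_sob b y \<noteq> 0" for y using low[OF b, of y] m(1) by auto
    then show "b \<in> nonzero_sob" by (simp add: nonzero_sob_def)
  qed
  have "norm (sob_inverse b) \<le> M" if b: "b \<in> ball a r" for b
  proof -
    have "norm b \<le> norm a + r" using b norm_triangle_sub[of b a] by (simp add: dist_norm norm_minus_commute)
    then have le: "(2 * pi * norm b / (m / 2)\<^sup>2)\<^sup>2 \<le> (2 * pi * (norm a + r) / (m / 2)\<^sup>2)\<^sup>2"
      by (intro power_mono divide_right_mono mult_left_mono) auto
    have "fun_sob (sob_inverse b) = (\<lambda>y. 1 / fun_sob b y)"
      using b sub by (auto simp: fun_sob_inverse subset_iff)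
    then have "(norm (sob_inverse b))\<^sup>2 \<le> (1 / (m / 2))\<^sup>2 + (2 * pi * norm b / (m / 2)\<^sup>2)\<^sup>2"
      using H1_norm_inverse[OF fun_sob_H1 half_gt_zero[OF m(1)] low[OF b]]
      unfolding norm_sob.rep_eq by simp
    also have "\<dots> \<le> (1 / (m / 2))\<^sup>2 + (2 * pi * (norm a + r) / (m / 2)\<^sup>2)\<^sup>2"
      using le by simp
    finally show ?thesis unfolding M_def by (rule real_le_rsqrt)
  qed
  with r sub show thesis by (rule that)
qed

lemma open_nonzero_sob: "open nonzero_sob"
  unfolding open_contains_ball by (meson nonzero_sob_locally_bounded)

lemma algebra_const_nonneg: "algebra_const \<ge> 0"
  by (simp add: algebra_const_def)

lemma loc_lip_sob_inverse: "loc_lip nonzero_sob sob_inverse"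
  unfolding loc_lip_def
proof
  fix a assume "a \<in> nonzero_sob"
  then obtain r M where r: "r > 0" "ball a r \<subseteq> nonzero_sob" "\<And>b. b \<in> ball a r \<Longrightarrow> norm (sob_inverse b) \<le> M"
    by (rule nonzero_sob_locally_bounded) blast
  have M: "M \<ge> 0" using order_trans[OF norm_ge_zero r(3)[of a]] r(1) by simp
  have "(M * M * algebra_const * algebra_const)-lipschitz_on (ball a r \<inter> nonzero_sob) sob_inverse"
  proof (rule lipschitz_onI)
    fix b c assume b: "b \<in> ball a r \<inter> nonzero_sob" and c: "c \<in> ball a r \<inter> nonzero_sob"
    have "norm (sob_inverse b - sob_inverse c) = norm (sob_inverse b * sob_inverse c * (c - b))"
      using b c by (simp add: sob_inverse_diff)
    also have "\<dots> \<le> norm (sob_inverse b * sob_inverse c) * norm (c - b) * algebra_const"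
      by (rule norm_sob_mult)
    also have "\<dots> \<le> (norm (sob_inverse b) * norm (sob_inverse c) * algebra_const) * norm (c - b) * algebra_const"
      by (intro mult_right_mono norm_sob_mult algebra_const_nonneg norm_ge_zero)
    also have "\<dots> \<le> (M * M * algebra_const) * norm (c - b) * algebra_const"
      using b c M by (intro mult_right_mono mult_mono r(3) algebra_const_nonneg norm_ge_zero) auto
    finally show "dist (sob_inverse b) (sob_inverse c) \<le> M * M * algebra_const * algebra_const * dist b c"
      by (simp add: dist_norm norm_minus_commute mult_ac)
  qed (use M algebra_const_nonneg in auto)
  with r(1) show "\<exists>r>0. \<exists>L. L-lipschitz_on (ball a r \<inter> nonzero_sob) sob_inverse" by blast
qed

lemma has_derivative_sob_inverse:
  assumes a: "a \<in> nonzero_sob"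
  shows "(sob_inverse has_derivative (\<lambda>h. - (sob_inverse a * sob_inverse a * h))) (at a)"
  unfolding has_derivative_iff_norm
proof
  let ?v = "sob_inverse a" and ?K = algebra_const
  show "bounded_linear (\<lambda>h. - (?v * ?v * h))"
    by (intro bounded_linear_minus bounded_bilinear.bounded_linear_right[OF bounded_bilinear_sob_mult])
  have "isCont sob_inverse a"
    using loc_lip_continuous[OF loc_lip_sob_inverse] a open_nonzero_sob
    by (simp add: continuous_on_eq_continuous_at)
  then have "((\<lambda>b. norm (?v - sob_inverse b) * (norm ?v * ?K * ?K)) \<longlongrightarrow> norm (?v - ?v) * (norm ?v * ?K * ?K)) (at a)"
    unfolding isCont_def by (intro tendsto_intros)
  then have lim: "((\<lambda>b. norm (?v - sob_inverse b) * (norm ?v * ?K * ?K)) \<longlongrightarrow> 0) (at a)" by simp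
  have ev: "\<forall>\<^sub>F b in at a. b \<in> nonzero_sob"
    using open_nonzero_sob a by (rule eventually_at_in_open')
  have "\<forall>\<^sub>F b in at a. norm (norm (sob_inverse b - ?v - - (?v * ?v * (b - a))) / norm (b - a))
      \<le> norm (?v - sob_inverse b) * (norm ?v * ?K * ?K)"
    using ev
  proof eventually_elim
    case (elim b)
    \<comment> \<open>By the resolvent identity the remainder contains the factor
      \<open>b - a\<close> together with \<open>?v - sob_inverse b\<close>, which tends to 0 by
      continuity.\<close>
    have "sob_inverse b - ?v - - (?v * ?v * (b - a)) = (?v - sob_inverse b) * ?v * (b - a)"
      using sob_inverse_diff[OF elim a] by (simp add: algebra_simps)
    then have "norm (sob_inverse b - ?v - - (?v * ?v * (b - a))) \<le> norm ((?v - sob_inverse b) * ?v) * norm (b - a) * ?K"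
      by (simp only: norm_sob_mult)
    also have "\<dots> \<le> (norm (?v - sob_inverse b) * norm ?v * ?K) * norm (b - a) * ?K"
      by (intro mult_right_mono norm_sob_mult algebra_const_nonneg norm_ge_zero)
    finally show ?case
      by (cases "b = a") (auto simp: divide_simps mult_ac)
  qed
  then show "((\<lambda>b. norm (sob_inverse b - ?v - - (?v * ?v * (b - a))) / norm (b - a)) \<longlongrightarrow> 0) (at a)"
    by (rule Lim_null_comparison[OF _ lim])
qed

text \<open>The derivative of 1/W is a polynomial in 1/W and W', so order \<open>l\<close> of 1/W,
  known by induction, yields order \<open>l + 1\<close>.\<close>

lemma smooth_family_sob_inverse:
  "smooth_family l V T W \<Longrightarrow> (\<And>z t. z \<in> V \<Longrightarrow> t \<in> {0..<T} \<Longrightarrow> W z t \<in> nonzero_sob) \<Longrightarrow>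
    smooth_family l V T (\<lambda>z t. sob_inverse (W z t))"
proof (induction l)
  have cont: "continuous_on (V \<times> {0..<T}) (\<lambda>x. sob_inverse (W (fst x) (snd x)))"
    if "smooth_family l V T W" "\<And>z t. z \<in> V \<Longrightarrow> t \<in> {0..<T} \<Longrightarrow> W z t \<in> nonzero_sob" for l
    by (rule continuous_on_compose2[OF loc_lip_continuous[OF loc_lip_sob_inverse] smooth_family_continuous[OF that(1)]])
      (use that(2) in auto)
  {
    case 0
    then show ?case using cont[of 0] by simp
  next
    case (Suc l)
    from Suc.prems(1) obtain W' where W': "smooth_family l V T W'"
      "\<And>z t. z \<in> V \<Longrightarrow> t \<in> {0..<T} \<Longrightarrow> (W z has_vector_derivative W' z t) (at t within {0..<T})"
      by auto
    have v: "smooth_family l V T (\<lambda>z t. sob_inverse (W z t))"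
      by (rule Suc.IH[OF smooth_family_SucD[OF Suc.prems(1)] Suc.prems(2)])
    have "smooth_family l V T (\<lambda>z t. - (sob_inverse (W z t) * sob_inverse (W z t) * W' z t))"
      by (intro smooth_family_bounded_linear[OF bounded_linear_minus[OF bounded_linear_ident]]
          smooth_family_bounded_bilinear[OF bounded_bilinear_sob_mult] v W'(1))
    moreover have "((\<lambda>t. sob_inverse (W z t)) has_vector_derivative
        - (sob_inverse (W z t) * sob_inverse (W z t) * W' z t)) (at t within {0..<T})"
      if "z \<in> V" "t \<in> {0..<T}" for z t
      using has_derivative_compose[OF W'(2)[OF that, unfolded has_vector_derivative_def]
          has_derivative_sob_inverse[OF Suc.prems(2)[OF that]]]
      by (simp add: has_vector_derivative_def bounded_bilinear.scaleR_right[OF bounded_bilinear_sob_mult])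
    ultimately show ?case
      using cont[OF Suc.prems] by auto
  }
qed

lemma tame_sob_inverse:
  assumes G: "tame D G" and sub: "\<And>z. z \<in> D \<Longrightarrow> G z \<in> nonzero_sob"
  shows "tame D (\<lambda>z. sob_inverse (G z))"
  using G sub unfolding tame_def
  by (auto intro!: smooth_family_sob_inverse loc_lip_compose[OF _ loc_lip_sob_inverse])

section \<open>Gradients of the Hamiltonians\<close>

abbreviation phase_space :: "(hardy \<times> hardy) set" where
  "phase_space \<equiv> nonvanishing \<times> UNIV"

lemma nonvanishing_iff: "w \<in> nonvanishing \<longleftrightarrow> sob_of w \<in> nonzero_sob"
  by (simp add: nonvanishing_def nonzero_sob_def fun_sob_of)

lemma open_nonvanishing: "open nonvanishing"
proof -
  have "nonvanishing = sob_of -` nonzero_sob" by (auto simp: nonvanishing_iff)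
  then show ?thesis
    using open_vimage[OF open_nonzero_sob bounded_linear.continuous_on[OF bounded_linear_sob_of continuous_on_id]]
    by simp
qed

lemma open_phase_space: "open phase_space"
  by (simp add: open_Times open_nonvanishing)

lemma proj_pos_fun_sob: "proj_pos (fun_sob a) = fun_sob (sob_of (proj_hardy a))"
  by (simp add: fun_sob_of proj_hardy.rep_eq)

lemma proj_nonneg_fun_sob: "proj_nonneg (fun_sob a) = fun_sob (proj_sob a)"
  by (simp add: proj_sob.rep_eq)

abbreviation proj_sob_pos :: "sob \<Rightarrow> sob" where
  "proj_sob_pos a \<equiv> sob_of (proj_hardy a)"

lemma bounded_linear_proj_sob_pos: "bounded_linear proj_sob_pos"
  by (rule bounded_linear_compose[OF bounded_linear_sob_of bounded_linear_proj_hardy])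

lemmas sob_distrib =
  linear_add[OF bounded_linear.linear[OF bounded_linear_proj_sob_pos]]
  linear_diff[OF bounded_linear.linear[OF bounded_linear_proj_sob_pos]]
  linear_neg[OF bounded_linear.linear[OF bounded_linear_proj_sob_pos]]
  linear_add[OF bounded_linear.linear[OF bounded_linear_proj_sob]]
  linear_diff[OF bounded_linear.linear[OF bounded_linear_proj_sob]]
  linear_neg[OF bounded_linear.linear[OF bounded_linear_proj_sob]]
  bounded_bilinear.add_left[OF bounded_bilinear_sob_pairing]
  bounded_bilinear.diff_left[OF bounded_bilinear_sob_pairing]
  bounded_bilinear.minus_left[OF bounded_bilinear_sob_pairing]
  bounded_bilinear.add_right[OF bounded_bilinear_sob_pairing]
  bounded_bilinear.diff_right[OF bounded_bilinear_sob_pairing]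
  bounded_bilinear.minus_right[OF bounded_bilinear_sob_pairing]

lemmas sob_derivative =
  bounded_linear.has_derivative[OF bounded_linear_sob_of]
  bounded_linear.has_derivative[OF bounded_linear_proj_hardy]
  bounded_linear.has_derivative[OF bounded_linear_proj_sob]
  bounded_linear.has_derivative[OF bounded_linear_reflect]
  bounded_bilinear.FDERIV[OF bounded_bilinear_sob_mult]
  bounded_bilinear.FDERIV[OF bounded_bilinear_sob_pairing]

text \<open>Any two-sided \<open>g\<close> representing the derivative will do: directions in
  \<open>hardy\<close> do not see its nonpositive frequencies, and \<open>proj_hardy\<close> can be
  moved across the pairing.\<close>

lemma is_gradient_atI:
  assumes "(G has_derivative (\<lambda>\<delta>. sob_pairing g (sob_of \<delta>))) (at u)"
  shows "is_gradient_at G u (proj_hardy g)"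
proof -
  have "pairing (fun_of (proj_hardy g)) (fun_of \<delta>) = sob_pairing g (sob_of \<delta>)" for \<delta>
    unfolding fun_sob_of[symmetric] pairing_fun_sob sob_pairing_proj_hardy proj_hardy_sob_of ..
  then show ?thesis using assms by (simp add: is_gradient_at_def)
qed

lemma H1_fourier_basis: "fourier_basis m \<in> H1"
proof -
  have "(\<lambda>k. (cmod (fourier_coeff (fourier_basis m) k))\<^sup>2 * (jap k)\<^sup>2) summable_on UNIV"
    unfolding fourier_coeff_basis
    by (rule summable_on_cong_neutral[THEN iffD1, OF _ _ _ summable_on_finite[of "{m}"]]) auto
  then show ?thesis
    unfolding H1_def using fourier_basis_periodic[of m] by (auto intro!: continuous_intros)
qed

lift_definition sob_basis :: "int \<Rightarrow> sob" is fourier_basis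
  by (rule H1_fourier_basis)

lemma norm_sob_basis: "norm (sob_basis m) = jap m"
proof -
  have "(norm (sob_basis m))\<^sup>2 = (\<Sum>\<^sub>\<infinity>k\<in>{m}. (jap k)\<^sup>2)"
    unfolding norm_sob_sq sob_basis.rep_eq fourier_coeff_basis by (intro infsum_cong_neutral) auto
  then show ?thesis by (simp add: jap_nonneg)
qed

lemma sob_pairing_basis: "sob_pairing a (sob_basis m) = sob_coeff a m"
proof -
  have "fun_sob (a * reflect (sob_basis m)) = (\<lambda>y. fourier_basis (- m) y * fun_sob a y)"
    by (simp add: fun_eq_iff fun_sob_mult reflect.rep_eq sob_basis.rep_eq)
  then show ?thesis
    using fourier_coeff_basis_mult[of "- m" "fun_sob a" 0] by (simp add: sob_pairing_def)
qed

lemma sob_pairing_1: "sob_pairing a 1 = sob_coeff a 0"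
proof -
  have "reflect 1 = (1 :: sob)" by transfer simp
  then show ?thesis by (simp add: sob_pairing_def)
qed

text \<open>Projected exponentials are admissible directions, and moving the projection back shows
  that each one extracts a coefficient. Uniqueness turns the relation \<open>is_ham_vector\<close>
  into a vector field, and the Hamiltonian equation into an ordinary differential equation.\<close>

lemma is_gradient_at_unique:
  assumes "is_gradient_at G u g" "is_gradient_at G u h"
  shows "g = h"
proof -
  have "(\<lambda>\<delta>. pairing (fun_of g) (fun_of \<delta>)) = (\<lambda>\<delta>. pairing (fun_of h) (fun_of \<delta>))"
    using assms has_derivative_unique unfolding is_gradient_at_def by blast
  then have eq: "sob_pairing (sob_of g) (sob_of \<delta>) = sob_pairing (sob_of h) (sob_of \<delta>)" for \<delta>
    by (auto dest!: fun_cong[of _ _ \<delta>] simp: fun_sob_of[symmetric] pairing_fun_sob)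
  have "sob_coeff (sob_of g) k = sob_coeff (sob_of h) k" for k
    using eq[of "proj_hardy (sob_basis k)"]
    by (simp add: sob_pairing_proj_hardy[symmetric] proj_hardy_sob_of sob_pairing_basis)
  then show ?thesis using sob_eqI sob_of_inject by blast
qed

text \<open>Here \<open>gw\<close> and \<open>gp\<close> are two-sided representatives of the
  gradients. The flow is obtained from \<open>local_flow\<close> before any order is chosen, as the
  definition demands a single solution map for all \<open>l\<close>.\<close>

lemma locally_well_posedI:
  assumes gw: "\<And>w p. w \<in> nonvanishing \<Longrightarrow> is_gradient_at (\<lambda>w. F w p) w (proj_hardy (gw (w, p)))"
    and gp: "\<And>w p. w \<in> nonvanishing \<Longrightarrow> is_gradient_at (\<lambda>p. F w p) p (proj_hardy (gp (w, p)))"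
    and tame: "tame phase_space gw" "tame phase_space gp"
  shows "locally_well_posed F"
proof -
  define X where "X z = (proj_hardy (gp z), - proj_hardy (gw z))" for z
  have X: "tame phase_space X"
    unfolding X_def
    by (intro tame_Pair tame_uminus tame_linear_compose[OF bounded_linear_proj_hardy] tame)
  then have lip: "loc_lip phase_space X" by (simp add: tame_def)
  have ham: "is_ham_vector F z v \<longleftrightarrow> v = X z" if "z \<in> phase_space" for z v
    using gw[of "fst z" "snd z"] gp[of "fst z" "snd z"] that
    by (auto simp: is_ham_vector_def X_def dest: is_gradient_at_unique)
  show ?thesis
    unfolding locally_well_posed_def
  proof
    fix z assume z: "z \<in> phase_space"
    obtain r T \<Phi> where r: "r > 0" "T > 0" "ball z r \<subseteq> phase_space"
      and \<Phi>0: "\<And>z0. z0 \<in> ball z r \<Longrightarrow> \<Phi> z0 0 = z0"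
      and \<Phi>D: "\<And>z0 t. z0 \<in> ball z r \<Longrightarrow> t \<in> {0..<T} \<Longrightarrow> \<Phi> z0 t \<in> phase_space"
      and \<Phi>': "\<And>z0 t. z0 \<in> ball z r \<Longrightarrow> t \<in> {0..<T} \<Longrightarrow>
        (\<Phi> z0 has_vector_derivative X (\<Phi> z0 t)) (at t within {0..<T})"
      and smooth: "\<And>l. smooth_family l (ball z r) T \<Phi>"
      using local_flow[OF X open_phase_space z] by metis
    let ?\<Phi> = "\<lambda>z0. restrict (\<Phi> z0) {0..<T}"
    have sol: "ham_solution F T z0 (?\<Phi> z0)" if z0: "z0 \<in> ball z r" for z0
      unfolding ham_solution_def
    proof (intro conjI ballI)
      show "?\<Phi> z0 0 = z0" using r(2) \<Phi>0[OF z0] by simp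
      fix t assume t: "t \<in> {0..<T}"
      have "(?\<Phi> z0 has_vector_derivative X (\<Phi> z0 t)) (at t within {0..<T})"
        by (rule has_vector_derivative_transform[OF t _ \<Phi>'[OF z0 t]]) simp
      then show "\<exists>v. is_ham_vector F (?\<Phi> z0 t) v \<and> (?\<Phi> z0 has_vector_derivative v) (at t within {0..<T})"
        using t ham[OF \<Phi>D[OF z0 t]] by auto
    qed
    have uniq: "u = ?\<Phi> z0"
      if z0: "z0 \<in> ball z r" and u: "u \<in> C_space l T phase_space" "ham_solution F T z0 u" for z0 u l
    proof -
      have uE: "u \<in> {0..<T} \<rightarrow>\<^sub>E phase_space" using u(1) by (simp add: C_space_def)
      have "u t = \<Phi> z0 t" if "t \<in> {0..<T}" for t
      proof (rule integral_curve_unique[OF lip open_phase_space _ _ _ that])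
        fix s assume s: "s \<in> {0..<T}"
        have us: "u s \<in> phase_space" using uE s by (rule PiE_mem)
        obtain v where "is_ham_vector F (u s) v" "(u has_vector_derivative v) (at s within {0..<T})"
          using u(2) s unfolding ham_solution_def by blast
        with us show "u s \<in> phase_space \<and> (u has_vector_derivative X (u s)) (at s within {0..<T})"
          unfolding ham[OF us] by blast
        show "\<Phi> z0 s \<in> phase_space \<and> (\<Phi> z0 has_vector_derivative X (\<Phi> z0 s)) (at s within {0..<T})"
          using \<Phi>D[OF z0 s] \<Phi>'[OF z0 s] by blast
      next
        show "u 0 = \<Phi> z0 0" using u(2) \<Phi>0[OF z0] by (simp add: ham_solution_def)
      qed
      then show ?thesis using uE by (intro extensionalityI[of _ "{0..<T}"]) (auto simp: PiE_iff)
    qed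
    show "\<exists>V T. openin (top_of_set phase_space) V \<and> z \<in> V \<and> T > 0 \<and>
        (\<exists>\<Phi>. \<forall>l\<ge>1.
           (\<forall>z\<^sub>0\<in>V. \<Phi> z\<^sub>0 \<in> C_space l T phase_space \<and> ham_solution F T z\<^sub>0 (\<Phi> z\<^sub>0) \<and>
              (\<forall>u \<in> C_space l T phase_space. ham_solution F T z\<^sub>0 u \<longrightarrow> u = \<Phi> z\<^sub>0)) \<and>
           continuous_map (top_of_set V) (C_topology l T phase_space) \<Phi>)"
    proof (intro exI conjI allI impI ballI)
      show "openin (top_of_set phase_space) (ball z r)" using r(3) by (intro open_subset) auto
      show "z \<in> ball z r" "T > 0" using r by auto
      fix l
      show "continuous_map (top_of_set (ball z r)) (C_topology l T phase_space) ?\<Phi>"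
        by (rule smooth_family_continuous_map[OF smooth \<Phi>D])
      fix z0 assume z0: "z0 \<in> ball z r"
      show "?\<Phi> z0 \<in> C_space l T phase_space" by (rule smooth_family_C_space[OF smooth z0 \<Phi>D[OF z0]])
      show "ham_solution F T z0 (?\<Phi> z0)" by (rule sol[OF z0])
      show "u = ?\<Phi> z0" if "u \<in> C_space l T phase_space" "ham_solution F T z0 u" for u
        by (rule uniq[OF z0 that])
    qed
  qed
qed

lemma tame_sob_of_fst: "tame D (\<lambda>z. sob_of (fst z))"
  by (rule tame_bounded_linear[OF bounded_linear_compose[OF bounded_linear_sob_of bounded_linear_fst]])

lemma tame_sob_of_snd: "tame D (\<lambda>z. sob_of (snd z))"
  by (rule tame_bounded_linear[OF bounded_linear_compose[OF bounded_linear_sob_of bounded_linear_snd]])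

lemma tame_sob_inverse_fst: "tame phase_space (\<lambda>z. sob_inverse (sob_of (fst z)))"
  by (rule tame_sob_inverse[OF tame_sob_of_fst]) (auto simp: nonvanishing_iff)

lemmas tame_intros =
  tame_sob_of_fst tame_sob_of_snd tame_sob_inverse_fst tame_const tame_add tame_diff tame_uminus
  tame_bilinear[OF bounded_bilinear_sob_mult]
  tame_linear_compose[OF bounded_linear_proj_sob]
  tame_linear_compose[OF bounded_linear_proj_sob_pos]
  tame_linear_compose[OF bounded_linear_reflect]

section \<open>The Hamiltonian with potential f/w\<close>

lemma well_posed_H_ham:
  assumes f: "f \<in> H1"
  shows "locally_well_posed (H_ham f)"
proof -
  define F where "F = Abs_sob f"
  have F: "fun_sob F = f" using f by (simp add: F_def Abs_sob_inverse)
  define H where "H w p = sob_pairing (sob_of w) (sob_of p * sob_of p) + sob_pairing (F * sob_inverse (sob_of w)) 1" for w p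
  have HH: "H w p = H_ham f w p" if w: "w \<in> nonvanishing" for w p
  proof -
    have 1: "(\<lambda>y. (fun_of p y)\<^sup>2) = fun_sob (sob_of p * sob_of p)"
      by (simp add: fun_eq_iff fun_sob_mult fun_sob_of power2_eq_square)
    have 2: "(\<lambda>y. f y / fun_of w y) = fun_sob (F * sob_inverse (sob_of w))"
      using w by (simp add: fun_eq_iff fun_sob_mult fun_sob_of F fun_sob_inverse nonvanishing_iff)
    show ?thesis
      unfolding H_def H_ham_def 1 2 sob_pairing_1
      by (simp add: fun_sob_of[symmetric] pairing_fun_sob fourier_coeff_def)
  qed
  \<comment> \<open>Up to projection the gradients are 2 w(y) p(-y) in \<open>p\<close> and p(y)^2 -
    (f/w^2)(-y) in \<open>w\<close>. The reflections arise from moving a factor to the other side of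
    the pairing.\<close>
  define gp where "gp z = reflect (sob_of (snd z)) * sob_of (fst z) + reflect (sob_of (snd z)) * sob_of (fst z)" for z
  define gw where "gw z = sob_of (snd z) * sob_of (snd z)
      - reflect (F * (sob_inverse (sob_of (fst z)) * sob_inverse (sob_of (fst z))))" for z
  show ?thesis
  proof (rule locally_well_posedI[where gw = gw and gp = gp])
    fix w p :: hardy assume w: "w \<in> nonvanishing"
    let ?W = "sob_of w" and ?P = "sob_of p" and ?v = "sob_inverse (sob_of w)"
    have "((\<lambda>p. H w p) has_derivative (\<lambda>\<delta>. sob_pairing (gp (w, p)) (sob_of \<delta>))) (at p)"
      unfolding H_def
    proof (rule has_derivative_eq_rhs)
      show "((\<lambda>p. sob_pairing ?W (sob_of p * sob_of p) + sob_pairing (F * ?v) 1) has_derivative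
          (\<lambda>\<delta>. sob_pairing ?W (?P * sob_of \<delta> + sob_of \<delta> * ?P) + sob_pairing 0 (?P * ?P) + 0)) (at p)"
        by (intro has_derivative_add has_derivative_const sob_derivative has_derivative_ident)
      show "(\<lambda>\<delta>. sob_pairing ?W (?P * sob_of \<delta> + sob_of \<delta> * ?P) + sob_pairing 0 (?P * ?P) + 0)
          = (\<lambda>\<delta>. sob_pairing (gp (w, p)) (sob_of \<delta>))"
      proof
        fix \<delta>
        have "sob_pairing ?W (?P * sob_of \<delta>) = sob_pairing (reflect ?P * ?W) (sob_of \<delta>)"
          by (metis sob_pairing_commute sob_pairing_mult)
        then show "sob_pairing ?W (?P * sob_of \<delta> + sob_of \<delta> * ?P) + sob_pairing 0 (?P * ?P) + 0
            = sob_pairing (gp (w, p)) (sob_of \<delta>)"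
          unfolding gp_def fst_conv snd_conv mult.commute[of "sob_of \<delta>"] sob_distrib
          by (simp only: bounded_bilinear.zero_left[OF bounded_bilinear_sob_pairing] add_0_right)
      qed
    qed
    then show "is_gradient_at (\<lambda>p. H_ham f w p) p (proj_hardy (gp (w, p)))"
      unfolding HH[OF w] by (rule is_gradient_atI)
    have "((\<lambda>w. H w p) has_derivative (\<lambda>\<delta>. sob_pairing (gw (w, p)) (sob_of \<delta>))) (at w)"
      unfolding H_def
    proof (rule has_derivative_eq_rhs)
      have v: "((\<lambda>w. sob_inverse (sob_of w)) has_derivative (\<lambda>\<delta>. - (?v * ?v * sob_of \<delta>))) (at w)"
        by (rule has_derivative_compose[OF sob_derivative(1)[OF has_derivative_ident]
              has_derivative_sob_inverse[OF w[unfolded nonvanishing_iff]]])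
      show "((\<lambda>w. sob_pairing (sob_of w) (?P * ?P) + sob_pairing (F * sob_inverse (sob_of w)) 1) has_derivative
          (\<lambda>\<delta>. (sob_pairing ?W 0 + sob_pairing (sob_of \<delta>) (?P * ?P)) +
            (sob_pairing (F * ?v) 0 + sob_pairing (F * (- (?v * ?v * sob_of \<delta>)) + 0 * ?v) 1))) (at w)"
        by (intro has_derivative_add has_derivative_const sob_derivative(1,5,6) has_derivative_ident v)
      show "(\<lambda>\<delta>. (sob_pairing ?W 0 + sob_pairing (sob_of \<delta>) (?P * ?P)) +
            (sob_pairing (F * ?v) 0 + sob_pairing (F * (- (?v * ?v * sob_of \<delta>)) + 0 * ?v) 1))
          = (\<lambda>\<delta>. sob_pairing (gw (w, p)) (sob_of \<delta>))"
      proof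
        fix \<delta>
        have "sob_pairing (F * (?v * ?v) * sob_of \<delta>) 1 = sob_pairing (sob_of \<delta>) (reflect (F * (?v * ?v)))"
          by (simp add: sob_pairing_mult)
        then show "(sob_pairing ?W 0 + sob_pairing (sob_of \<delta>) (?P * ?P)) +
            (sob_pairing (F * ?v) 0 + sob_pairing (F * (- (?v * ?v * sob_of \<delta>)) + 0 * ?v) 1)
          = sob_pairing (gw (w, p)) (sob_of \<delta>)"
          by (simp add: gw_def sob_distrib bounded_bilinear.zero_right[OF bounded_bilinear_sob_pairing]
              mult.assoc sob_pairing_commute[of "sob_of \<delta>"])
      qed
    qed
    \<comment> \<open>\<open>H\<close> agrees with \<open>H_ham f\<close> where \<open>w\<close>
      does not vanish. That set is open, so the derivative at \<open>w\<close> carries over.\<close>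
    then have "((\<lambda>w. H_ham f w p) has_derivative (\<lambda>\<delta>. sob_pairing (gw (w, p)) (sob_of \<delta>))) (at w)"
      by (rule has_derivative_transform_within_open[OF _ open_nonvanishing w]) (rule HH)
    then show "is_gradient_at (\<lambda>w. H_ham f w p) w (proj_hardy (gw (w, p)))"
      by (rule is_gradient_atI)
  qed (unfold gw_def gp_def, (intro tame_intros)+)
qed

text \<open>With \<open>C\<close> the function \<open>y \<mapsto> exp (2 \<pi> i (k + 1) y)\<close>, \<open>tail_shift C\<close> is
  \<open>\<Pi>\<^sup>+ L\<^sup>k\<^sup>+\<^sup>1\<close> and the following is \<open>J\<^sup>f\<^sub>k\<close>. It is linear in \<open>C\<close>, so the generating
  function \<open>J\<^sup>f(\<mu>)\<close> is again of this form.\<close>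

definition tail_shift :: "sob \<Rightarrow> sob \<Rightarrow> sob" where
  "tail_shift C a = proj_sob (reflect C * a)"

definition J_fun :: "sob \<Rightarrow> sob \<Rightarrow> sob \<Rightarrow> sob \<Rightarrow> sob \<Rightarrow> complex" where
  "J_fun F C w v p =
     sob_pairing (proj_sob_pos (w * reflect p) * tail_shift C w - w * tail_shift C (proj_sob_pos (w * reflect p))) p
     - sob_pairing (w * proj_sob_pos (F * v)) C"

section \<open>Gradients of the functions \<open>J_fun\<close>\<close>

lemma sob_pairing_mult': "sob_pairing (a * b) c = sob_pairing a (reflect b * c)"
  by (subst mult.commute) (rule sob_pairing_mult)

lemma sob_pairing_tail_shift: "sob_pairing (tail_shift C a) b = sob_pairing a (C * proj_sob b)"
  by (simp add: tail_shift_def sob_pairing_proj_sob sob_pairing_mult)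

text \<open>The interaction term is quadratic in \<open>p\<close>. The first bracket comes from
  varying the right argument of the pairing; the second, from varying \<open>p\<close> inside the
  projection of \<open>w * reflect p\<close>, applies the adjoints in reverse order.\<close>

definition J_grad_p :: "sob \<Rightarrow> sob \<Rightarrow> sob \<Rightarrow> sob" where
  "J_grad_p C w p =
     (proj_sob_pos (w * reflect p) * tail_shift C w - w * tail_shift C (proj_sob_pos (w * reflect p)))
     + (w * reflect (proj_sob_pos (reflect (tail_shift C w) * p))
       - w * reflect (proj_sob_pos (C * proj_sob (reflect w * p))))"

text \<open>One bracket for each of the three products in \<open>J_fun\<close>, with one summand for
  each occurrence of \<open>w\<close>. In the last bracket \<open>v\<close> stands for 1/w, and the
  inner minus sign is that of the derivative of inversion.\<close>

definition J_grad_w :: "sob \<Rightarrow> sob \<Rightarrow> sob \<Rightarrow> sob \<Rightarrow> sob \<Rightarrow> sob" where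
  "J_grad_w F C w v p =
     (C * proj_sob (reflect (proj_sob_pos (w * reflect p)) * p)
       + p * proj_sob_pos (reflect (tail_shift C w) * p))
     - (reflect (tail_shift C (proj_sob_pos (w * reflect p))) * p
       + p * proj_sob_pos (C * proj_sob (reflect w * p)))
     - (reflect (proj_sob_pos (F * v)) * C
       - reflect (F * (v * v)) * proj_sob_pos (reflect w * C))"

lemma has_derivative_J_fun_p:
  "((\<lambda>p. J_fun F C w v (sob_of p)) has_derivative (\<lambda>\<delta>. sob_pairing (J_grad_p C w (sob_of p)) (sob_of \<delta>))) (at p)"
proof (rule has_derivative_eq_rhs)
  let ?P = "sob_of p" and ?d = sob_of
  let ?G = "\<lambda>p. proj_sob_pos (w * reflect p)"
  let ?A = "\<lambda>g. g * tail_shift C w - w * tail_shift C g"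
  have d: "((\<lambda>p. ?A (?G (sob_of p))) has_derivative (\<lambda>\<delta>. ?A (?G (?d \<delta>)))) (at p)"
    unfolding tail_shift_def
    by (rule has_derivative_eq_rhs, (rule sob_derivative(1-5) has_derivative_diff has_derivative_const has_derivative_ident)+)
      simp
  show "((\<lambda>p. J_fun F C w v (sob_of p)) has_derivative
      (\<lambda>\<delta>. sob_pairing (?A (?G ?P)) (?d \<delta>) + sob_pairing (?A (?G (?d \<delta>))) ?P - 0)) (at p)"
    unfolding J_fun_def
    by (intro has_derivative_diff has_derivative_const sob_derivative(6) d sob_derivative(1) has_derivative_ident)
  show "(\<lambda>\<delta>. sob_pairing (?A (?G ?P)) (?d \<delta>) + sob_pairing (?A (?G (?d \<delta>))) ?P - 0)
      = (\<lambda>\<delta>. sob_pairing (J_grad_p C w ?P) (?d \<delta>))"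
  proof
    fix \<delta>
    \<comment> \<open>The direction occurs reflected: moving \<open>w\<close> across the pairing and
      then the reflection leaves \<open>w * reflect b\<close>.\<close>
    have adj: "sob_pairing (w * reflect (?d \<delta>)) b = sob_pairing (w * reflect b) (?d \<delta>)" for b
      by (simp only: sob_pairing_mult[of w "reflect (?d \<delta>)"] sob_pairing_reflect reflect_mult reflect_reflect
          sob_pairing_commute[of "?d \<delta>"])
    have 1: "sob_pairing (?G (?d \<delta>) * tail_shift C w) ?P
        = sob_pairing (w * reflect (proj_sob_pos (reflect (tail_shift C w) * ?P))) (?d \<delta>)"
      by (simp only: sob_pairing_mult'[of "?G (?d \<delta>)"] sob_pairing_proj_hardy adj)
    have 2: "sob_pairing (w * tail_shift C (?G (?d \<delta>))) ?P
        = sob_pairing (w * reflect (proj_sob_pos (C * proj_sob (reflect w * ?P)))) (?d \<delta>)"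
      by (simp only: sob_pairing_mult[of w "tail_shift C (?G (?d \<delta>))"] sob_pairing_tail_shift
          sob_pairing_proj_hardy adj)
    show "sob_pairing (?A (?G ?P)) (?d \<delta>) + sob_pairing (?A (?G (?d \<delta>))) ?P - 0
      = sob_pairing (J_grad_p C w ?P) (?d \<delta>)"
      unfolding J_grad_p_def sob_distrib 1 2 by simp
  qed
qed

lemma has_derivative_J_fun_w:
  assumes w: "w \<in> nonvanishing"
  shows "((\<lambda>w. J_fun F C (sob_of w) (sob_inverse (sob_of w)) p) has_derivative
    (\<lambda>\<delta>. sob_pairing (J_grad_w F C (sob_of w) (sob_inverse (sob_of w)) p) (sob_of \<delta>))) (at w)"
proof (rule has_derivative_eq_rhs)
  let ?W = "sob_of w" and ?v = "sob_inverse (sob_of w)" and ?d = sob_of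
  let ?G = "\<lambda>w. proj_sob_pos (w * reflect p)"
  let ?Q = "proj_sob_pos (F * ?v)"
  have v: "((\<lambda>w. sob_inverse (sob_of w)) has_derivative (\<lambda>\<delta>. - (?v * ?v * ?d \<delta>))) (at w)"
    by (rule has_derivative_compose[OF sob_derivative(1)[OF has_derivative_ident]
          has_derivative_sob_inverse[OF w[unfolded nonvanishing_iff]]])
  have W: "(sob_of has_derivative ?d) (at w)"
    by (rule sob_derivative(1)[OF has_derivative_ident])
  have G: "((\<lambda>w. ?G (sob_of w)) has_derivative (\<lambda>\<delta>. ?G (?d \<delta>))) (at w)"
    by (rule has_derivative_eq_rhs, (rule sob_derivative(1-5) has_derivative_const has_derivative_ident)+) simp
  have S: "((\<lambda>w. tail_shift C (g w)) has_derivative (\<lambda>\<delta>. tail_shift C (g' \<delta>))) (at w)"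
    if "(g has_derivative g') (at w)" for g g'
    unfolding tail_shift_def
    by (rule has_derivative_eq_rhs, (rule sob_derivative(3,5) has_derivative_const that)+) simp
  have Q: "((\<lambda>w. proj_sob_pos (F * sob_inverse (sob_of w))) has_derivative (\<lambda>\<delta>. proj_sob_pos (F * - (?v * ?v * ?d \<delta>)))) (at w)"
    by (rule has_derivative_eq_rhs, (rule sob_derivative(1,2,5) has_derivative_const v)+) simp
  show "((\<lambda>w. J_fun F C (sob_of w) (sob_inverse (sob_of w)) p) has_derivative
      (\<lambda>\<delta>. (sob_pairing (?G ?W * tail_shift C ?W - ?W * tail_shift C (?G ?W)) 0
        + sob_pairing ((?G ?W * tail_shift C (?d \<delta>) + ?G (?d \<delta>) * tail_shift C ?W)
            - (?W * tail_shift C (?G (?d \<delta>)) + ?d \<delta> * tail_shift C (?G ?W))) p)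
        - (sob_pairing (?W * ?Q) 0 + sob_pairing (?W * proj_sob_pos (F * - (?v * ?v * ?d \<delta>)) + ?d \<delta> * ?Q) C))) (at w)"
    unfolding J_fun_def
    by (intro has_derivative_diff sob_derivative(5,6) has_derivative_const W G S Q)
  show "(\<lambda>\<delta>. (sob_pairing (?G ?W * tail_shift C ?W - ?W * tail_shift C (?G ?W)) 0
        + sob_pairing ((?G ?W * tail_shift C (?d \<delta>) + ?G (?d \<delta>) * tail_shift C ?W)
            - (?W * tail_shift C (?G (?d \<delta>)) + ?d \<delta> * tail_shift C (?G ?W))) p)
        - (sob_pairing (?W * ?Q) 0 + sob_pairing (?W * proj_sob_pos (F * - (?v * ?v * ?d \<delta>)) + ?d \<delta> * ?Q) C))
      = (\<lambda>\<delta>. sob_pairing (J_grad_w F C ?W ?v p) (?d \<delta>))"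
  proof
    fix \<delta>
    have 1: "sob_pairing (?G ?W * tail_shift C (?d \<delta>)) p = sob_pairing (C * proj_sob (reflect (?G ?W) * p)) (?d \<delta>)"
      by (simp only: sob_pairing_mult[of "?G ?W"] sob_pairing_tail_shift sob_pairing_commute[of "?d \<delta>"])
    have 2: "sob_pairing (?G (?d \<delta>) * tail_shift C ?W) p = sob_pairing (p * proj_sob_pos (reflect (tail_shift C ?W) * p)) (?d \<delta>)"
      by (simp only: sob_pairing_mult'[of "?G (?d \<delta>)"] sob_pairing_proj_hardy sob_pairing_mult'[of "?d \<delta>"]
          reflect_reflect sob_pairing_commute[of "?d \<delta>"])
    have 3: "sob_pairing (?W * tail_shift C (?G (?d \<delta>))) p = sob_pairing (p * proj_sob_pos (C * proj_sob (reflect ?W * p))) (?d \<delta>)"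
      by (simp only: sob_pairing_mult[of ?W] sob_pairing_tail_shift sob_pairing_proj_hardy sob_pairing_mult'[of "?d \<delta>"]
          reflect_reflect sob_pairing_commute[of "?d \<delta>"])
    have 4: "sob_pairing (?d \<delta> * a) b = sob_pairing (reflect a * b) (?d \<delta>)" for a b
      by (simp only: sob_pairing_mult'[of "?d \<delta>"] sob_pairing_commute[of "?d \<delta>"])
    have 5: "sob_pairing (?W * proj_sob_pos (F * - (?v * ?v * ?d \<delta>))) C
        = - sob_pairing (reflect (F * (?v * ?v)) * proj_sob_pos (reflect ?W * C)) (?d \<delta>)"
    proof -
      have "F * - (?v * ?v * ?d \<delta>) = - (?d \<delta> * (F * (?v * ?v)))" by (simp add: mult_ac)
      then show ?thesis
        by (simp only: sob_pairing_mult[of ?W] sob_pairing_proj_hardy sob_distrib 4)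
    qed
    show "(sob_pairing (?G ?W * tail_shift C ?W - ?W * tail_shift C (?G ?W)) 0
        + sob_pairing ((?G ?W * tail_shift C (?d \<delta>) + ?G (?d \<delta>) * tail_shift C ?W)
            - (?W * tail_shift C (?G (?d \<delta>)) + ?d \<delta> * tail_shift C (?G ?W))) p)
        - (sob_pairing (?W * ?Q) 0 + sob_pairing (?W * proj_sob_pos (F * - (?v * ?v * ?d \<delta>)) + ?d \<delta> * ?Q) C)
      = sob_pairing (J_grad_w F C ?W ?v p) (?d \<delta>)"
      unfolding J_grad_w_def bounded_bilinear.zero_right[OF bounded_bilinear_sob_pairing]
        bounded_bilinear.add_left[OF bounded_bilinear_sob_pairing]
        bounded_bilinear.diff_left[OF bounded_bilinear_sob_pairing] 1 2 3 4 5
      by simp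
  qed
qed

lemma well_posed_J_fun:
  assumes J: "\<And>w p. w \<in> nonvanishing \<Longrightarrow> J w p = J_fun F C (sob_of w) (sob_inverse (sob_of w)) (sob_of p)"
  shows "locally_well_posed J"
proof (rule locally_well_posedI[where
      gw = "\<lambda>z. J_grad_w F C (sob_of (fst z)) (sob_inverse (sob_of (fst z))) (sob_of (snd z))"
      and gp = "\<lambda>z. J_grad_p C (sob_of (fst z)) (sob_of (snd z))"])
  fix w p :: hardy assume w: "w \<in> nonvanishing"
  show "is_gradient_at (J w) p (proj_hardy (J_grad_p C (sob_of (fst (w, p))) (sob_of (snd (w, p)))))"
    unfolding J[OF w] fst_conv snd_conv by (intro is_gradient_atI has_derivative_J_fun_p)
  have "((\<lambda>w. J w p) has_derivative
      (\<lambda>\<delta>. sob_pairing (J_grad_w F C (sob_of w) (sob_inverse (sob_of w)) (sob_of p)) (sob_of \<delta>))) (at w)"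
    by (rule has_derivative_transform_within_open[OF has_derivative_J_fun_w[OF w] open_nonvanishing w])
      (simp add: J)
  then show "is_gradient_at (\<lambda>w. J w p) w
      (proj_hardy (J_grad_w F C (sob_of (fst (w, p))) (sob_inverse (sob_of (fst (w, p)))) (sob_of (snd (w, p)))))"
    unfolding fst_conv snd_conv by (rule is_gradient_atI)
qed (unfold J_grad_w_def J_grad_p_def tail_shift_def, (intro tame_intros)+)

section \<open>The functions J_k and their generating function\<close>

lemma shift_funpow: "(shift ^^ n) h y = h y * exp (- 2 * pi * \<i> * of_nat n * of_real y)"
  by (induction n arbitrary: h) (simp_all add: shift_def exp_add[symmetric] algebra_simps)

text \<open>One exponential encodes both occurrences of the index: multiplication by its reflection
  is the (k + 1)-fold shift, and pairing with it extracts the coefficient at k + 1.\<close>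

lemma J_ham_eq_J_fun:
  assumes w: "w \<in> nonvanishing" and F: "fun_sob F = f"
  shows "J_ham f k w p = J_fun F (sob_basis (int k + 1)) (sob_of w) (sob_inverse (sob_of w)) (sob_of p)"
proof -
  let ?C = "sob_basis (int k + 1)" and ?W = "sob_of w" and ?P = "sob_of p"
  have sh: "proj_nonneg ((shift ^^ (k + 1)) (fun_sob a)) = fun_sob (tail_shift ?C a)" for a
  proof -
    have "(shift ^^ (k + 1)) (fun_sob a) = fun_sob (reflect ?C * a)"
      by (simp add: fun_eq_iff shift_funpow fun_sob_mult reflect.rep_eq sob_basis.rep_eq algebra_simps del: funpow.simps)
    then show ?thesis by (simp only: proj_nonneg_fun_sob tail_shift_def)
  qed
  have G: "Gamma_op (fun_sob ?W) (fun_sob ?P) = fun_sob (proj_sob_pos (?W * reflect ?P))"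
  proof -
    have "(\<lambda>y. fun_sob ?W y * fun_sob ?P (- y)) = fun_sob (?W * reflect ?P)"
      by (simp add: fun_eq_iff fun_sob_mult reflect.rep_eq)
    then show ?thesis by (simp only: Gamma_op_def proj_pos_fun_sob)
  qed
  have A: "A_op k (fun_sob ?W) (fun_sob g) = fun_sob (g * tail_shift ?C ?W - ?W * tail_shift ?C g)" for g
    unfolding fun_eq_iff A_op_def sh by (simp add: fun_sob_diff fun_sob_mult)
  have Q: "(\<lambda>y. fun_sob ?W y * proj_pos (\<lambda>x. f x / fun_sob ?W x) y) = fun_sob (?W * proj_sob_pos (F * sob_inverse ?W))"
  proof -
    have eq: "(\<lambda>y. f y / fun_sob ?W y) = fun_sob (F * sob_inverse ?W)"
      using w by (simp add: fun_eq_iff fun_sob_mult F fun_sob_inverse nonvanishing_iff)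
    show ?thesis unfolding eq proj_pos_fun_sob by (simp add: fun_eq_iff fun_sob_mult)
  qed
  show ?thesis
    unfolding J_ham_def I_fun_def fun_sob_of[symmetric] G A Q pairing_fun_sob J_fun_def sob_pairing_basis ..
qed

lemma norm_sob_const_mult: "norm (sob_const c * a) = cmod c * norm a"
  by (simp add: norm_sob.rep_eq times_sob.rep_eq sob_const.rep_eq H1_norm_cmult)

text \<open>\<open>bounded_linear\<close> supplies homogeneity over the reals only, whereas the
  powers of \<mu> are complex; they are moved into \<open>C\<close> as constant functions.\<close>

lemma J_fun_const_mult: "J_fun F (sob_const c * C) w v p = c * J_fun F C w v p"
proof -
  have r: "reflect (sob_const c * C) = sob_const c * reflect C" by transfer simp
  have s: "tail_shift (sob_const c * C) a = sob_const c * tail_shift C a" for a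
    unfolding tail_shift_def r
    by (rule sob_eqI) (simp add: sob_coeff_proj_sob sob_coeff_const_mult mult.assoc)
  have p: "sob_pairing (sob_const c * a) b = c * sob_pairing a b" for a b
    by (simp add: sob_pairing_def sob_coeff_const_mult mult.assoc)
  have p': "sob_pairing a (sob_const c * b) = c * sob_pairing a b" for a b
    by (metis p sob_pairing_commute)
  let ?G = "proj_sob_pos (w * reflect p)"
  have d: "?G * (sob_const c * tail_shift C w) - w * (sob_const c * tail_shift C ?G)
      = sob_const c * (?G * tail_shift C w - w * tail_shift C ?G)"
    by (simp add: algebra_simps)
  show ?thesis
    unfolding J_fun_def s p' d p by (rule right_diff_distrib[symmetric])
qed

lemma bounded_linear_J_fun: "bounded_linear (\<lambda>C. J_fun F C w v p)"
  unfolding J_fun_def tail_shift_def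
  by (intro bounded_linear_sub
      bounded_linear_compose[OF bounded_bilinear.bounded_linear_left[OF bounded_bilinear_sob_pairing]]
      bounded_linear_compose[OF bounded_bilinear.bounded_linear_right[OF bounded_bilinear_sob_mult]]
      bounded_linear_compose[OF bounded_bilinear.bounded_linear_left[OF bounded_bilinear_sob_mult]]
      bounded_linear_compose[OF bounded_linear_proj_sob] bounded_linear_reflect
      bounded_bilinear.bounded_linear_right[OF bounded_bilinear_sob_pairing])

theorem theorem4:
  fixes f :: "real \<Rightarrow> complex"
  assumes "f \<in> H1"
  shows "locally_well_posed (H_ham f)
    \<and> (\<forall>k\<ge>1. locally_well_posed (J_ham f k))
    \<and> (\<forall>\<mu>. cmod \<mu> < 1 \<longrightarrow> locally_well_posed (J_gen f \<mu>))"
proof (intro conjI allI impI)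
  have F: "fun_sob (Abs_sob f) = f" using assms by (simp add: Abs_sob_inverse)
  show "locally_well_posed (H_ham f)" by (rule well_posed_H_ham[OF assms])
  show "locally_well_posed (J_ham f k)" for k
    by (rule well_posed_J_fun) (rule J_ham_eq_J_fun[OF _ F])
  fix \<mu> :: complex assume \<mu>: "cmod \<mu> < 1"
  \<comment> \<open>The generating series starts at \<mu>^1, so its term number \<open>k\<close>,
    counted from 0, has index k + 1 and exponential frequency k + 2. An exponential has norm equal
    to its frequency, which gives the bound (k + 2) |\<mu>|^(k + 1), summable as a shifted
    derivative of the geometric series.\<close>
  define B where "B k = sob_const (\<mu> ^ Suc k) * sob_basis (int (Suc k) + 1)" for k
  have "summable B"
  proof (rule summable_norm_cancel, rule summable_comparison_test')
    have "summable (\<lambda>n. real (Suc n) * cmod \<mu> ^ n)"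
      using geometric_deriv_sums[of "cmod \<mu>"] \<mu> by (simp add: sums_iff)
    then show "summable (\<lambda>n. real (Suc (Suc n)) * cmod \<mu> ^ Suc n)"
      by (subst summable_Suc_iff)
    show "norm (norm (B n)) \<le> real (Suc (Suc n)) * cmod \<mu> ^ Suc n" for n
      by (simp add: B_def norm_sob_const_mult norm_sob_basis jap_def norm_power norm_mult)
  qed
  \<comment> \<open>A bounded linear map commutes with the sum, so the generating function is a
    single \<open>J_fun\<close> whose \<open>C\<close> is the sum of the series
    \<open>B\<close>.\<close>
  from bounded_linear.suminf[OF bounded_linear_J_fun this]
  have "J_gen f \<mu> w p = J_fun (Abs_sob f) (\<Sum>k. B k) (sob_of w) (sob_inverse (sob_of w)) (sob_of p)"
    if "w \<in> nonvanishing" for w p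
    unfolding J_gen_def J_ham_eq_J_fun[OF that F]
    by (simp only: B_def J_fun_const_mult mult.commute[of _ "\<mu> ^ _"])
  then show "locally_well_posed (J_gen f \<mu>)" by (rule well_posed_J_fun)
qed

end
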